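(* Let $1<p<\infty$ and let $(X,d,\mu)$ be a Cheeger space for the exponent $p$. Let $\{r_n\}_{n\ge1}$ be a sequence of positive numbers converging to zero along which the $\Gamma$-limit $\mathcal{E}_p$ of $E_{p,r_n}$ and the $\overline{\Gamma}$-limit $\Gamma_p$ of $E_{p,r_n}(\cdot,\cdot)$ exist. Then for every $f\in KS^{1,p}(X)$, $\Gamma_p(f)$ defines a finite Radon measure on $X$ (i.e. the set function $U\mapsto\Gamma_p(f)(U)$ on open sets is the restriction to open sets of a finite Radon measure on $X$, still denoted $\Gamma_p(f)$), and $$\Gamma_p(f)(X)=\mathcal{E}_p(f).$$ Moreover, there exist $C_1,C_2>0$ such that for any $f\in KS^{1,p}(X)$ and any open sets $U,V,W\subset X$ with $U\Subset V\Subset W$, $$C_1\limsup_{r\to0^+}E_{p,r}(f,U)\le\Gamma_p(f)(V)\le\liminf_{n\to\infty}E_{p,r_n}(f,V)\le C_2\liminf_{r\to0^+}E_{p,r}(f,W).$$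
   Context: Cheeger space (for $1\le p<\infty$): a locally compact, complete metric space $(X,d)$ with a Radon measure $\mu$ such that, writing $B(x,r)=\{y:d(x,y)<r\}$: (VD) there is $C>0$ with $0<\mu(B(x,2r))\le C\mu(B(x,r))<\infty$ for all $x\in X$, $r>0$; (PI) there are $C>0$, $\lambda\ge1$ such that for every Lipschitz $f$ on $X$ and every ball $B(x,R)$, $\int_{B(x,R)}|f-f_{B(x,R)}|^p d\mu\le CR^p\int_{B(x,\lambda R)}(\mathrm{Lip} f)^p d\mu$, where $f_B=\frac1{\mu(B)}\int_B f\,d\mu$ and $(\mathrm{Lip} f)(y)=\limsup_{r\to0^+}\sup_{d(x,y)\le r}\frac{|f(x)-f(y)|}{r}$. Energies: for $r>0$, $f\in L^p(X,\mu)$ and $U\subset X$ open, $E_{p,r}(f,U)=\frac1{r^p}\int_U\frac1{\mu(B(x,r))}\int_{B(x,r)}|f(y)-f(x)|^p d\mu(y)d\mu(x)$, and $E_{p,r}(f)=E_{p,r}(f,X)$. The Korevaar-Schoen space is $KS^{1,p}(X)=\{f\in L^p(X,\mu):\limsup_{r\to0^+}E_{p,r}(f)<\infty\}$. $U\Subset V$ means $\overline U$ is compact and $\overline U\subset V$; $\mathcal{O}$ is the family of open subsets of $X$. $\Gamma$-convergence: $E_n\colon L^p(X,\mu)\to[-\infty,\infty]$ $\Gamma$-converge to $E$ if (i) $E(f)\le\liminf_n E_n(f_n)$ whenever $f_n\to f$ strongly in $L^p$, and (ii) for every $f$ there is $f_n\to f$ strongly in $L^p$ with $\limsup_n E_n(f_n)\le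 E(f)$. $\overline{\Gamma}$-convergence: $E_n\colon L^p(X,\mu)\times\mathcal{O}\to[-\infty,\infty]$ $\overline\Gamma$-converge to $E$ if (i) $E(f,U)\le\liminf_nE_n(f_n,U)$ for all $U\in\mathcal{O}$ whenever $f_n\to f$ in $L^p$; (ii) for all $f$ and all $U\Subset V$ in $\mathcal{O}$ there is $f_n\to f$ in $L^p$ with $\limsup_nE_n(f_n,U)\le E(f,V)$; and $E$ is inner regular: $E(f,V)=\sup\{E(f,U):U\in\mathcal{O},U\Subset V\}$. By compactness of $\Gamma$- and $\overline\Gamma$-convergence, sequences $r_n\to0^+$ as in the claim exist. $\mathcal{E}_p$ denotes the $\Gamma$-limit of $E_{p,r_n}$ and $\Gamma_p(f)(U)=\Gamma_p(f,U)$ the $\overline\Gamma$-limit of $E_{p,r_n}(f,U)$. *)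

theory Defs
  imports "HOL-Analysis.Analysis"
begin

section \<open>Radon measures and compact containment\<close>

definition radon_measure :: "'a::topological_space measure \<Rightarrow> bool" where
  "radon_measure M \<longleftrightarrow>
     sets M = sets borel \<and>
     (\<forall>K. compact K \<longrightarrow> emeasure M K < \<infinity>) \<and>
     (\<forall>A\<in>sets borel. emeasure M A = (INF U\<in>{U. open U \<and> A \<subseteq> U}. emeasure M U)) \<and>
     (\<forall>U. open U \<longrightarrow> emeasure M U = (SUP K\<in>{K. compact K \<and> K \<subseteq> U}. emeasure M K))"

definition compactly_contained :: "'a::topological_space set \<Rightarrow> 'a set \<Rightarrow> bool"
    (infix "\<Subset>" 50) where
  "U \<Subset> V \<longleftrightarrow> compact (closure U) \<and> closure U \<subseteq> V"


section \<open>Cheeger spaces\<close>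

text \<open>For Lipschitz \<open>f\<close> the limsup below is bounded by the Lipschitz constant, so
  \<^const>\<open>enn2real\<close> loses nothing wherever this definition is used.\<close>

definition pointwise_lip :: "('a::metric_space \<Rightarrow> real) \<Rightarrow> 'a \<Rightarrow> real" where
  "pointwise_lip f y =
     enn2real (Limsup (at_right 0) (\<lambda>r. SUP x\<in>cball y r. ennreal (\<bar>f x - f y\<bar> / r)))"

definition ball_average :: "'a::metric_space measure \<Rightarrow> ('a \<Rightarrow> real) \<Rightarrow> 'a \<Rightarrow> real \<Rightarrow> real" where
  "ball_average M f x R = (1 / measure M (ball x R)) * (LINT y:ball x R|M. f y)"

definition volume_doubling :: "'a::metric_space measure \<Rightarrow> bool" where
  "volume_doubling M \<longleftrightarrow>
     (\<exists>C::real. C > 0 \<and>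
       (\<forall>x r. r > 0 \<longrightarrow>
          0 < emeasure M (ball x (2 * r)) \<and>
          emeasure M (ball x (2 * r)) \<le> ennreal C * emeasure M (ball x r) \<and>
          ennreal C * emeasure M (ball x r) < \<infinity>))"

definition poincare_inequality :: "real \<Rightarrow> 'a::metric_space measure \<Rightarrow> bool" where
  "poincare_inequality p M \<longleftrightarrow>
     (\<exists>(C::real) (l::real). C > 0 \<and> l \<ge> 1 \<and>
       (\<forall>f::'a \<Rightarrow> real. (\<exists>L. L-lipschitz_on UNIV f) \<longrightarrow>
         (\<forall>x R. R > 0 \<longrightarrow>
           (\<integral>\<^sup>+y\<in>ball x R. ennreal (\<bar>f y - ball_average M f x R\<bar> powr p) \<partial>M)
             \<le> ennreal (C * R powr p) *
                (\<integral>\<^sup>+y\<in>ball x (l * R). ennreal (pointwise_lip f y powr p) \<partial>M))))"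

text \<open>Completeness of the underlying metric space is carried by the type class.\<close>

definition cheeger_space :: "real \<Rightarrow> 'a::complete_space measure \<Rightarrow> bool" where
  "cheeger_space p M \<longleftrightarrow>
     locally_compact_space (euclidean :: 'a topology) \<and>
     radon_measure M \<and> volume_doubling M \<and> poincare_inequality p M"


section \<open>\<open>L\<^sup>p\<close>, energies and the Korevaar--Schoen space\<close>

text \<open>Elements of \<open>L\<^sup>p\<close> are represented by Borel functions, without passing to the quotient by
  almost-everywhere equality. The energies below do not depend on the representative, and
  neither do their \<open>\<Gamma>\<close>- and \<open>\<Gamma>\<close>-bar-limits: altering \<open>f\<close> on a null set does not
  change which sequences converge to it.\<close>

definition Lp :: "real \<Rightarrow> 'a measure \<Rightarrow> ('a \<Rightarrow> real) set" where
  "Lp p M = {f \<in> borel_measurable M. integrable M (\<lambda>x. \<bar>f x\<bar> powr p)}"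

definition Lp_norm :: "real \<Rightarrow> 'a measure \<Rightarrow> ('a \<Rightarrow> real) \<Rightarrow> real" where
  "Lp_norm p M f = (\<integral>x. \<bar>f x\<bar> powr p \<partial>M) powr (1 / p)"

definition Lp_converges ::
    "real \<Rightarrow> 'a measure \<Rightarrow> (nat \<Rightarrow> 'a \<Rightarrow> real) \<Rightarrow> ('a \<Rightarrow> real) \<Rightarrow> bool" where
  "Lp_converges p M fn f \<longleftrightarrow>
     (\<forall>n. fn n \<in> Lp p M) \<and> f \<in> Lp p M \<and>
     (\<lambda>n. Lp_norm p M (\<lambda>x. fn n x - f x)) \<longlonglongrightarrow> 0"

definition KS_energy ::
    "real \<Rightarrow> 'a::metric_space measure \<Rightarrow> real \<Rightarrow> ('a \<Rightarrow> real) \<Rightarrow> 'a set \<Rightarrow> ereal" where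
  "KS_energy p M r f U = enn2ereal (ennreal (1 / r powr p) *
     (\<integral>\<^sup>+x\<in>U. (1 / emeasure M (ball x r)) *
        (\<integral>\<^sup>+y\<in>ball x r. ennreal (\<bar>f y - f x\<bar> powr p) \<partial>M) \<partial>M))"

definition KS_space :: "real \<Rightarrow> 'a::metric_space measure \<Rightarrow> ('a \<Rightarrow> real) set" where
  "KS_space p M = {f \<in> Lp p M. Limsup (at_right 0) (\<lambda>r. KS_energy p M r f UNIV) < \<infinity>}"


section \<open>Variational convergence\<close>

text \<open>Only the values of the functionals at elements of \<open>L\<^sup>p\<close> and, for the localized version,
  at open sets are constrained.\<close>

definition Gamma_converges ::
    "real \<Rightarrow> 'a measure \<Rightarrow> (nat \<Rightarrow> ('a \<Rightarrow> real) \<Rightarrow> ereal) \<Rightarrow> (('a \<Rightarrow> real) \<Rightarrow> ereal) \<Rightarrow> bool" where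
  "Gamma_converges p M En E \<longleftrightarrow>
     (\<forall>f\<in>Lp p M. \<forall>fn. Lp_converges p M fn f \<longrightarrow> E f \<le> liminf (\<lambda>n. En n (fn n))) \<and>
     (\<forall>f\<in>Lp p M. \<exists>fn. Lp_converges p M fn f \<and> limsup (\<lambda>n. En n (fn n)) \<le> E f)"

definition Gamma_bar_converges ::
    "real \<Rightarrow> 'a::topological_space measure \<Rightarrow> (nat \<Rightarrow> ('a \<Rightarrow> real) \<Rightarrow> 'a set \<Rightarrow> ereal) \<Rightarrow>
     (('a \<Rightarrow> real) \<Rightarrow> 'a set \<Rightarrow> ereal) \<Rightarrow> bool" where
  "Gamma_bar_converges p M En E \<longleftrightarrow>
     (\<forall>f\<in>Lp p M. \<forall>fn. Lp_converges p M fn f \<longrightarrow>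
        (\<forall>U. open U \<longrightarrow> E f U \<le> liminf (\<lambda>n. En n (fn n) U))) \<and>
     (\<forall>f\<in>Lp p M. \<forall>U V. open U \<and> open V \<and> U \<Subset> V \<longrightarrow>
        (\<exists>fn. Lp_converges p M fn f \<and> limsup (\<lambda>n. En n (fn n) U) \<le> E f V)) \<and>
     (\<forall>f\<in>Lp p M. \<forall>V. open V \<longrightarrow> E f V = (SUP U\<in>{U. open U \<and> U \<Subset> V}. E f U))"

end

theory Submission
  imports Defs
begin

text \<open>Two estimates carry the proof. First, all energies are comparable across scales: for
  \<open>s \<le> R\<close>, \<open>E\<^sub>R(f, U)\<close> is at most a constant times \<open>E\<^sub>s(h, V) + R\<^sup>-\<^sup>p \<parallel>f - h\<parallel>\<^sup>p\<close> as soon as \<open>V\<close> contains a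
  neighbourhood of \<open>U\<close> of width comparable to \<open>R\<close>. Indeed, averaging \<open>h\<close> against a tent function
  of radius \<open>s/2\<close> gives a Lipschitz function \<open>g\<close> for which both \<open>(Lip g)\<^sup>p\<close> and \<open>s\<^sup>-\<^sup>p |g - h|\<^sup>p\<close> are
  bounded pointwise by the energy density of \<open>h\<close> at scale \<open>s\<close>, and the Poincare inequality bounds
  \<open>E\<^sub>R(g, U)\<close> by the integral of \<open>(Lip g)\<^sup>p\<close> over \<open>V\<close>. Inserting recovery sequences gives the
  two-sided bounds on the limit. Second, gluing two recovery sequences with a cutoff function costs
  only an \<open>L\<^sup>p\<close> distance, by convexity; this gives subadditivity of the limit in the open set, and
  the De Giorgi--Letta criterion then produces the measure. The total mass is \<open>\<E>\<^sub>p(f)\<close> because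
  gluing a recovery sequence on a large ball with \<open>f\<close> itself outside only adds a tail of the energy
  of \<open>f\<close>, which the first estimate bounds by the tail of a finite measure.\<close>

section \<open>Elementary inequalities\<close>

lemma convex_on_abs_powr:
  assumes "1 \<le> (p::real)"
  shows "convex_on UNIV (\<lambda>x::real. \<bar>x\<bar> powr p)"
proof -
  have nonneg: "((1 - t) * x + t * y) powr p \<le> (1 - t) * x powr p + t * y powr p"
    if "0 < t" "t < 1" "0 \<le> x" "0 \<le> y" for t x y :: real
  proof -
    have scale: "c powr p \<le> c" if "0 \<le> c" "c \<le> 1" for c :: real
      using that assms powr_mono'[of 1 p c] by simp
    consider "x = 0" | "y = 0" | "0 < x" "0 < y" using \<open>0 \<le> x\<close> \<open>0 \<le> y\<close> by linarith
    then show ?thesis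
    proof cases
      case 1
      then show ?thesis using that scale[of t]
        by (simp add: powr_mult mult_right_mono)
    next
      case 2
      then show ?thesis using that scale[of "1 - t"]
        by (simp add: powr_mult mult_right_mono)
    next
      case 3
      then show ?thesis
        using convex_onD[OF powr_convex[OF assms], of t x y] that by simp
    qed
  qed
  show ?thesis
  proof (rule convex_onI)
    fix t x y :: real assume t: "0 < t" "t < 1"
    have "\<bar>(1 - t) * x + t * y\<bar> \<le> (1 - t) * \<bar>x\<bar> + t * \<bar>y\<bar>"
      using t abs_triangle_ineq[of "(1 - t) * x" "t * y"] by (simp add: abs_mult)
    then have "\<bar>(1 - t) * x + t * y\<bar> powr p \<le> ((1 - t) * \<bar>x\<bar> + t * \<bar>y\<bar>) powr p"
      using assms by (intro powr_mono2) auto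
    also have "\<dots> \<le> (1 - t) * \<bar>x\<bar> powr p + t * \<bar>y\<bar> powr p"
      using nonneg t by simp
    finally show "\<bar>(1 - t) *\<^sub>R x + t *\<^sub>R y\<bar> powr p \<le> (1 - t) * \<bar>x\<bar> powr p + t * \<bar>y\<bar> powr p"
      by simp
  qed simp
qed

lemma abs_powr_convex:
  assumes "1 \<le> (p::real)" "0 \<le> t" "t \<le> 1"
  shows "\<bar>t * x + (1 - t) * y\<bar> powr p \<le> t * \<bar>x\<bar> powr p + (1 - t) * \<bar>y\<bar> powr p"
  using convex_onD[OF convex_on_abs_powr[OF assms(1)], of "1 - t" x y] assms by simp

lemma abs_add_powr_le:
  assumes "1 \<le> (p::real)" "0 < d" "d < 1"
  shows "\<bar>a + c\<bar> powr p \<le> (1 - d) powr (1 - p) * \<bar>a\<bar> powr p + d powr (1 - p) * \<bar>c\<bar> powr p"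
proof -
  have "\<bar>a + c\<bar> powr p = \<bar>(1 - d) * (a / (1 - d)) + (1 - (1 - d)) * (c / d)\<bar> powr p"
    using assms by simp
  also have "\<dots> \<le> (1 - d) * \<bar>a / (1 - d)\<bar> powr p + (1 - (1 - d)) * \<bar>c / d\<bar> powr p"
    using assms by (intro abs_powr_convex) auto
  also have "\<dots> = (1 - d) powr (1 - p) * \<bar>a\<bar> powr p + d powr (1 - p) * \<bar>c\<bar> powr p"
    using assms by (simp add: abs_divide powr_divide powr_diff field_simps)
  finally show ?thesis .
qed

lemma abs_powr_interpolate_le:
  assumes "1 \<le> (p::real)" "0 < d" "d < 1" "0 \<le> t" "t \<le> 1"
  shows "\<bar>t * a + (1 - t) * b + c\<bar> powr p \<le>
    (1 - d) powr (1 - p) * (t * \<bar>a\<bar> powr p + (1 - t) * \<bar>b\<bar> powr p) + d powr (1 - p) * \<bar>c\<bar> powr p"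
proof -
  have "\<bar>t * a + (1 - t) * b + c\<bar> powr p \<le>
      (1 - d) powr (1 - p) * \<bar>t * a + (1 - t) * b\<bar> powr p + d powr (1 - p) * \<bar>c\<bar> powr p"
    using assms by (intro abs_add_powr_le)
  also have "\<dots> \<le> (1 - d) powr (1 - p) * (t * \<bar>a\<bar> powr p + (1 - t) * \<bar>b\<bar> powr p)
      + d powr (1 - p) * \<bar>c\<bar> powr p"
    using assms by (intro add_right_mono mult_left_mono abs_powr_convex) auto
  finally show ?thesis .
qed

lemma abs_add_powr_le2:
  assumes "1 \<le> (p::real)"
  shows "\<bar>a + b\<bar> powr p \<le> 2 powr p * (\<bar>a\<bar> powr p + \<bar>b\<bar> powr p)"
proof -
  have "\<bar>a + b\<bar> powr p \<le> (1/2) powr (1 - p) * \<bar>a\<bar> powr p + (1/2) powr (1 - p) * \<bar>b\<bar> powr p"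
    using abs_add_powr_le[OF assms, of "1/2" a b] by simp
  also have "(1/2::real) powr (1 - p) = 2 powr (p - 1)"
    using powr_minus[of "2::real" "1 - p"] by (simp add: powr_divide inverse_eq_divide)
  also have "2 powr (p - 1) * \<bar>a\<bar> powr p + 2 powr (p - 1) * \<bar>b\<bar> powr p
      \<le> 2 powr p * \<bar>a\<bar> powr p + 2 powr p * \<bar>b\<bar> powr p"
    by (intro add_mono mult_right_mono powr_mono) auto
  finally show ?thesis by (simp add: algebra_simps)
qed

lemma powr_eq_mult_powr_minus_one: "x powr p = x * x powr (p - 1)" if "0 < x" for x p :: real
  using that by (simp add: powr_diff)

lemma powr_tangent_le:
  assumes "1 \<le> (p::real)" "0 \<le> x" "0 < a"
  shows "a powr p + p * a powr (p - 1) * (x - a) \<le> x powr p"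
proof (cases "x = 0")
  case True
  define b where "b = a powr (p - 1)"
  have "a powr p = a * b" unfolding b_def using assms by (intro powr_eq_mult_powr_minus_one)
  then have "a powr p + p * a powr (p - 1) * (0 - a) = (1 - p) * a powr p"
    unfolding b_def[symmetric] by (simp only:) (simp add: algebra_simps)
  also have "\<dots> \<le> 0" using assms by (simp add: mult_nonpos_nonneg)
  finally show ?thesis using True by simp
next
  case False
  have "x powr p - a powr p \<ge> p * a powr (p - 1) * (x - a)"
  proof (rule convex_on_imp_above_tangent[where A="{0<..}"])
    show "convex_on {0<..} (\<lambda>x. x powr p)" using powr_convex[OF assms(1)] .
    show "((\<lambda>x. x powr p) has_field_derivative p * a powr (p - 1)) (at a within {0<..})"
      by (rule has_field_derivative_at_within[OF has_real_derivative_powr[OF assms(3)]])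
  qed (use assms False in \<open>auto simp: interior_open\<close>)
  then show ?thesis by simp
qed

section \<open>Doubling metric measure spaces\<close>

locale metric_doubling =
  fixes M :: "'a::complete_space measure" and C0 :: real
  assumes sets_M [measurable_cong]: "sets M = sets borel"
    and C0_ge_1: "1 \<le> C0"
    and emeasure_ball_pos: "0 < r \<Longrightarrow> 0 < emeasure M (ball x r)"
    and emeasure_ball_finite: "emeasure M (ball x r) < \<infinity>"
    and doubling: "0 < r \<Longrightarrow> measure M (ball x (2 * r)) \<le> C0 * measure M (ball x r)"
begin

lemma space_M [simp]: "space M = UNIV"
  using sets_M by (metis sets_eq_imp_space_eq space_borel)

lemma ball_in_sets [measurable, simp]: "ball x r \<in> sets M"
  by (simp add: sets_M)

lemma emeasure_ball_eq: "emeasure M (ball x r) = ennreal (measure M (ball x r))"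
  using emeasure_ball_finite by (simp add: emeasure_eq_ennreal_measure less_top)

lemma measure_ball_pos: "0 < r \<Longrightarrow> 0 < measure M (ball x r)"
  using emeasure_ball_pos[of r x] emeasure_ball_eq[of x r] by simp

lemma measure_ball_mono: "ball x r \<subseteq> ball y s \<Longrightarrow> measure M (ball x r) \<le> measure M (ball y s)"
  using emeasure_mono[of "ball x r" "ball y s" M] emeasure_ball_eq by simp

lemma doubling_iterate:
  "0 < r \<Longrightarrow> measure M (ball x (2 ^ n * r)) \<le> C0 ^ n * measure M (ball x r)"
proof (induction n)
  case (Suc n)
  have "measure M (ball x (2 * (2 ^ n * r))) \<le> C0 * measure M (ball x (2 ^ n * r))"
    using Suc by (intro doubling) simp
  also have "\<dots> \<le> C0 * (C0 ^ n * measure M (ball x r))"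
    using Suc C0_ge_1 by (intro mult_left_mono) auto
  finally show ?case by (simp add: mult.assoc)
qed simp

lemma measure_ball_le_of_dist:
  assumes "0 < s" "dist x y + r \<le> 2 ^ n * s"
  shows "measure M (ball x r) \<le> C0 ^ n * measure M (ball y s)"
proof -
  have "ball x r \<subseteq> ball y (2 ^ n * s)"
  proof
    fix z assume "z \<in> ball x r"
    then show "z \<in> ball y (2 ^ n * s)"
      using assms dist_triangle[of y z x] by (simp add: dist_commute)
  qed
  then show ?thesis
    using measure_ball_mono doubling_iterate[OF assms(1)] order_trans by blast
qed

lemma cball_finite_net:
  fixes x :: 'a
  assumes "0 < e"
  shows "\<exists>k. finite k \<and> cball x r \<subseteq> (\<Union>y\<in>k. ball y e)"
proof (cases "0 \<le> r")
  case False
  then show ?thesis by (intro exI[of _ "{}"]) auto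
next
  case r: True
  define sep where "sep = (\<lambda>k. finite k \<and> k \<subseteq> cball x r \<and> (\<forall>y\<in>k. \<forall>z\<in>k. y \<noteq> z \<longrightarrow> e \<le> dist y z))"
  obtain n :: nat where n: "4 * (r + e) / e < 2 ^ n"
    using real_arch_pow[of 2] by auto
  define m where "m = measure M (ball x (r + e))"
  have m_pos: "0 < m" unfolding m_def using r assms by (intro measure_ball_pos) simp
  have card_le: "real (card k) \<le> C0 ^ n" if k: "sep k" for k
  proof -
    have fin: "finite k" using k sep_def by simp
    have disj: "disjoint_family_on (\<lambda>y. ball y (e/2)) k"
    proof -
      have "ball y (e/2) \<inter> ball z (e/2) = {}" if "y \<in> k" "z \<in> k" "y \<noteq> z" for y z
      proof -
        have "e \<le> dist y z" using k that by (simp add: sep_def)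
        then show ?thesis
          by (intro disjoint_ballI) simp
      qed
      then show ?thesis by (simp add: disjoint_family_on_def)
    qed
    have lower: "m \<le> C0 ^ n * measure M (ball y (e/2))" if "y \<in> k" for y
    proof -
      have "dist x y \<le> r" using that k by (auto simp: sep_def)
      then have "dist x y + (r + e) \<le> 2 * (r + e)" using assms by simp
      also have "\<dots> \<le> 2 ^ n * (e/2)" using n assms by (simp add: field_simps)
      finally show ?thesis unfolding m_def using assms by (intro measure_ball_le_of_dist) auto
    qed
    have "real (card k) * m = (\<Sum>y\<in>k. m)" by simp
    also have "\<dots> \<le> (\<Sum>y\<in>k. C0 ^ n * measure M (ball y (e/2)))"
      by (intro sum_mono lower)
    also have "\<dots> = C0 ^ n * (\<Sum>y\<in>k. measure M (ball y (e/2)))" by (simp add: sum_distrib_left)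
    also have "(\<Sum>y\<in>k. measure M (ball y (e/2))) = measure M (\<Union>y\<in>k. ball y (e/2))"
      using fin disj emeasure_ball_finite
      by (intro measure_finite_Union[symmetric]) (auto simp: less_top)
    also have "\<dots> \<le> m" unfolding m_def
    proof (rule measure_mono_fmeasurable)
      show "(\<Union>y\<in>k. ball y (e/2)) \<subseteq> ball x (r + e)"
      proof safe
        fix y z assume y: "y \<in> k" and z: "z \<in> ball y (e/2)"
        have "dist x y \<le> r" using k y by (auto simp: sep_def)
        then show "z \<in> ball x (r + e)"
          using z dist_triangle[of x z y] assms by simp
      qed
      show "ball x (r + e) \<in> fmeasurable M"
        using emeasure_ball_finite by (intro fmeasurableI) auto
    qed (use fin in auto)
    finally show ?thesis using m_pos C0_ge_1 by (simp add: mult_left_mono)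
  qed
  obtain B :: nat where B: "C0 ^ n < real B" using reals_Archimedean2 by blast
  have "\<exists>k. sep k \<and> (\<forall>k'. sep k' \<longrightarrow> card k' \<le> card k)"
  proof (rule ex_has_greatest_nat)
    show "sep {}" by (simp add: sep_def)
    show "\<forall>k. sep k \<longrightarrow> card k < B"
      using card_le B by (metis of_nat_less_iff order_le_less_trans)
  qed
  then obtain k where k: "sep k" and max: "\<And>k'. sep k' \<Longrightarrow> card k' \<le> card k" by blast
  have "cball x r \<subseteq> (\<Union>y\<in>k. ball y e)"
  proof
    fix z assume z: "z \<in> cball x r"
    show "z \<in> (\<Union>y\<in>k. ball y e)"
    proof (rule ccontr)
      assume "\<not> ?thesis"
      then have far: "e \<le> dist y z" if "y \<in> k" for y using that by (auto simp: not_less)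
      then have "z \<notin> k" using assms by force
      moreover have "sep (insert z k)"
        using k z far by (auto simp: sep_def dist_commute)
      ultimately show False using max[of "insert z k"] k by (simp add: sep_def)
    qed
  qed
  moreover have "finite k" using k by (simp add: sep_def)
  ultimately show ?thesis by blast
qed

lemma compact_cball: "compact (cball x r :: 'a set)"
proof -
  have "complete (cball x r)" using complete_eq_closed closed_cball by blast
  then show ?thesis
    using cball_finite_net[of _ x r] unfolding compact_eq_totally_bounded by blast
qed

lemma compact_if_closed_bounded: "closed S \<Longrightarrow> bounded S \<Longrightarrow> compact (S :: 'a set)"
  by (metis bounded_subset_cball compact_cball compact_Int_closed inf.absorb_iff2)

lemma countable_dense_exists: "\<exists>D::'a set. countable D \<and> (\<forall>x e. 0 < e \<longrightarrow> (\<exists>q\<in>D. dist x q < e))"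
proof -
  fix x0 :: 'a
  have "\<forall>n m. \<exists>k. finite k \<and> cball x0 (real n) \<subseteq> (\<Union>y\<in>k. ball y (1 / Suc m))"
    by (intro allI cball_finite_net) simp
  then obtain k where k: "\<And>n m. finite (k n m)"
    "\<And>n m. cball x0 (real n) \<subseteq> (\<Union>y\<in>k n m. ball y (1 / Suc m))" by metis
  have "\<exists>q\<in>(\<Union>n m. k n m). dist x q < e" if e: "0 < e" for x and e :: real
  proof -
    obtain n where n: "dist x0 x < real n" using reals_Archimedean2 by blast
    moreover obtain m where m: "1 / real (Suc m) < e"
      using e by (rule nat_approx_posE)
    moreover have "x \<in> cball x0 (real n)" using n by simp
    ultimately obtain q where "q \<in> k n m" "x \<in> ball q (1 / Suc m)"
      using k(2)[of n m] by blast
    then show ?thesis using m by (intro bexI[of _ q]) (auto simp: dist_commute)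
  qed
  moreover have "countable (\<Union>n m. k n m)" using k(1) by (intro countable_UN) (auto intro: countable_finite)
  ultimately show ?thesis by blast
qed

lemma sigma_finite_M: "sigma_finite_measure M"
proof
  fix x0 :: 'a
  show "\<exists>A. countable A \<and> A \<subseteq> sets M \<and> \<Union> A = space M \<and> (\<forall>a\<in>A. emeasure M a \<noteq> \<infinity>)"
  proof (intro exI conjI)
    have "\<exists>n. y \<in> ball x0 (real n)" for y using reals_Archimedean2 by simp
    then show "\<Union> (range (\<lambda>n. ball x0 (real n))) = space M" by auto
  qed (use emeasure_ball_finite in \<open>auto simp: less_top\<close>)
qed

sublocale sigma_finite_measure M by (rule sigma_finite_M)
sublocale MM: pair_sigma_finite M M ..

lemma measurable_dist [measurable (raw)]:
  assumes f [measurable]: "f \<in> measurable N M" and g [measurable]: "g \<in> measurable N M"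
  shows "(\<lambda>x. dist (f x) (g x)) \<in> borel_measurable N"
proof -
  obtain D :: "'a set" where D: "countable D" "\<And>x e. 0 < e \<Longrightarrow> \<exists>q\<in>D. dist x q < e"
    using countable_dense_exists by metis
  have eq: "{x \<in> space N. dist (f x) (g x) < a} =
     (\<Union>q\<in>D. \<Union>s\<in>\<rat>. (f -` ball q s \<inter> space N) \<inter> (g -` ball q (a - s) \<inter> space N))" for a
  proof safe
    fix x assume x: "x \<in> space N" "dist (f x) (g x) < a"
    define e where "e = (a - dist (f x) (g x)) / 2"
    have "e > 0" using x by (simp add: e_def)
    then obtain q where q: "q \<in> D" "dist (f x) q < e" using D by blast
    then obtain s where s: "s \<in> \<rat>" "dist (f x) q < s" "s < e" using Rats_dense_in_real by blast
    have "dist q (g x) < a - s"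
      using s dist_triangle[of q "g x" "f x"] by (simp add: e_def dist_commute field_simps)
    then show "x \<in> (\<Union>q\<in>D. \<Union>s\<in>\<rat>. (f -` ball q s \<inter> space N) \<inter> (g -` ball q (a - s) \<inter> space N))"
      using x q s by (auto simp: dist_commute)
  next
    fix x q s assume "f x \<in> ball q s" "g x \<in> ball q (a - s)"
    then show "dist (f x) (g x) < a" using dist_triangle[of "f x" "g x" q] by (simp add: dist_commute)
  qed
  show ?thesis
  proof (rule borel_measurableI_less)
    fix a
    show "{x \<in> space N. dist (f x) (g x) < a} \<in> sets N"
      unfolding eq
      by (intro sets.countable_UN' D countable_rat sets.Int measurable_sets[OF f] measurable_sets[OF g])
        (auto intro!: sets.countable_UN' countable_rat sets.Int measurable_sets[OF f] measurable_sets[OF g])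
  qed
qed

end

section \<open>Energies and the Poincare inequality\<close>

definition nn_energy :: "real \<Rightarrow> 'a::metric_space measure \<Rightarrow> real \<Rightarrow> ('a \<Rightarrow> real) \<Rightarrow> 'a set \<Rightarrow> ennreal" where
  "nn_energy p M r f U = ennreal (1 / r powr p) *
     (\<integral>\<^sup>+x\<in>U. (1 / emeasure M (ball x r)) *
        (\<integral>\<^sup>+y\<in>ball x r. ennreal (\<bar>f y - f x\<bar> powr p) \<partial>M) \<partial>M)"

lemma KS_energy_eq: "KS_energy p M r f U = enn2ereal (nn_energy p M r f U)"
  by (simp add: KS_energy_def nn_energy_def)

lemma indicator_ball: "(indicator (ball x r) y :: 'b::zero_neq_one) = (if dist x y < r then 1 else 0)"
  by (simp add: indicator_def)

context metric_doubling
begin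

lemma measurable_emeasure_ball [measurable (raw)]:
  assumes [measurable]: "g \<in> measurable N M"
  shows "(\<lambda>z. emeasure M (ball (g z) r)) \<in> borel_measurable N"
proof -
  have "emeasure M (ball x r) = (\<integral>\<^sup>+y. (if dist x y < r then 1 else 0) \<partial>M)" for x
    by (subst nn_integral_indicator[symmetric], simp, rule nn_integral_cong) (simp add: indicator_ball)
  then show ?thesis by simp
qed

lemma measurable_nn_set_integral_ball [measurable (raw)]:
  assumes [measurable]: "g \<in> measurable N M" "case_prod u \<in> borel_measurable (N \<Otimes>\<^sub>M M)"
  shows "(\<lambda>z. \<integral>\<^sup>+y\<in>ball (g z) r. u z y \<partial>M) \<in> borel_measurable N"
  unfolding indicator_ball by measurable

lemma ball_ratio_le:
  assumes "0 < s" "0 < r" "dist x y + r \<le> 2 ^ n * s"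
  shows "1 / emeasure M (ball y s) \<le> ennreal (C0 ^ n) * (1 / emeasure M (ball x r))"
proof -
  have "1 / measure M (ball y s) \<le> C0 ^ n * (1 / measure M (ball x r))"
    using measure_ball_le_of_dist[OF assms(1,3)] measure_ball_pos[OF assms(1), of y]
      measure_ball_pos[OF assms(2), of x] C0_ge_1
    by (simp add: field_simps)
  then show ?thesis
    using measure_ball_pos[OF assms(1), of y] measure_ball_pos[OF assms(2), of x] C0_ge_1
    by (simp add: emeasure_ball_eq divide_ennreal ennreal_mult'[symmetric] ennreal_leI flip: ennreal_1)
qed

lemma inverse_emeasure_ball_mult: "0 < r \<Longrightarrow> (1 / emeasure M (ball x r)) * emeasure M (ball x r) = 1"
  using measure_ball_pos[of r x]
  by (simp add: emeasure_ball_eq divide_ennreal ennreal_mult'[symmetric] flip: ennreal_1)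

lemma nn_integral_ball_kernel:
  assumes [measurable]: "I \<in> borel_measurable M"
  shows "(\<integral>\<^sup>+z. (1 / emeasure M (ball z R)) * (\<integral>\<^sup>+x\<in>ball z t. I x \<partial>M) \<partial>M) =
    (\<integral>\<^sup>+x. I x * (\<integral>\<^sup>+z\<in>ball x t. (1 / emeasure M (ball z R)) \<partial>M) \<partial>M)"
proof -
  have "(\<integral>\<^sup>+z. (1 / emeasure M (ball z R)) * (\<integral>\<^sup>+x\<in>ball z t. I x \<partial>M) \<partial>M) =
      (\<integral>\<^sup>+z. \<integral>\<^sup>+x. (1 / emeasure M (ball z R)) * (I x * (if dist z x < t then 1 else 0)) \<partial>M \<partial>M)"
    by (simp add: nn_integral_cmult indicator_ball)
  also have "\<dots> = (\<integral>\<^sup>+x. \<integral>\<^sup>+z. (1 / emeasure M (ball z R)) * (I x * (if dist z x < t then 1 else 0)) \<partial>M \<partial>M)"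
    by (rule MM.Fubini') measurable
  also have "\<dots> = (\<integral>\<^sup>+x. I x * (\<integral>\<^sup>+z\<in>ball x t. (1 / emeasure M (ball z R)) \<partial>M) \<partial>M)"
    by (subst nn_integral_cmult[symmetric])
      (auto simp: indicator_ball dist_commute ac_simps intro!: nn_integral_cong)
  finally show ?thesis .
qed

lemma nn_integral_ball_kernel_le:
  assumes [measurable]: "I \<in> borel_measurable M" and "0 < R" "0 < t" "2 * t \<le> 2 ^ n * R"
  shows "(\<integral>\<^sup>+z. (1 / emeasure M (ball z R)) * (\<integral>\<^sup>+x\<in>ball z t. I x \<partial>M) \<partial>M)
    \<le> ennreal (C0 ^ n) * (\<integral>\<^sup>+x. I x \<partial>M)"
proof -
  have "(\<integral>\<^sup>+z\<in>ball x t. (1 / emeasure M (ball z R)) \<partial>M) \<le> ennreal (C0 ^ n)" for x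
  proof -
    have "(\<integral>\<^sup>+z\<in>ball x t. (1 / emeasure M (ball z R)) \<partial>M)
        \<le> (\<integral>\<^sup>+z\<in>ball x t. ennreal (C0 ^ n) * (1 / emeasure M (ball x t)) \<partial>M)"
      using assms by (intro nn_integral_mono)
        (auto simp: indicator_ball simp del: ennreal_power intro!: ball_ratio_le)
    also have "\<dots> = ennreal (C0 ^ n) * ((1 / emeasure M (ball x t)) * emeasure M (ball x t))"
      by (subst nn_integral_cmult_indicator) (simp_all only: mult.assoc ball_in_sets)
    also have "\<dots> = ennreal (C0 ^ n)" using assms by (simp add: inverse_emeasure_ball_mult)
    finally show ?thesis .
  qed
  then have "(\<integral>\<^sup>+x. I x * (\<integral>\<^sup>+z\<in>ball x t. (1 / emeasure M (ball z R)) \<partial>M) \<partial>M)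
      \<le> (\<integral>\<^sup>+x. ennreal (C0 ^ n) * I x \<partial>M)"
    by (intro nn_integral_mono) (subst mult.commute, rule mult_right_mono, auto)
  then show ?thesis unfolding nn_integral_ball_kernel[OF assms(1)] by (simp add: nn_integral_cmult)
qed

lemma nn_integral_le_ball_kernel:
  assumes [measurable]: "I \<in> borel_measurable M" and "0 < R"
  shows "(\<integral>\<^sup>+x. I x \<partial>M) \<le>
    ennreal C0 * (\<integral>\<^sup>+z. (1 / emeasure M (ball z R)) * (\<integral>\<^sup>+x\<in>ball z R. I x \<partial>M) \<partial>M)"
proof -
  have "1 \<le> ennreal C0 * (\<integral>\<^sup>+z\<in>ball x R. (1 / emeasure M (ball z R)) \<partial>M)" for x
  proof -
    have "1 = (\<integral>\<^sup>+z\<in>ball x R. (1 / emeasure M (ball x R)) \<partial>M)"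
      using assms by (simp add: nn_integral_cmult_indicator inverse_emeasure_ball_mult)
    also have "\<dots> \<le> (\<integral>\<^sup>+z\<in>ball x R. ennreal C0 * (1 / emeasure M (ball z R)) \<partial>M)"
      using assms ball_ratio_le[of R R _ x 1]
      by (intro nn_integral_mono) (auto simp: indicator_ball dist_commute)
    also have "\<dots> = ennreal C0 * (\<integral>\<^sup>+z\<in>ball x R. (1 / emeasure M (ball z R)) \<partial>M)"
      by (simp add: nn_integral_cmult mult.assoc indicator_ball)
    finally show ?thesis .
  qed
  then have "(\<integral>\<^sup>+x. I x * 1 \<partial>M) \<le>
      (\<integral>\<^sup>+x. I x * (ennreal C0 * (\<integral>\<^sup>+z\<in>ball x R. (1 / emeasure M (ball z R)) \<partial>M)) \<partial>M)"
    by (intro nn_integral_mono mult_left_mono) auto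
  also have "\<dots> = ennreal C0 * (\<integral>\<^sup>+x. I x * (\<integral>\<^sup>+z\<in>ball x R. (1 / emeasure M (ball z R)) \<partial>M) \<partial>M)"
    by (subst nn_integral_cmult[symmetric]) (auto simp: ac_simps indicator_ball intro!: nn_integral_cong)
  finally show ?thesis unfolding nn_integral_ball_kernel[OF assms(1)] by simp
qed

lemma nn_integral_double_ball_le:
  assumes [measurable]: "g \<in> borel_measurable M" and p: "1 \<le> p"
  shows "(\<integral>\<^sup>+x\<in>ball z r. (\<integral>\<^sup>+y\<in>ball z r. ennreal (\<bar>g y - g x\<bar> powr p) \<partial>M) \<partial>M) \<le>
    ennreal (2 * 2 powr p) * emeasure M (ball z r) * (\<integral>\<^sup>+y\<in>ball z r. ennreal (\<bar>g y - c\<bar> powr p) \<partial>M)"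
proof -
  define a where "a y = ennreal (\<bar>g y - c\<bar> powr p)" for y
  have [measurable]: "a \<in> borel_measurable M" unfolding a_def by measurable
  have le: "ennreal (\<bar>g y - g x\<bar> powr p) \<le> ennreal (2 powr p) * (a y + a x)" for x y
  proof -
    have "\<bar>g y - g x\<bar> powr p \<le> 2 powr p * (\<bar>g y - c\<bar> powr p + \<bar>g x - c\<bar> powr p)"
      using abs_add_powr_le2[OF p, of "g y - c" "c - g x"] by (simp add: abs_minus_commute)
    then show ?thesis
      by (simp add: a_def ennreal_leI flip: ennreal_mult' ennreal_plus)
  qed
  let ?B = "ball z r" and ?i = "\<lambda>x. indicator (ball z r) x :: ennreal"
  have "(\<integral>\<^sup>+x\<in>?B. (\<integral>\<^sup>+y\<in>?B. ennreal (\<bar>g y - g x\<bar> powr p) \<partial>M) \<partial>M)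
      \<le> (\<integral>\<^sup>+x\<in>?B. (\<integral>\<^sup>+y\<in>?B. ennreal (2 powr p) * (a y + a x) \<partial>M) \<partial>M)"
    by (intro nn_integral_mono mult_right_mono le) auto
  also have "\<dots> = ennreal (2 powr p) * (\<integral>\<^sup>+x. (\<integral>\<^sup>+y. a y * ?i y \<partial>M) * ?i x + emeasure M ?B * (a x * ?i x) \<partial>M)"
  proof -
    have "(\<integral>\<^sup>+y\<in>?B. ennreal (2 powr p) * (a y + a x) \<partial>M) =
        ennreal (2 powr p) * ((\<integral>\<^sup>+y. a y * ?i y \<partial>M) + emeasure M ?B * a x)" for x
    proof -
      have "(\<integral>\<^sup>+y\<in>?B. ennreal (2 powr p) * (a y + a x) \<partial>M) =
          (\<integral>\<^sup>+y. ennreal (2 powr p) * (a y * ?i y + a x * ?i y) \<partial>M)"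
        by (intro nn_integral_cong) (simp add: algebra_simps)
      also have "\<dots> = ennreal (2 powr p) * ((\<integral>\<^sup>+y. a y * ?i y \<partial>M) + (\<integral>\<^sup>+y. a x * ?i y \<partial>M))"
        by (subst nn_integral_cmult) (auto simp: nn_integral_add)
      also have "(\<integral>\<^sup>+y. a x * ?i y \<partial>M) = emeasure M ?B * a x"
        by (simp add: nn_integral_cmult_indicator mult.commute)
      finally show ?thesis .
    qed
    then show ?thesis
      by (subst nn_integral_cmult[symmetric]) (auto simp: algebra_simps intro!: nn_integral_cong)
  qed
  also have "(\<integral>\<^sup>+x. (\<integral>\<^sup>+y. a y * ?i y \<partial>M) * ?i x + emeasure M ?B * (a x * ?i x) \<partial>M)
      = (\<integral>\<^sup>+y. a y * ?i y \<partial>M) * emeasure M ?B + emeasure M ?B * (\<integral>\<^sup>+y. a y * ?i y \<partial>M)"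
    by (subst nn_integral_add) (auto simp: nn_integral_cmult_indicator nn_integral_cmult)
  also have "ennreal (2 powr p) * \<dots> = ennreal (2 * 2 powr p) * emeasure M ?B * (\<integral>\<^sup>+y. a y * ?i y \<partial>M)"
  proof -
    have "c * (A * b + b * A) = 2 * c * b * A" for A b c :: ennreal
    proof -
      have "A * b + b * A = 2 * (b * A)" by (metis mult.commute mult_2)
      then show ?thesis by (metis mult.assoc mult.left_commute)
    qed
    then show ?thesis by (simp add: ennreal_mult')
  qed
  finally show ?thesis
    unfolding a_def .
qed

end

locale cheeger = metric_doubling +
  fixes p C1 l :: real
  assumes p: "1 < p" and C1: "0 < C1" and l: "1 \<le> l"
    and poincare: "\<And>f x R L. L-lipschitz_on UNIV f \<Longrightarrow> 0 < R \<Longrightarrow>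
      (\<integral>\<^sup>+y\<in>ball x R. ennreal (\<bar>f y - ball_average M f x R\<bar> powr p) \<partial>M)
         \<le> ennreal (C1 * R powr p) * (\<integral>\<^sup>+y\<in>ball x (l * R). ennreal (pointwise_lip f y powr p) \<partial>M)"
begin

text \<open>Averaging over the centre \<open>z\<close> of a ball of radius \<open>R\<close> replaces the usual covering by balls
  with bounded overlap.\<close>

lemma nn_energy_le_upper_gradient:
  "\<exists>C>0. \<forall>g L G R U V. L-lipschitz_on UNIV g \<longrightarrow> G \<in> borel_measurable M \<longrightarrow>
      (\<forall>x. ennreal (pointwise_lip g x powr p) \<le> G x) \<longrightarrow> 0 < R \<longrightarrow> open U \<longrightarrow> open V \<longrightarrow>
      (\<forall>x\<in>U. ball x ((1 + 2 * l) * R) \<subseteq> V) \<longrightarrow>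
      nn_energy p M R g U \<le> ennreal C * (\<integral>\<^sup>+x\<in>V. G x \<partial>M)"
proof -
  obtain n :: nat where n: "4 * l < 2 ^ n" using real_arch_pow[of 2 "4 * l"] by auto
  define K where "K = C0 ^ 2 * (2 * 2 powr p) * C1 * 2 powr p"
  have K: "0 < K" unfolding K_def using C0_ge_1 C1 by simp
  show ?thesis
  proof (intro exI[of _ "C0 * K * C0 ^ n"] conjI allI impI)
    show "0 < C0 * K * C0 ^ n" using K C0_ge_1 by simp
    fix g :: "'a \<Rightarrow> real" and L and G :: "'a \<Rightarrow> ennreal" and R :: real and U V :: "'a set"
    assume lip: "L-lipschitz_on UNIV g" and [measurable]: "G \<in> borel_measurable M"
      and G: "\<forall>x. ennreal (pointwise_lip g x powr p) \<le> G x" and R: "0 < R"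
      and op: "open U" "open V" and UV: "\<forall>x\<in>U. ball x ((1 + 2 * l) * R) \<subseteq> V"
    have [measurable]: "U \<in> sets M" "V \<in> sets M" using op by (simp_all add: sets_M)
    have "continuous_on UNIV g" using lip lipschitz_on_continuous_on by blast
    then have "g \<in> borel_measurable borel" by (rule borel_measurable_continuous_onI)
    then have g [measurable]: "g \<in> borel_measurable M" using measurable_cong_sets[OF sets_M refl] by blast
    define I where "I x = (1 / emeasure M (ball x R)) *
        (\<integral>\<^sup>+y\<in>ball x R. ennreal (\<bar>g y - g x\<bar> powr p) \<partial>M) * indicator U x" for x
    have [measurable]: "I \<in> borel_measurable M" unfolding I_def by measurable
    have local: "(\<integral>\<^sup>+x\<in>ball z R. I x \<partial>M) \<le>
        ennreal (K * R powr p) * (\<integral>\<^sup>+w\<in>ball z (2 * l * R). (G w * indicator V w) \<partial>M)" for z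
    proof (cases "ball z R \<inter> U = {}")
      case True
      then have "(\<integral>\<^sup>+x\<in>ball z R. I x \<partial>M) = (\<integral>\<^sup>+x. 0 \<partial>M)"
        by (intro nn_integral_cong) (auto simp: I_def indicator_def)
      then show ?thesis by simp
    next
      case False
      then obtain x where x: "x \<in> U" "dist z x < R" by auto
      have sub: "ball z (2 * l * R) \<subseteq> V"
      proof
        fix w assume "w \<in> ball z (2 * l * R)"
        then have "w \<in> ball x ((1 + 2 * l) * R)"
          using x dist_triangle[of x w z] by (simp add: dist_commute algebra_simps)
        then show "w \<in> V" using UV x by blast
      qed
      let ?B = "ball z (2 * R)"
      have "(\<integral>\<^sup>+x\<in>ball z R. I x \<partial>M) \<le> (\<integral>\<^sup>+x\<in>?B. ennreal (C0 ^ 2) * (1 / emeasure M ?B) *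
          (\<integral>\<^sup>+y\<in>?B. ennreal (\<bar>g y - g x\<bar> powr p) \<partial>M) \<partial>M)"
      proof (rule nn_integral_mono)
        fix x
        show "I x * indicator (ball z R) x \<le> ennreal (C0 ^ 2) * (1 / emeasure M ?B) *
            (\<integral>\<^sup>+y\<in>?B. ennreal (\<bar>g y - g x\<bar> powr p) \<partial>M) * indicator ?B x"
        proof (cases "x \<in> ball z R")
          case True
          have "ball x R \<subseteq> ?B"
          proof
            fix w assume "w \<in> ball x R"
            then show "w \<in> ?B" using True dist_triangle[of z w x] by simp
          qed
          then have "(\<integral>\<^sup>+y\<in>ball x R. ennreal (\<bar>g y - g x\<bar> powr p) \<partial>M)
              \<le> (\<integral>\<^sup>+y\<in>?B. ennreal (\<bar>g y - g x\<bar> powr p) \<partial>M)"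
            by (intro nn_set_integral_set_mono)
          moreover have "1 / emeasure M (ball x R) \<le> ennreal (C0 ^ 2) * (1 / emeasure M ?B)"
            using R True by (intro ball_ratio_le) auto
          ultimately have "(1 / emeasure M (ball x R)) * (\<integral>\<^sup>+y\<in>ball x R. ennreal (\<bar>g y - g x\<bar> powr p) \<partial>M)
             \<le> ennreal (C0 ^ 2) * (1 / emeasure M ?B) * (\<integral>\<^sup>+y\<in>?B. ennreal (\<bar>g y - g x\<bar> powr p) \<partial>M)"
            by (intro mult_mono) auto
          moreover have "x \<in> ?B" using True R by auto
          ultimately show ?thesis using True by (auto simp: I_def indicator_def)
        qed auto
      qed
      also have "\<dots> = ennreal (C0 ^ 2) * (1 / emeasure M ?B) *
          (\<integral>\<^sup>+x\<in>?B. (\<integral>\<^sup>+y\<in>?B. ennreal (\<bar>g y - g x\<bar> powr p) \<partial>M) \<partial>M)"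
        by (subst nn_integral_cmult[symmetric]) (auto simp: mult.assoc)
      also have "\<dots> \<le> ennreal (C0 ^ 2) * (1 / emeasure M ?B) * (ennreal (2 * 2 powr p) * emeasure M ?B *
          (\<integral>\<^sup>+y\<in>?B. ennreal (\<bar>g y - ball_average M g z (2 * R)\<bar> powr p) \<partial>M))"
        using p by (intro mult_left_mono nn_integral_double_ball_le) auto
      also have "\<dots> = (1 / emeasure M ?B * emeasure M ?B) * (ennreal (C0 ^ 2) * ennreal (2 * 2 powr p) *
          (\<integral>\<^sup>+y\<in>?B. ennreal (\<bar>g y - ball_average M g z (2 * R)\<bar> powr p) \<partial>M))"
        by (simp add: ac_simps)
      also have "\<dots> = ennreal (C0 ^ 2) * ennreal (2 * 2 powr p) *
          (\<integral>\<^sup>+y\<in>?B. ennreal (\<bar>g y - ball_average M g z (2 * R)\<bar> powr p) \<partial>M)"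
        using R by (simp add: inverse_emeasure_ball_mult)
      also have "\<dots> \<le> ennreal (C0 ^ 2) * ennreal (2 * 2 powr p) * (ennreal (C1 * (2 * R) powr p) *
          (\<integral>\<^sup>+y\<in>ball z (l * (2 * R)). ennreal (pointwise_lip g y powr p) \<partial>M))"
        using R by (intro mult_left_mono poincare[OF lip]) auto
      also have "\<dots> \<le> ennreal (C0 ^ 2) * ennreal (2 * 2 powr p) * (ennreal (C1 * (2 * R) powr p) *
          (\<integral>\<^sup>+w\<in>ball z (2 * l * R). (G w * indicator V w) \<partial>M))"
        using G sub by (intro mult_left_mono nn_integral_mono) (auto simp: indicator_def ac_simps)
      also have "\<dots> = ennreal (K * R powr p) * (\<integral>\<^sup>+w\<in>ball z (2 * l * R). (G w * indicator V w) \<partial>M)"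
      proof -
        have "K * R powr p = C0 ^ 2 * (2 * 2 powr p) * (C1 * (2 * R) powr p)"
          using R by (simp add: K_def powr_mult ac_simps)
        then show ?thesis using C0_ge_1 C1 by (simp only:) (simp add: ennreal_mult' mult.assoc)
      qed
      finally show ?thesis .
    qed
    have "(\<integral>\<^sup>+x. I x \<partial>M) \<le>
        ennreal C0 * (\<integral>\<^sup>+z. (1 / emeasure M (ball z R)) * (\<integral>\<^sup>+x\<in>ball z R. I x \<partial>M) \<partial>M)"
      using R by (intro nn_integral_le_ball_kernel) auto
    also have "\<dots> \<le> ennreal C0 * (\<integral>\<^sup>+z. ennreal (K * R powr p) * ((1 / emeasure M (ball z R)) *
        (\<integral>\<^sup>+w\<in>ball z (2 * l * R). (G w * indicator V w) \<partial>M)) \<partial>M)"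
      by (intro mult_left_mono nn_integral_mono, subst mult.left_commute) (auto intro!: mult_left_mono local)
    also have "\<dots> = ennreal C0 * (ennreal (K * R powr p) * (\<integral>\<^sup>+z. (1 / emeasure M (ball z R)) *
        (\<integral>\<^sup>+w\<in>ball z (2 * l * R). (G w * indicator V w) \<partial>M) \<partial>M))"
      by (subst nn_integral_cmult) auto
    also have "\<dots> \<le> ennreal C0 * (ennreal (K * R powr p) * (ennreal (C0 ^ n) * (\<integral>\<^sup>+x\<in>V. G x \<partial>M)))"
      using R l n by (intro mult_left_mono nn_integral_ball_kernel_le) auto
    finally have "nn_energy p M R g U \<le> ennreal (1 / R powr p) * (ennreal C0 * (ennreal (K * R powr p) *
        (ennreal (C0 ^ n) * (\<integral>\<^sup>+x\<in>V. G x \<partial>M))))"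
      unfolding nn_energy_def I_def by (intro mult_left_mono) auto
    also have "\<dots> = ennreal (1 / R powr p * C0 * (K * R powr p) * C0 ^ n) * (\<integral>\<^sup>+x\<in>V. G x \<partial>M)"
    proof -
      have "ennreal (a * b * c * d) * e = ennreal a * (ennreal b * (ennreal c * (ennreal d * e)))"
        if "0 \<le> a" "0 \<le> b" "0 \<le> c" for a b c d e
        using that by (simp add: ennreal_mult' mult.assoc)
      note product = this
      have nonneg: "0 \<le> 1 / R powr p" "0 \<le> C0" "0 \<le> K * R powr p" using C0_ge_1 K by auto
      show ?thesis by (rule product[OF nonneg, symmetric])
    qed
    also have "1 / R powr p * C0 * (K * R powr p) * C0 ^ n = C0 * K * C0 ^ n"
      using R by simp
    finally show "nn_energy p M R g U \<le> ennreal (C0 * K * C0 ^ n) * (\<integral>\<^sup>+x\<in>V. G x \<partial>M)" .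
  qed
qed

end

section \<open>Lipschitz approximation\<close>

lemma pointwise_lip_le:
  assumes "0 \<le> c" "0 < d" "\<And>x. dist y x < d \<Longrightarrow> \<bar>f x - f y\<bar> \<le> c * dist y x"
  shows "pointwise_lip f y \<le> c"
proof -
  have "Limsup (at_right 0) (\<lambda>r. SUP x\<in>cball y r. ennreal (\<bar>f x - f y\<bar> / r)) \<le> ennreal c"
  proof (rule Limsup_bounded)
    have "eventually (\<lambda>r. r \<in> {0<..<d}) (at_right 0)"
      using assms(2) by (rule eventually_at_right_real)
    then show "\<forall>\<^sub>F r in at_right 0. (SUP x\<in>cball y r. ennreal (\<bar>f x - f y\<bar> / r)) \<le> ennreal c"
    proof eventually_elim
      case (elim r)
      have "\<bar>f x - f y\<bar> / r \<le> c" if "x \<in> cball y r" for x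
      proof -
        have "\<bar>f x - f y\<bar> \<le> c * dist y x" using that elim by (intro assms) auto
        also have "\<dots> \<le> c * r" using that assms by (intro mult_left_mono) auto
        finally show ?thesis using elim by (simp add: field_simps)
      qed
      then show ?case by (intro SUP_least ennreal_leI)
    qed
  qed
  then have "pointwise_lip f y \<le> enn2real (ennreal c)"
    unfolding pointwise_lip_def by (intro enn2real_mono) auto
  then show ?thesis using assms by simp
qed

context metric_doubling
begin

lemma integrable_bounded_ball:
  assumes "u \<in> borel_measurable M" "\<And>y. \<bar>u y\<bar> \<le> c" "\<And>y. y \<notin> ball x r \<Longrightarrow> u y = 0"
  shows "integrable M (u :: 'a \<Rightarrow> real)"
  using assms emeasure_ball_finite by (intro integrableI_bounded_set[of "ball x r" _ _ c]) auto

lemma set_integrable_bounded_ball: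
  assumes [measurable]: "u \<in> borel_measurable M" and u: "\<And>y. \<bar>u y\<bar> \<le> c"
  shows "set_integrable M (ball x r) (u :: 'a \<Rightarrow> real)"
  unfolding set_integrable_def
proof (rule integrable_bounded_ball[of _ c x r])
  have "0 \<le> c" using u[of undefined] by (rule order_trans[rotated]) simp
  then show "\<bar>indicat_real (ball x r) y *\<^sub>R u y\<bar> \<le> c" for y using u by (simp add: indicator_def)
qed auto

lemma ball_average_const: "0 < r \<Longrightarrow> ball_average M (\<lambda>_. c) x r = c"
  using measure_ball_pos[of r x] by (simp add: ball_average_def set_lebesgue_integral_def)

lemma ball_average_mono:
  assumes "set_integrable M (ball x r) u" "set_integrable M (ball x r) v" "\<And>y. u y \<le> v y"
  shows "ball_average M u x r \<le> ball_average M v x r"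
  unfolding ball_average_def using assms by (intro mult_left_mono set_integral_mono) auto

lemma ball_average_add:
  assumes "set_integrable M (ball x r) u" "set_integrable M (ball x r) v"
  shows "ball_average M (\<lambda>y. u y + v y) x r = ball_average M u x r + ball_average M v x r"
  unfolding ball_average_def using assms by (simp add: set_integral_add distrib_left)

lemma ball_average_cmult: "ball_average M (\<lambda>y. c * u y) x r = c * ball_average M u x r"
  unfolding ball_average_def by simp

lemma ball_average_nonneg: "(\<And>y. 0 \<le> u y) \<Longrightarrow> 0 \<le> ball_average M u x r"
  unfolding ball_average_def set_lebesgue_integral_def
  by (intro mult_nonneg_nonneg integral_nonneg_AE) auto

lemma ball_average_powr_le:
  assumes [measurable]: "u \<in> borel_measurable M" and u: "\<And>y. 0 \<le> u y" "\<And>y. u y \<le> c"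
    and r: "0 < r" and p: "1 \<le> p"
  shows "ball_average M u x r powr p \<le> ball_average M (\<lambda>y. u y powr p) x r"
proof -
  define a where "a = ball_average M u x r"
  have a: "0 \<le> a" unfolding a_def using u by (intro ball_average_nonneg) auto
  have iu: "set_integrable M (ball x r) u"
    using u by (intro set_integrable_bounded_ball[of _ c]) auto
  have iup: "set_integrable M (ball x r) (\<lambda>y. u y powr p)"
    using u p by (intro set_integrable_bounded_ball[of _ "c powr p"]) (auto intro!: powr_mono2)
  have ic: "set_integrable M (ball x r) (\<lambda>_. c)" for c :: real
    by (intro set_integrable_bounded_ball[of _ "\<bar>c\<bar>"]) auto
  show ?thesis
  proof (cases "a = 0")
    case True
    then show ?thesis unfolding a_def[symmetric] by (simp add: ball_average_nonneg)
  next
    case False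
    define b where "b = p * a powr (p - 1)"
    have "a powr p = ball_average M (\<lambda>y. (a powr p - b * a) + b * u y) x r"
    proof (subst ball_average_add)
      show "set_integrable M (ball x r) (\<lambda>y. b * u y)" using iu by simp
    qed (use ic r in \<open>simp_all add: ball_average_const ball_average_cmult a_def[symmetric]\<close>)
    also have "\<dots> \<le> ball_average M (\<lambda>y. u y powr p) x r"
    proof (rule ball_average_mono)
      show "a powr p - b * a + b * u y \<le> u y powr p" for y
        using powr_tangent_le[OF p, of "u y" a] u a False unfolding b_def by (simp add: algebra_simps)
      show "set_integrable M (ball x r) (\<lambda>y. a powr p - b * a + b * u y)"
        using iu ic by (intro set_integral_add) auto
    qed (rule iup)
    finally show ?thesis unfolding a_def .
  qed
qed

lemma ennreal_ball_average:
  assumes "set_integrable M (ball x r) u" "\<And>y. 0 \<le> u y" "0 < r"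
  shows "ennreal (ball_average M u x r) = (1 / emeasure M (ball x r)) * (\<integral>\<^sup>+y\<in>ball x r. ennreal (u y) \<partial>M)"
proof -
  have "(\<integral>\<^sup>+y\<in>ball x r. ennreal (u y) \<partial>M) = ennreal (LINT y:ball x r|M. u y)"
  proof -
    have "(\<integral>\<^sup>+y. ennreal (indicator (ball x r) y *\<^sub>R u y) \<partial>M) = ennreal (LINT y:ball x r|M. u y)"
      unfolding set_lebesgue_integral_def using assms
      by (intro nn_integral_eq_integral) (auto simp: set_integrable_def)
    moreover have "ennreal (indicator (ball x r) y *\<^sub>R u y) = ennreal (u y) * indicator (ball x r) y" for y
      by (simp add: indicator_def)
    ultimately show ?thesis by simp
  qed
  then show ?thesis
    using measure_ball_pos[OF assms(3), of x] unfolding ball_average_def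
    by (simp add: emeasure_ball_eq divide_ennreal ennreal_mult'[symmetric] flip: ennreal_1)
qed

definition tent :: "real \<Rightarrow> 'a \<Rightarrow> 'a \<Rightarrow> real" where
  "tent s x y = max 0 (1 - dist x y / (s / 2))"

definition mollify :: "real \<Rightarrow> ('a \<Rightarrow> real) \<Rightarrow> 'a \<Rightarrow> real" where
  "mollify s h x = (LINT y|M. tent s x y * h y) / (LINT y|M. tent s x y)"

context
  fixes h :: "'a \<Rightarrow> real" and k s :: real
  assumes h [measurable]: "h \<in> borel_measurable M" and h_le: "\<And>y. \<bar>h y\<bar> \<le> k" and s: "0 < s"
begin

lemma measurable_tent [measurable]: "tent s x \<in> borel_measurable M"
  unfolding tent_def by measurable

lemma tent_bounds: "0 \<le> tent s x y" "tent s x y \<le> 1"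
  using s by (auto simp: tent_def)

lemma tent_eq_0: "y \<notin> ball x (s / 2) \<Longrightarrow> tent s x y = 0"
  using s by (simp add: tent_def field_simps)

lemma integrable_tent_mult:
  assumes [measurable]: "u \<in> borel_measurable M" and u: "\<And>y. \<bar>u y\<bar> \<le> c"
  shows "integrable M (\<lambda>y. tent s x y * u y)"
proof (rule integrable_bounded_ball)
  show "\<bar>tent s x y * u y\<bar> \<le> c" for y
    using tent_bounds[of x y] u[of y] mult_mono[of "tent s x y" 1 "\<bar>u y\<bar>" c] by (simp add: abs_mult)
  show "tent s x y * u y = 0" if "y \<notin> ball x (s / 2)" for y using that tent_eq_0 by simp
qed auto

lemma integrable_tent: "integrable M (tent s x)"
  using integrable_tent_mult[of "\<lambda>_. 1" 1 x] by simp

lemma integral_tent_ge: "measure M (ball x s) \<le> 2 * C0 ^ 2 * (LINT y|M. tent s x y)"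
proof -
  have "measure M (ball x s) \<le> C0 ^ 2 * measure M (ball x (s / 4))"
    using s by (intro measure_ball_le_of_dist) auto
  also have "measure M (ball x (s / 4)) = 2 * (LINT y|M. (1/2) * indicator (ball x (s / 4)) y)"
    by simp
  also have "(LINT y|M. (1/2) * indicator (ball x (s / 4)) y) \<le> (LINT y|M. tent s x y)"
  proof (rule integral_mono)
    show "integrable M (\<lambda>y. (1/2) * indicat_real (ball x (s / 4)) y)"
      using emeasure_ball_finite by (intro integrable_mult_right integrable_real_indicator) auto
    show "1 / 2 * indicator (ball x (s / 4)) y \<le> tent s x y" for y
      using s tent_bounds(1)[of x y] by (auto simp: indicator_def tent_def field_simps)
  qed (rule integrable_tent)
  finally show ?thesis using C0_ge_1 by (simp add: mult.assoc mult_left_mono)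
qed

lemma integral_tent_pos: "0 < (LINT y|M. tent s x y)"
proof -
  have "0 < 2 * C0 ^ 2 * (LINT y|M. tent s x y)"
    using integral_tent_ge[of x] measure_ball_pos[OF s, of x] by linarith
  then show ?thesis using C0_ge_1 by (simp add: zero_less_mult_iff)
qed

lemma mollify_diff_eq:
  "(LINT y|M. tent s x y) * (mollify s h x - c) = (LINT y|M. tent s x y * (h y - c))"
proof -
  have "(LINT y|M. tent s x y * (h y - c)) = (LINT y|M. tent s x y * h y - tent s x y * c)"
    by (simp add: right_diff_distrib)
  also have "\<dots> = (LINT y|M. tent s x y * h y) - (LINT y|M. tent s x y) * c"
    using integrable_tent_mult[OF h h_le] integrable_tent by simp
  finally show ?thesis
    using integral_tent_pos[of x] by (simp add: mollify_def right_diff_distrib)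
qed

lemma set_integrable_abs_diff: "set_integrable M (ball x r) (\<lambda>y. \<bar>h y - c\<bar>)"
proof (intro set_integrable_bounded_ball)
  show "\<bar>\<bar>h y - c\<bar>\<bar> \<le> k + \<bar>c\<bar>" for y using h_le[of y] by linarith
qed auto

lemma mollify_abs_le: "\<bar>mollify s h x\<bar> \<le> k"
proof -
  let ?D = "LINT y|M. tent s x y"
  have "\<bar>?D * mollify s h x\<bar> = \<bar>LINT y|M. tent s x y * h y\<bar>"
    using mollify_diff_eq[of x 0] by simp
  also have "\<dots> \<le> (LINT y|M. \<bar>tent s x y * h y\<bar>)" by (rule integral_abs_bound)
  also have "\<dots> \<le> (LINT y|M. k * tent s x y)"
  proof (rule integral_mono)
    show "\<bar>tent s x y * h y\<bar> \<le> k * tent s x y" for y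
      using h_le[of y] tent_bounds[of x y] by (simp add: abs_mult mult.commute mult_right_mono)
  qed (use integrable_tent_mult[OF h h_le] integrable_tent in auto)
  finally show ?thesis using integral_tent_pos[of x] by (simp add: abs_mult mult.commute)
qed

lemma mollify_near:
  "\<bar>mollify s h x - h x\<bar> \<le> 2 * C0 ^ 2 * ball_average M (\<lambda>y. \<bar>h y - h x\<bar>) x s"
proof -
  let ?D = "LINT y|M. tent s x y" and ?m = "measure M (ball x s)"
  have "?m * \<bar>mollify s h x - h x\<bar> \<le> (2 * C0 ^ 2 * ?D) * \<bar>mollify s h x - h x\<bar>"
    by (intro mult_right_mono integral_tent_ge) auto
  also have "\<dots> = 2 * C0 ^ 2 * \<bar>?D * (mollify s h x - h x)\<bar>"
    using integral_tent_pos[of x] by (simp add: abs_mult)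
  also have "\<bar>?D * (mollify s h x - h x)\<bar> = \<bar>LINT y|M. tent s x y * (h y - h x)\<bar>"
    by (simp add: mollify_diff_eq)
  also have "\<dots> \<le> (LINT y|M. \<bar>tent s x y * (h y - h x)\<bar>)" by (rule integral_abs_bound)
  also have "\<dots> \<le> (LINT y:ball x s|M. \<bar>h y - h x\<bar>)"
    unfolding set_lebesgue_integral_def
  proof (rule integral_mono)
    show "integrable M (\<lambda>y. \<bar>tent s x y * (h y - h x)\<bar>)"
    proof (intro integrable_abs integrable_tent_mult)
      show "\<bar>h y - h x\<bar> \<le> k + k" for y using h_le[of y] h_le[of x] by linarith
    qed auto
    show "\<bar>tent s x y * (h y - h x)\<bar> \<le> indicat_real (ball x s) y *\<^sub>R \<bar>h y - h x\<bar>" for y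
      using tent_bounds[of x y] tent_eq_0[of y x] s
      by (auto simp: abs_mult indicator_def mult_left_le_one_le)
  qed (use set_integrable_abs_diff in \<open>simp add: set_integrable_def\<close>)
  finally show ?thesis
    using measure_ball_pos[OF s, of x] C0_ge_1
    by (simp add: ball_average_def field_simps mult_left_mono)
qed

lemma tent_lipschitz: "\<bar>tent s x' y - tent s x y\<bar> \<le> dist x x' / (s / 2)"
proof -
  have "\<bar>dist x y - dist x' y\<bar> \<le> dist x x'"
    using abs_dist_diff_le[of x y x'] dist_triangle2 by (metis dist_commute abs_dist_diff_le)
  then have "\<bar>(1 - dist x' y / (s / 2)) - (1 - dist x y / (s / 2))\<bar> \<le> dist x x' / (s / 2)"
    using s by (simp add: field_simps abs_divide flip: diff_divide_distrib)
  then show ?thesis unfolding tent_def by linarith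
qed

text \<open>With \<open>g = mollify s h\<close> and \<open>D\<close> the integral of \<open>tent s x'\<close>, the function \<open>tent s x (h - g x)\<close> has
  integral \<open>0\<close>, so \<open>D (g x' - g x)\<close> is the integral of \<open>(tent s x' - tent s x) (h - g x)\<close>.\<close>

lemma mollify_lip_near:
  assumes d: "dist x x' \<le> s / 2"
  shows "\<bar>mollify s h x' - mollify s h x\<bar> \<le>
    4 * C0 ^ 3 * (dist x x' / s) * ball_average M (\<lambda>y. \<bar>h y - mollify s h x\<bar>) x s"
proof -
  let ?g = "mollify s h" and ?D' = "LINT y|M. tent s x' y" and ?m = "measure M (ball x s)"
  have bnd: "\<bar>h y - ?g x\<bar> \<le> k + k" for y using h_le[of y] mollify_abs_le[of x] by linarith
  have int: "integrable M (\<lambda>y. tent s z y * (h y - ?g x))" for z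
    using bnd by (intro integrable_tent_mult) auto
  have "?m \<le> C0 ^ 1 * measure M (ball x' s)" using d s by (intro measure_ball_le_of_dist) auto
  also have "\<dots> \<le> C0 ^ 1 * (2 * C0 ^ 2 * ?D')" using C0_ge_1 by (intro mult_left_mono integral_tent_ge) auto
  finally have m: "?m \<le> 2 * C0 ^ 3 * ?D'" by (simp add: power2_eq_square power3_eq_cube)
  have "?m * \<bar>?g x' - ?g x\<bar> \<le> (2 * C0 ^ 3 * ?D') * \<bar>?g x' - ?g x\<bar>" by (intro mult_right_mono m) auto
  also have "\<dots> = 2 * C0 ^ 3 * \<bar>?D' * (?g x' - ?g x)\<bar>"
    using integral_tent_pos[of x'] by (simp add: abs_mult)
  also have "?D' * (?g x' - ?g x) = (LINT y|M. (tent s x' y - tent s x y) * (h y - ?g x))"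
  proof -
    have "(LINT y|M. tent s x y * (h y - ?g x)) = 0" using mollify_diff_eq[of x "?g x"] by simp
    then show ?thesis using int by (simp add: left_diff_distrib mollify_diff_eq)
  qed
  also have "\<bar>\<dots>\<bar> \<le> (LINT y|M. \<bar>(tent s x' y - tent s x y) * (h y - ?g x)\<bar>)" by (rule integral_abs_bound)
  also have "\<dots> \<le> (LINT y|M. dist x x' / (s / 2) * (indicat_real (ball x s) y *\<^sub>R \<bar>h y - ?g x\<bar>))"
  proof (rule integral_mono)
    show "integrable M (\<lambda>y. \<bar>(tent s x' y - tent s x y) * (h y - ?g x)\<bar>)"
      using int by (simp add: left_diff_distrib)
    show "integrable M (\<lambda>y. dist x x' / (s / 2) * (indicat_real (ball x s) y *\<^sub>R \<bar>h y - ?g x\<bar>))"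
      using set_integrable_abs_diff unfolding set_integrable_def by (intro integrable_mult_right) auto
    show "\<bar>(tent s x' y - tent s x y) * (h y - ?g x)\<bar> \<le>
        dist x x' / (s / 2) * (indicat_real (ball x s) y *\<^sub>R \<bar>h y - ?g x\<bar>)" for y
    proof (cases "y \<in> ball x s")
      case True
      then show ?thesis
        using mult_right_mono[OF tent_lipschitz[of x' y x], of "\<bar>h y - ?g x\<bar>"] by (simp add: abs_mult)
    next
      case False
      then have "y \<notin> ball x (s / 2)" "y \<notin> ball x' (s / 2)"
        using d s dist_triangle[of x y x'] by auto
      then show ?thesis using False by (simp add: tent_eq_0)
    qed
  qed
  also have "\<dots> = dist x x' / (s / 2) * (LINT y:ball x s|M. \<bar>h y - ?g x\<bar>)"
    by (simp add: set_lebesgue_integral_def)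
  finally show ?thesis
    using measure_ball_pos[OF s, of x] C0_ge_1 s
    by (simp add: ball_average_def field_simps mult_left_mono)
qed

lemma mollify_lip_osc:
  assumes d: "dist x x' \<le> s / 2"
  shows "\<bar>mollify s h x' - mollify s h x\<bar> \<le>
    4 * C0 ^ 3 * (1 + 2 * C0 ^ 2) * ball_average M (\<lambda>y. \<bar>h y - h x\<bar>) x s / s * dist x x'"
proof -
  let ?g = "mollify s h"
  let ?A = "ball_average M (\<lambda>y. \<bar>h y - h x\<bar>) x s"
  have "ball_average M (\<lambda>y. \<bar>h y - ?g x\<bar>) x s \<le> ball_average M (\<lambda>y. \<bar>h y - h x\<bar> + \<bar>h x - ?g x\<bar>) x s"
    by (intro ball_average_mono set_integral_add(1) set_integrable_abs_diff set_integrable_bounded_ball[of _ "\<bar>h x - ?g x\<bar>"]) auto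
  also have "\<dots> = ?A + \<bar>?g x - h x\<bar>"
    using s by (subst ball_average_add)
      (auto simp: ball_average_const abs_minus_commute intro!: set_integrable_abs_diff set_integrable_bounded_ball[of _ "\<bar>h x - ?g x\<bar>"])
  also have "\<dots> \<le> (1 + 2 * C0 ^ 2) * ?A" using mollify_near[of x] by (simp add: algebra_simps)
  finally have "4 * C0 ^ 3 * (dist x x' / s) * ball_average M (\<lambda>y. \<bar>h y - ?g x\<bar>) x s
      \<le> 4 * C0 ^ 3 * (dist x x' / s) * ((1 + 2 * C0 ^ 2) * ?A)"
    using s C0_ge_1 by (intro mult_left_mono) auto
  with mollify_lip_near[OF d] show ?thesis by (simp add: ac_simps)
qed

lemma mollify_lipschitz: "\<exists>L. L-lipschitz_on UNIV (mollify s h)"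
proof -
  let ?g = "mollify s h"
  have k: "0 \<le> k" using h_le[of undefined] by linarith
  define K where "K = 4 * C0 ^ 3 * (1 + 2 * C0 ^ 2)"
  have K: "0 \<le> K" unfolding K_def using C0_ge_1 by simp
  have "dist (?g x) (?g x') \<le> (K * (2 * k) / s + 4 * k / s) * dist x x'" for x x'
  proof (cases "dist x x' \<le> s / 2")
    case True
    have "ball_average M (\<lambda>y. \<bar>h y - h x\<bar>) x s \<le> ball_average M (\<lambda>_. 2 * k) x s"
    proof (intro ball_average_mono set_integrable_abs_diff)
      show "\<bar>h y - h x\<bar> \<le> 2 * k" for y using h_le[of y] h_le[of x] by linarith
    qed (use k in \<open>auto intro!: set_integrable_bounded_ball[of _ "2 * k"]\<close>)
    then have "K * ball_average M (\<lambda>y. \<bar>h y - h x\<bar>) x s / s * dist x x' \<le> K * (2 * k) / s * dist x x'"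
      using s K by (intro mult_right_mono divide_right_mono mult_left_mono) (auto simp: ball_average_const)
    then have "\<bar>?g x' - ?g x\<bar> \<le> K * (2 * k) / s * dist x x'"
      using mollify_lip_osc[OF True] unfolding K_def by linarith
    moreover have "0 \<le> 4 * k / s * dist x x'" using k s by simp
    ultimately show ?thesis by (simp add: dist_real_def abs_minus_commute algebra_simps)
  next
    case False
    have "\<bar>?g x - ?g x'\<bar> \<le> 2 * k" using mollify_abs_le[of x] mollify_abs_le[of x'] by linarith
    also have "\<dots> = 4 * k / s * (s / 2)" using s by simp
    also have "\<dots> \<le> 4 * k / s * dist x x'" using False k s by (intro mult_left_mono) auto
    also have "\<dots> \<le> (K * (2 * k) / s + 4 * k / s) * dist x x'"
      using k s K by (intro mult_right_mono) auto
    finally show ?thesis by (simp add: dist_real_def)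
  qed
  then show ?thesis using k s K
    by (intro exI[of _ "K * (2 * k) / s + 4 * k / s"] lipschitz_onI) auto
qed

lemma ball_average_abs_powr_le:
  assumes "1 \<le> p"
  shows "ennreal (ball_average M (\<lambda>y. \<bar>h y - h x\<bar>) x s powr p) \<le>
    (1 / emeasure M (ball x s)) * (\<integral>\<^sup>+y\<in>ball x s. ennreal (\<bar>h y - h x\<bar> powr p) \<partial>M)"
proof -
  have bnd: "\<bar>h y - h x\<bar> \<le> 2 * k" for y using h_le[of y] h_le[of x] by linarith
  have le: "ball_average M (\<lambda>y. \<bar>h y - h x\<bar>) x s powr p \<le> ball_average M (\<lambda>y. \<bar>h y - h x\<bar> powr p) x s"
    using bnd s assms by (intro ball_average_powr_le) auto
  have int: "set_integrable M (ball x s) (\<lambda>y. \<bar>h y - h x\<bar> powr p)"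
    using bnd assms by (intro set_integrable_bounded_ball[of _ "(2 * k) powr p"]) (auto intro!: powr_mono2)
  show ?thesis
    using ennreal_leI[OF le] by (simp only: ennreal_ball_average[OF int powr_ge_zero s])
qed

end

lemma lipschitz_approximation:
  assumes p: "1 \<le> p"
  shows "\<exists>K>0. \<forall>h k s. h \<in> borel_measurable M \<longrightarrow> (\<forall>y. \<bar>h y\<bar> \<le> k) \<longrightarrow> 0 < s \<longrightarrow>
    (\<exists>g L. L-lipschitz_on UNIV g \<and> (\<forall>x.
      ennreal (pointwise_lip g x powr p) \<le> ennreal (K / s powr p) *
        ((1 / emeasure M (ball x s)) * (\<integral>\<^sup>+y\<in>ball x s. ennreal (\<bar>h y - h x\<bar> powr p) \<partial>M)) \<and>
      ennreal (\<bar>g x - h x\<bar> powr p) \<le> ennreal K *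
        ((1 / emeasure M (ball x s)) * (\<integral>\<^sup>+y\<in>ball x s. ennreal (\<bar>h y - h x\<bar> powr p) \<partial>M))))"
proof -
  define c where "c = 4 * C0 ^ 3 * (1 + 2 * C0 ^ 2)"
  have c2: "2 * C0 ^ 2 \<le> c"
  proof -
    have "1 \<le> C0 ^ 3" using C0_ge_1 by simp
    then have "1 * (1 + 2 * C0 ^ 2) \<le> (4 * C0 ^ 3) * (1 + 2 * C0 ^ 2)"
      by (intro mult_right_mono) auto
    then show ?thesis unfolding c_def by simp
  qed
  have c: "0 < c" unfolding c_def using C0_ge_1 by (simp add: add_pos_nonneg)
  show ?thesis
  proof (intro exI[of _ "c powr p"] conjI allI impI)
    show "0 < c powr p" using c by simp
    fix h :: "'a \<Rightarrow> real" and k s :: real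
    assume h: "h \<in> borel_measurable M" and k: "\<forall>y. \<bar>h y\<bar> \<le> k" and s: "0 < s"
    note hyp = h k[rule_format] s
    let ?A = "\<lambda>x. ball_average M (\<lambda>y. \<bar>h y - h x\<bar>) x s"
    let ?E = "\<lambda>x. (1 / emeasure M (ball x s)) * (\<integral>\<^sup>+y\<in>ball x s. ennreal (\<bar>h y - h x\<bar> powr p) \<partial>M)"
    have A: "0 \<le> ?A x" for x by (intro ball_average_nonneg) auto
    obtain L where L: "L-lipschitz_on UNIV (mollify s h)" using mollify_lipschitz[OF hyp] by blast
    have bound: "ennreal (v powr p) \<le> ennreal (a powr p) * ?E x"
      if v: "0 \<le> v" "v \<le> a * ?A x" and "0 \<le> a" for a v x
    proof -
      have "v powr p \<le> a powr p * ?A x powr p"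
        using powr_mono2[of p v "a * ?A x"] that A[of x] p by (simp add: powr_mult)
      then have "ennreal (v powr p) \<le> ennreal (a powr p) * ennreal (?A x powr p)"
        by (simp add: ennreal_leI flip: ennreal_mult')
      also have "\<dots> \<le> ennreal (a powr p) * ?E x"
        by (intro mult_left_mono ball_average_abs_powr_le[OF hyp p]) auto
      finally show ?thesis .
    qed
    have "ennreal (pointwise_lip (mollify s h) x powr p) \<le> ennreal (c powr p / s powr p) * ?E x" for x
    proof -
      have "pointwise_lip (mollify s h) x \<le> (c / s) * ?A x"
        using s c A[of x] mollify_lip_osc[OF hyp, of x]
        by (intro pointwise_lip_le[of _ "s / 2"]) (auto simp: c_def)
      then have "ennreal (pointwise_lip (mollify s h) x powr p) \<le> ennreal ((c / s) powr p) * ?E x"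
        using c s by (intro bound) (auto simp: pointwise_lip_def)
      then show ?thesis using c s by (simp add: powr_divide)
    qed
    moreover have "ennreal (\<bar>mollify s h x - h x\<bar> powr p) \<le> ennreal (c powr p) * ?E x" for x
    proof (rule bound)
      show "\<bar>mollify s h x - h x\<bar> \<le> c * ?A x"
        using mollify_near[OF hyp, of x] mult_right_mono[OF c2 A[of x]] by linarith
    qed (use c in auto)
    ultimately show "\<exists>g L. L-lipschitz_on UNIV g \<and> (\<forall>x.
        ennreal (pointwise_lip g x powr p) \<le> ennreal (c powr p / s powr p) * ?E x \<and>
        ennreal (\<bar>g x - h x\<bar> powr p) \<le> ennreal (c powr p) * ?E x)"
      using L by blast
  qed
qed

end

section \<open>Comparison of energies across scales\<close>

lemma Lp_iff: "f \<in> Lp p M \<longleftrightarrow> f \<in> borel_measurable M \<and> (\<integral>\<^sup>+x. ennreal (\<bar>f x\<bar> powr p) \<partial>M) < \<infinity>"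
  by (auto simp: Lp_def integrable_iff_bounded)

lemma ennreal_abs_add_powr_le2:
  assumes "1 \<le> p"
  shows "ennreal (\<bar>a + b\<bar> powr p) \<le> ennreal (2 powr p) * (ennreal (\<bar>a\<bar> powr p) + ennreal (\<bar>b\<bar> powr p))"
  using ennreal_leI[OF abs_add_powr_le2[OF assms, of a b]] by (simp add: ennreal_mult' flip: ennreal_plus)

lemma nn_integral_abs_add_powr_le2:
  assumes "1 \<le> p" and [measurable]: "u \<in> borel_measurable M" "v \<in> borel_measurable M" "S \<in> sets M"
  shows "(\<integral>\<^sup>+x\<in>S. ennreal (\<bar>u x + v x\<bar> powr p) \<partial>M) \<le>
    ennreal (2 powr p) * ((\<integral>\<^sup>+x\<in>S. ennreal (\<bar>u x\<bar> powr p) \<partial>M) + (\<integral>\<^sup>+x\<in>S. ennreal (\<bar>v x\<bar> powr p) \<partial>M))"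
proof -
  have "(\<integral>\<^sup>+x\<in>S. ennreal (\<bar>u x + v x\<bar> powr p) \<partial>M) \<le>
      (\<integral>\<^sup>+x. ennreal (2 powr p) * (ennreal (\<bar>u x\<bar> powr p) * indicator S x + ennreal (\<bar>v x\<bar> powr p) * indicator S x) \<partial>M)"
    using ennreal_abs_add_powr_le2[OF assms(1)]
    by (intro nn_integral_mono) (auto simp: indicator_def)
  also have "\<dots> = ennreal (2 powr p) * ((\<integral>\<^sup>+x\<in>S. ennreal (\<bar>u x\<bar> powr p) \<partial>M) + (\<integral>\<^sup>+x\<in>S. ennreal (\<bar>v x\<bar> powr p) \<partial>M))"
    by (subst nn_integral_cmult) (auto simp: nn_integral_add)
  finally show ?thesis .
qed

definition truncate :: "nat \<Rightarrow> ('a \<Rightarrow> real) \<Rightarrow> 'a \<Rightarrow> real" where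
  "truncate k h x = max (- real k) (min (real k) (h x))"

lemma truncate_abs_le: "\<bar>truncate k h x\<bar> \<le> real k"
  by (simp add: truncate_def)

lemma truncate_diff_le: "\<bar>truncate k h y - truncate k h x\<bar> \<le> \<bar>h y - h x\<bar>"
  unfolding truncate_def by linarith

lemma measurable_truncate [measurable]:
  "h \<in> borel_measurable M \<Longrightarrow> truncate k h \<in> borel_measurable M"
  unfolding truncate_def[abs_def] by (intro borel_measurable_max borel_measurable_min) simp_all

lemma truncate_tendsto_Lp:
  assumes "1 \<le> p" "h \<in> Lp p M"
  shows "(\<lambda>k. \<integral>\<^sup>+x. ennreal (\<bar>h x - truncate k h x\<bar> powr p) \<partial>M) \<longlonglongrightarrow> 0"
proof -
  have [measurable]: "h \<in> borel_measurable M" and fin: "(\<integral>\<^sup>+x. ennreal (\<bar>h x\<bar> powr p) \<partial>M) < \<infinity>"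
    using assms by (auto simp: Lp_iff)
  have "(\<lambda>k. \<integral>\<^sup>+x. ennreal (\<bar>h x - truncate k h x\<bar> powr p) \<partial>M) \<longlonglongrightarrow> (\<integral>\<^sup>+x. 0 \<partial>M)"
  proof (rule nn_integral_dominated_convergence[where w="\<lambda>x. ennreal (\<bar>h x\<bar> powr p)"])
    show "AE x in M. ennreal (\<bar>h x - truncate k h x\<bar> powr p) \<le> ennreal (\<bar>h x\<bar> powr p)" for k
      using assms(1) by (intro AE_I2 ennreal_leI powr_mono2) (auto simp: truncate_def)
    show "AE x in M. (\<lambda>k. ennreal (\<bar>h x - truncate k h x\<bar> powr p)) \<longlonglongrightarrow> 0"
    proof (rule AE_I2)
      fix x
      obtain n :: nat where n: "\<bar>h x\<bar> \<le> real n" using real_arch_simple by blast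
      have "eventually (\<lambda>k. ennreal (\<bar>h x - truncate k h x\<bar> powr p) = 0) sequentially"
        using eventually_ge_at_top[of n]
      proof eventually_elim
        case (elim k)
        then have "\<bar>h x\<bar> \<le> real k" using n by linarith
        then have "truncate k h x = h x" by (auto simp: truncate_def)
        then show ?case using assms by simp
      qed
      then show "(\<lambda>k. ennreal (\<bar>h x - truncate k h x\<bar> powr p)) \<longlonglongrightarrow> 0"
        by (rule tendsto_eventually)
    qed
  qed (use fin in auto)
  then show ?thesis by simp
qed

lemma nn_energy_mono_fun:
  assumes "\<And>x y. \<bar>f y - f x\<bar> \<le> \<bar>g y - g x\<bar>" "0 \<le> p"
  shows "nn_energy p M r f U \<le> nn_energy p M r g U"
  unfolding nn_energy_def using assms
  by (intro mult_left_mono nn_integral_mono mult_right_mono ennreal_leI powr_mono2) auto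

context metric_doubling
begin

definition mean_osc :: "real \<Rightarrow> real \<Rightarrow> ('a \<Rightarrow> real) \<Rightarrow> 'a \<Rightarrow> ennreal" where
  "mean_osc p r f x = (1 / emeasure M (ball x r)) * (\<integral>\<^sup>+y\<in>ball x r. ennreal (\<bar>f y - f x\<bar> powr p) \<partial>M)"

lemma nn_energy_eq: "nn_energy p M r f U = ennreal (1 / r powr p) * (\<integral>\<^sup>+x\<in>U. mean_osc p r f x \<partial>M)"
  unfolding nn_energy_def mean_osc_def ..

lemma measurable_mean_osc [measurable]:
  assumes [measurable]: "f \<in> borel_measurable M"
  shows "mean_osc p r f \<in> borel_measurable M"
  unfolding mean_osc_def[abs_def] by measurable

lemma measurable_open [measurable]: "open U \<Longrightarrow> U \<in> sets M"
  by (simp add: sets_M)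

lemma mean_osc_le_sum:
  assumes [measurable]: "f \<in> borel_measurable M" "u \<in> borel_measurable M" "v \<in> borel_measurable M"
    and le: "\<And>y. ennreal (\<bar>f y - f x\<bar> powr p) \<le> c * (u y + v y)"
  shows "mean_osc p r f x \<le> c * ((1 / emeasure M (ball x r)) * (\<integral>\<^sup>+y\<in>ball x r. u y \<partial>M) +
    (1 / emeasure M (ball x r)) * (\<integral>\<^sup>+y\<in>ball x r. v y \<partial>M))"
proof -
  have "(\<integral>\<^sup>+y\<in>ball x r. ennreal (\<bar>f y - f x\<bar> powr p) \<partial>M) \<le>
      (\<integral>\<^sup>+y. c * (u y * indicator (ball x r) y + v y * indicator (ball x r) y) \<partial>M)"
    using le by (intro nn_integral_mono) (auto simp: indicator_def)
  also have "\<dots> = c * ((\<integral>\<^sup>+y\<in>ball x r. u y \<partial>M) + (\<integral>\<^sup>+y\<in>ball x r. v y \<partial>M))"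
    by (subst nn_integral_cmult) (auto simp: nn_integral_add)
  finally have "mean_osc p r f x \<le> (1 / emeasure M (ball x r)) *
      (c * ((\<integral>\<^sup>+y\<in>ball x r. u y \<partial>M) + (\<integral>\<^sup>+y\<in>ball x r. v y \<partial>M)))"
    unfolding mean_osc_def by (rule mult_left_mono) simp
  then show ?thesis by (simp add: distrib_left mult.left_commute)
qed

lemma nn_energy_add_le:
  assumes p: "1 \<le> p" and [measurable]: "f \<in> borel_measurable M" "g \<in> borel_measurable M" "open U"
  shows "nn_energy p M r (\<lambda>x. f x + g x) U \<le> ennreal (2 powr p) * (nn_energy p M r f U + nn_energy p M r g U)"
proof -
  have "mean_osc p r (\<lambda>x. f x + g x) x \<le> ennreal (2 powr p) * (mean_osc p r f x + mean_osc p r g x)" for x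
  proof -
    have "ennreal (\<bar>(f y + g y) - (f x + g x)\<bar> powr p) \<le>
        ennreal (2 powr p) * (ennreal (\<bar>f y - f x\<bar> powr p) + ennreal (\<bar>g y - g x\<bar> powr p))" for y
      using ennreal_abs_add_powr_le2[OF p, of "f y - f x" "g y - g x"] by (simp add: algebra_simps)
    then show ?thesis unfolding mean_osc_def[of p r f] mean_osc_def[of p r g]
      by (intro mean_osc_le_sum) auto
  qed
  then have "(\<integral>\<^sup>+x\<in>U. mean_osc p r (\<lambda>x. f x + g x) x \<partial>M) \<le>
      (\<integral>\<^sup>+x. ennreal (2 powr p) * (mean_osc p r f x * indicator U x + mean_osc p r g x * indicator U x) \<partial>M)"
    by (intro nn_integral_mono) (auto simp: indicator_def)
  also have "\<dots> = ennreal (2 powr p) * ((\<integral>\<^sup>+x\<in>U. mean_osc p r f x \<partial>M) + (\<integral>\<^sup>+x\<in>U. mean_osc p r g x \<partial>M))"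
    by (subst nn_integral_cmult) (auto simp: nn_integral_add)
  finally have "nn_energy p M r (\<lambda>x. f x + g x) U \<le> ennreal (1 / r powr p) * (ennreal (2 powr p) *
     ((\<integral>\<^sup>+x\<in>U. mean_osc p r f x \<partial>M) + (\<integral>\<^sup>+x\<in>U. mean_osc p r g x \<partial>M)))"
    unfolding nn_energy_eq by (rule mult_left_mono) simp
  then show ?thesis unfolding nn_energy_eq by (simp add: distrib_left mult.left_commute)
qed

lemma nn_energy_le_Lp:
  assumes p: "1 \<le> p" and [measurable]: "u \<in> borel_measurable M" "open U" "open V"
    and R: "0 < R" and UV: "\<And>x. x \<in> U \<Longrightarrow> ball x R \<subseteq> V"
  shows "nn_energy p M R u U \<le> ennreal (2 powr p * (C0 + 1)) *
    (ennreal (1 / R powr p) * (\<integral>\<^sup>+x\<in>V. ennreal (\<bar>u x\<bar> powr p) \<partial>M))"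
proof -
  define a where "a y = ennreal (\<bar>u y\<bar> powr p)" for y
  have [measurable]: "a \<in> borel_measurable M" unfolding a_def by measurable
  have UV': "U \<subseteq> V" using UV R by fastforce
  have "mean_osc p R u x * indicator U x \<le> ennreal (2 powr p) *
      ((1 / emeasure M (ball x R)) * (\<integral>\<^sup>+y\<in>ball x R. (a y * indicator V y) \<partial>M) + a x * indicator V x)" for x
  proof (cases "x \<in> U")
    case True
    have "ennreal (\<bar>u y - u x\<bar> powr p) \<le> ennreal (2 powr p) * (a y + a x)" for y
      using ennreal_abs_add_powr_le2[OF p, of "u y" "- u x"] by (simp add: a_def)
    then have "mean_osc p R u x \<le> ennreal (2 powr p) * ((1 / emeasure M (ball x R)) * (\<integral>\<^sup>+y\<in>ball x R. a y \<partial>M) +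
        (1 / emeasure M (ball x R)) * (\<integral>\<^sup>+y\<in>ball x R. a x \<partial>M))"
      by (intro mean_osc_le_sum) auto
    also have "(1 / emeasure M (ball x R)) * (\<integral>\<^sup>+y\<in>ball x R. a x \<partial>M) = a x"
      using inverse_emeasure_ball_mult[OF R, of x]
      by (simp add: nn_integral_cmult_indicator mult.left_commute[of _ "a x"])
    also have "(\<integral>\<^sup>+y\<in>ball x R. a y \<partial>M) = (\<integral>\<^sup>+y\<in>ball x R. (a y * indicator V y) \<partial>M)"
      using UV[OF True] by (intro nn_integral_cong) (auto simp: indicator_def)
    finally show ?thesis using True UV' by (auto simp: indicator_def)
  qed simp
  then have "(\<integral>\<^sup>+x\<in>U. mean_osc p R u x \<partial>M) \<le> (\<integral>\<^sup>+x. ennreal (2 powr p) *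
      ((1 / emeasure M (ball x R)) * (\<integral>\<^sup>+y\<in>ball x R. (a y * indicator V y) \<partial>M) + a x * indicator V x) \<partial>M)"
    by (rule nn_integral_mono)
  also have "\<dots> = ennreal (2 powr p) * ((\<integral>\<^sup>+x. (1 / emeasure M (ball x R)) *
      (\<integral>\<^sup>+y\<in>ball x R. (a y * indicator V y) \<partial>M) \<partial>M) + (\<integral>\<^sup>+x\<in>V. a x \<partial>M))"
    by (subst nn_integral_cmult) (auto simp: nn_integral_add)
  also have "\<dots> \<le> ennreal (2 powr p) * (ennreal (C0 ^ 1) * (\<integral>\<^sup>+x\<in>V. a x \<partial>M) + (\<integral>\<^sup>+x\<in>V. a x \<partial>M))"
    using R by (intro mult_left_mono add_right_mono nn_integral_ball_kernel_le) auto
  also have "\<dots> = ennreal (2 powr p * (C0 + 1)) * (\<integral>\<^sup>+x\<in>V. a x \<partial>M)"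
    using C0_ge_1 by (simp add: ennreal_mult' distrib_right mult.assoc)
  finally have "nn_energy p M R u U \<le> ennreal (1 / R powr p) *
      (ennreal (2 powr p * (C0 + 1)) * (\<integral>\<^sup>+x\<in>V. a x \<partial>M))"
    unfolding nn_energy_eq by (rule mult_left_mono) simp
  then show ?thesis unfolding a_def by (simp add: mult.left_commute)
qed

end

context cheeger
begin

lemma nn_energy_comparison_bounded:
  "\<exists>C>0. \<forall>f h k s R U V. f \<in> borel_measurable M \<longrightarrow> h \<in> borel_measurable M \<longrightarrow> (\<forall>y. \<bar>h y\<bar> \<le> k) \<longrightarrow>
    0 < s \<longrightarrow> s \<le> R \<longrightarrow> open U \<longrightarrow> open V \<longrightarrow> (\<forall>x\<in>U. ball x ((1 + 2 * l) * R) \<subseteq> V) \<longrightarrow>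
    nn_energy p M R f U \<le> ennreal C * (nn_energy p M s h V +
      ennreal (1 / R powr p) * (\<integral>\<^sup>+x. ennreal (\<bar>f x - h x\<bar> powr p) \<partial>M))"
proof -
  have p1: "1 \<le> p" using p by simp
  obtain Cu where Cu: "0 < Cu" and grad: "\<forall>g L G R U V. L-lipschitz_on UNIV g \<longrightarrow> G \<in> borel_measurable M \<longrightarrow>
      (\<forall>x. ennreal (pointwise_lip g x powr p) \<le> G x) \<longrightarrow> 0 < R \<longrightarrow> open U \<longrightarrow> open V \<longrightarrow>
      (\<forall>x\<in>U. ball x ((1 + 2 * l) * R) \<subseteq> V) \<longrightarrow>
      nn_energy p M R g U \<le> ennreal Cu * (\<integral>\<^sup>+x\<in>V. G x \<partial>M)"
    using nn_energy_le_upper_gradient by (elim exE conjE)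
  note grad = grad[rule_format]
  obtain K where K: "0 < K" and approx: "\<forall>h k s. h \<in> borel_measurable M \<longrightarrow> (\<forall>y. \<bar>h y\<bar> \<le> k) \<longrightarrow> 0 < s \<longrightarrow>
    (\<exists>g L. L-lipschitz_on UNIV g \<and> (\<forall>x.
      ennreal (pointwise_lip g x powr p) \<le> ennreal (K / s powr p) * mean_osc p s h x \<and>
      ennreal (\<bar>g x - h x\<bar> powr p) \<le> ennreal K * mean_osc p s h x))"
    using lipschitz_approximation[OF p1] unfolding mean_osc_def by (elim exE conjE)
  define b where "b = 2 powr p * (2 powr p * (C0 + 1) * 2 powr p)"
  have b: "0 \<le> b" using C0_ge_1 by (simp add: b_def)
  define C where "C = 2 powr p * (Cu * K) + b * K + b"
  have C: "0 < C" unfolding C_def using Cu K b by (intro add_pos_nonneg) auto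
  show ?thesis
  proof (intro exI[of _ C] conjI allI impI)
    show "0 < C" by (rule C)
    fix f h :: "'a \<Rightarrow> real" and k s R and U V :: "'a set"
    assume [measurable]: "f \<in> borel_measurable M" and hm [measurable]: "h \<in> borel_measurable M"
      and hk: "\<forall>y. \<bar>h y\<bar> \<le> k" and s: "0 < s" "s \<le> R" and op [measurable]: "open U" "open V"
      and UV: "\<forall>x\<in>U. ball x ((1 + 2 * l) * R) \<subseteq> V"
    define E where "E = nn_energy p M s h V"
    define J where "J = ennreal (1 / R powr p) * (\<integral>\<^sup>+x. ennreal (\<bar>f x - h x\<bar> powr p) \<partial>M)"
    obtain g L where lip: "L-lipschitz_on UNIV g"
      and g_lip: "\<And>x. ennreal (pointwise_lip g x powr p) \<le> ennreal (K / s powr p) * mean_osc p s h x"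
      and g_near: "\<And>x. ennreal (\<bar>g x - h x\<bar> powr p) \<le> ennreal K * mean_osc p s h x"
      using approx[rule_format, OF hm hk[rule_format] s(1)] by (elim exE conjE) blast
    have "continuous_on UNIV g" using lip lipschitz_on_continuous_on by blast
    then have "g \<in> borel_measurable borel" by (rule borel_measurable_continuous_onI)
    then have [measurable]: "g \<in> borel_measurable M" using measurable_cong_sets[OF sets_M refl] by blast
    have grad_part: "nn_energy p M R g U \<le> ennreal (Cu * K) * E"
    proof -
      have "nn_energy p M R g U \<le> ennreal Cu * (\<integral>\<^sup>+x\<in>V. (ennreal (K / s powr p) * mean_osc p s h x) \<partial>M)"
        using UV s g_lip op by (intro grad[OF lip]) auto
      also have "(\<integral>\<^sup>+x\<in>V. (ennreal (K / s powr p) * mean_osc p s h x) \<partial>M) =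
          ennreal (K / s powr p) * (\<integral>\<^sup>+x\<in>V. mean_osc p s h x \<partial>M)"
        by (simp add: nn_integral_cmult mult.assoc)
      also have "\<dots> = ennreal K * E"
        unfolding E_def nn_energy_eq using K by (simp add: ennreal_mult' divide_inverse mult.assoc)
      finally show ?thesis using Cu by (simp add: ennreal_mult' mult.assoc)
    qed
    have near_part: "ennreal (1 / R powr p) * (\<integral>\<^sup>+x\<in>V. ennreal (\<bar>h x - g x\<bar> powr p) \<partial>M) \<le> ennreal K * E"
    proof -
      have "(\<integral>\<^sup>+x\<in>V. ennreal (\<bar>h x - g x\<bar> powr p) \<partial>M) \<le> (\<integral>\<^sup>+x\<in>V. (ennreal K * mean_osc p s h x) \<partial>M)"
        using g_near by (intro nn_integral_mono mult_right_mono) (auto simp: abs_minus_commute)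
      also have "\<dots> = ennreal K * (\<integral>\<^sup>+x\<in>V. mean_osc p s h x \<partial>M)"
        by (simp add: nn_integral_cmult mult.assoc)
      finally have "ennreal (1 / R powr p) * (\<integral>\<^sup>+x\<in>V. ennreal (\<bar>h x - g x\<bar> powr p) \<partial>M) \<le>
          ennreal (1 / s powr p) * (ennreal K * (\<integral>\<^sup>+x\<in>V. mean_osc p s h x \<partial>M))"
        using s p by (intro mult_mono ennreal_leI) (auto intro!: divide_left_mono powr_mono2)
      then show ?thesis unfolding E_def nn_energy_eq by (simp add: mult.left_commute)
    qed
    have "(\<integral>\<^sup>+x\<in>V. ennreal (\<bar>f x - g x\<bar> powr p) \<partial>M) \<le>
        ennreal (2 powr p) * ((\<integral>\<^sup>+x\<in>V. ennreal (\<bar>f x - h x\<bar> powr p) \<partial>M) + (\<integral>\<^sup>+x\<in>V. ennreal (\<bar>h x - g x\<bar> powr p) \<partial>M))"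
      using nn_integral_abs_add_powr_le2[OF p1, of "\<lambda>x. f x - h x" M "\<lambda>x. h x - g x" V] by simp
    also have "\<dots> \<le> ennreal (2 powr p) * ((\<integral>\<^sup>+x. ennreal (\<bar>f x - h x\<bar> powr p) \<partial>M) +
        (\<integral>\<^sup>+x\<in>V. ennreal (\<bar>h x - g x\<bar> powr p) \<partial>M))"
      by (intro mult_left_mono add_right_mono nn_integral_mono) (auto simp: indicator_def)
    finally have "ennreal (1 / R powr p) * (\<integral>\<^sup>+x\<in>V. ennreal (\<bar>f x - g x\<bar> powr p) \<partial>M) \<le> ennreal (1 / R powr p) *
        (ennreal (2 powr p) * ((\<integral>\<^sup>+x. ennreal (\<bar>f x - h x\<bar> powr p) \<partial>M) + (\<integral>\<^sup>+x\<in>V. ennreal (\<bar>h x - g x\<bar> powr p) \<partial>M)))"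
      by (rule mult_left_mono) simp
    also have "\<dots> = ennreal (2 powr p) * (J + ennreal (1 / R powr p) * (\<integral>\<^sup>+x\<in>V. ennreal (\<bar>h x - g x\<bar> powr p) \<partial>M))"
      unfolding J_def by (simp add: distrib_left mult.left_commute)
    also have "\<dots> \<le> ennreal (2 powr p) * (J + ennreal K * E)"
      by (intro mult_left_mono add_left_mono near_part) auto
    finally have Lp_part: "ennreal (1 / R powr p) * (\<integral>\<^sup>+x\<in>V. ennreal (\<bar>f x - g x\<bar> powr p) \<partial>M) \<le>
        ennreal (2 powr p) * (J + ennreal K * E)" .
    have "nn_energy p M R (\<lambda>x. f x - g x) U \<le> ennreal (2 powr p * (C0 + 1)) *
        (ennreal (1 / R powr p) * (\<integral>\<^sup>+x\<in>V. ennreal (\<bar>f x - g x\<bar> powr p) \<partial>M))"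
    proof (rule nn_energy_le_Lp[OF p1])
      have "R \<le> (1 + 2 * l) * R" using s l by simp
      then show "ball x R \<subseteq> V" if "x \<in> U" for x using UV that subset_ball by blast
    qed (use s op in auto)
    also have "\<dots> \<le> ennreal (2 powr p * (C0 + 1)) * (ennreal (2 powr p) * (J + ennreal K * E))"
      by (intro mult_left_mono Lp_part) simp
    finally have diff_part: "nn_energy p M R (\<lambda>x. f x - g x) U \<le>
        ennreal (2 powr p * (C0 + 1)) * (ennreal (2 powr p) * (J + ennreal K * E))" .
    have "nn_energy p M R f U \<le> ennreal (2 powr p) * (nn_energy p M R g U + nn_energy p M R (\<lambda>x. f x - g x) U)"
      using nn_energy_add_le[OF p1, of g "\<lambda>x. f x - g x" U R] op by simp
    also have "\<dots> \<le> ennreal (2 powr p) * (ennreal (Cu * K) * E +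
        ennreal (2 powr p * (C0 + 1)) * (ennreal (2 powr p) * (J + ennreal K * E)))"
      by (intro mult_left_mono add_mono grad_part diff_part) simp
    also have "\<dots> = ennreal (2 powr p * (Cu * K)) * E + ennreal (b * K) * E + ennreal b * J"
    proof -
      have "ennreal b = ennreal (2 powr p) * (ennreal (2 powr p * (C0 + 1)) * ennreal (2 powr p))"
        unfolding b_def using C0_ge_1 by (simp add: ennreal_mult' mult.assoc)
      then show ?thesis using b by (simp add: ennreal_mult' distrib_left add.assoc mult.assoc add.commute)
    qed
    also have "\<dots> = ennreal (2 powr p * (Cu * K) + b * K) * E + ennreal b * J"
      using Cu K b by (simp add: ennreal_plus distrib_right)
    also have "\<dots> \<le> ennreal C * E + ennreal C * J"
      using Cu K b by (intro add_mono mult_right_mono ennreal_leI) (auto simp: C_def)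
    finally show "nn_energy p M R f U \<le> ennreal C * (nn_energy p M s h V +
        ennreal (1 / R powr p) * (\<integral>\<^sup>+x. ennreal (\<bar>f x - h x\<bar> powr p) \<partial>M))"
      unfolding E_def J_def by (simp add: distrib_left)
  qed
qed

lemma nn_energy_comparison:
  "\<exists>C>0. \<forall>f h s R U V. f \<in> borel_measurable M \<longrightarrow> h \<in> Lp p M \<longrightarrow>
    0 < s \<longrightarrow> s \<le> R \<longrightarrow> open U \<longrightarrow> open V \<longrightarrow> (\<forall>x\<in>U. ball x ((1 + 2 * l) * R) \<subseteq> V) \<longrightarrow>
    nn_energy p M R f U \<le> ennreal C * (nn_energy p M s h V +
      ennreal (1 / R powr p) * (\<integral>\<^sup>+x. ennreal (\<bar>f x - h x\<bar> powr p) \<partial>M))"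
proof -
  have p1: "1 \<le> p" using p by simp
  obtain C where C: "0 < C" and comp: "\<forall>f h k s R U V. f \<in> borel_measurable M \<longrightarrow> h \<in> borel_measurable M \<longrightarrow> (\<forall>y. \<bar>h y\<bar> \<le> k) \<longrightarrow>
    0 < s \<longrightarrow> s \<le> R \<longrightarrow> open U \<longrightarrow> open V \<longrightarrow> (\<forall>x\<in>U. ball x ((1 + 2 * l) * R) \<subseteq> V) \<longrightarrow>
    nn_energy p M R f U \<le> ennreal C * (nn_energy p M s h V +
      ennreal (1 / R powr p) * (\<integral>\<^sup>+x. ennreal (\<bar>f x - h x\<bar> powr p) \<partial>M))"
    using nn_energy_comparison_bounded by (elim exE conjE)
  note comp = comp[rule_format]
  have two: "1 \<le> (2::real) powr p" using p by (simp add: ge_one_powr_ge_zero)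
  show ?thesis
  proof (intro exI[of _ "C * 2 powr p"] conjI allI impI)
    show "0 < C * 2 powr p" using C by simp
    fix f h :: "'a \<Rightarrow> real" and s R and U V :: "'a set"
    assume [measurable]: "f \<in> borel_measurable M" and h: "h \<in> Lp p M"
      and s: "0 < s" "s \<le> R" and op: "open U" "open V" and UV: "\<forall>x\<in>U. ball x ((1 + 2 * l) * R) \<subseteq> V"
    have [measurable]: "h \<in> borel_measurable M" using h by (simp add: Lp_iff)
    define a where "a k = (\<integral>\<^sup>+x. ennreal (\<bar>h x - truncate k h x\<bar> powr p) \<partial>M)" for k
    define E where "E = nn_energy p M s h V"
    define J where "J = (\<integral>\<^sup>+x. ennreal (\<bar>f x - h x\<bar> powr p) \<partial>M)"
    have "nn_energy p M R f U \<le> ennreal C * (E + ennreal (1 / R powr p) * (ennreal (2 powr p) * (J + a k)))" for k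
    proof -
      have "nn_energy p M R f U \<le> ennreal C * (nn_energy p M s (truncate k h) V +
          ennreal (1 / R powr p) * (\<integral>\<^sup>+x. ennreal (\<bar>f x - truncate k h x\<bar> powr p) \<partial>M))"
        using s op UV truncate_abs_le by (intro comp) auto
      also have "\<dots> \<le> ennreal C * (E + ennreal (1 / R powr p) * (ennreal (2 powr p) * (J + a k)))"
      proof (intro mult_left_mono add_mono)
        show "nn_energy p M s (truncate k h) V \<le> E"
          unfolding E_def using truncate_diff_le p by (intro nn_energy_mono_fun) auto
        show "(\<integral>\<^sup>+x. ennreal (\<bar>f x - truncate k h x\<bar> powr p) \<partial>M) \<le> ennreal (2 powr p) * (J + a k)"
          unfolding J_def a_def
          using nn_integral_abs_add_powr_le2[OF p1, of "\<lambda>x. f x - h x" M "\<lambda>x. h x - truncate k h x" UNIV] by simp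
      qed auto
      finally show ?thesis .
    qed
    moreover have "(\<lambda>k. ennreal C * (E + ennreal (1 / R powr p) * (ennreal (2 powr p) * (J + a k))))
        \<longlonglongrightarrow> ennreal C * (E + ennreal (1 / R powr p) * (ennreal (2 powr p) * (J + 0)))"
      unfolding a_def using truncate_tendsto_Lp[OF p1 h]
      by (intro ennreal_tendsto_cmult tendsto_add tendsto_const) auto
    ultimately have "nn_energy p M R f U \<le>
        ennreal C * (E + ennreal (1 / R powr p) * (ennreal (2 powr p) * (J + 0)))"
      by (intro LIMSEQ_le_const) auto
    also have "\<dots> \<le> ennreal C * (ennreal (2 powr p) * E + ennreal (1 / R powr p) * (ennreal (2 powr p) * J))"
      using two mult_right_mono[of 1 "ennreal (2 powr p)" E] by (intro mult_left_mono add_mono) auto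
    also have "\<dots> = ennreal (C * 2 powr p) * (E + ennreal (1 / R powr p) * J)"
      using C by (simp add: ennreal_mult' distrib_left ac_simps)
    finally show "nn_energy p M R f U \<le> ennreal (C * 2 powr p) * (nn_energy p M s h V +
        ennreal (1 / R powr p) * (\<integral>\<^sup>+x. ennreal (\<bar>f x - h x\<bar> powr p) \<partial>M))"
      unfolding E_def J_def .
  qed
qed

end

section \<open>The De Giorgi--Letta criterion\<close>

locale de_giorgi_letta =
  fixes G :: "'a::topological_space set \<Rightarrow> ennreal"
  assumes empty: "G {} = 0"
    and inner_regular: "open V \<Longrightarrow> G V = (SUP U\<in>{U. open U \<and> U \<Subset> V}. G U)"
    and superadditive: "open U \<Longrightarrow> open V \<Longrightarrow> U \<inter> V = {} \<Longrightarrow> G U + G V \<le> G (U \<union> V)"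
    and subadditive: "open U \<Longrightarrow> open V \<Longrightarrow> G (U \<union> V) \<le> G U + G V"
begin

lemma mono: "open U \<Longrightarrow> open V \<Longrightarrow> U \<subseteq> V \<Longrightarrow> G U \<le> G V"
  unfolding inner_regular[of U] inner_regular[of V]
  by (intro SUP_subset_mono) (auto simp: compactly_contained_def)

lemma finite_subadditive:
  fixes U :: "nat \<Rightarrow> 'a set"
  assumes "\<And>i. open (U i)"
  shows "G (\<Union>i<n. U i) \<le> (\<Sum>i<n. G (U i))"
proof (induction n)
  case (Suc n)
  have "G (\<Union>i<Suc n. U i) = G ((\<Union>i<n. U i) \<union> U n)" by (simp add: lessThan_Suc Un_commute)
  also have "\<dots> \<le> G (\<Union>i<n. U i) + G (U n)" using assms by (intro subadditive) auto
  also have "\<dots> \<le> (\<Sum>i<Suc n. G (U i))" using Suc by (simp add: add_right_mono)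
  finally show ?case .
qed (simp add: empty)

lemma countably_subadditive:
  fixes U :: "nat \<Rightarrow> 'a set"
  assumes op: "\<And>i. open (U i)"
  shows "G (\<Union>i. U i) \<le> (\<Sum>i. G (U i))"
proof -
  have "G K \<le> (\<Sum>i. G (U i))" if K: "open K" "K \<Subset> (\<Union>i. U i)" for K
  proof -
    have "compact (closure K)" "closure K \<subseteq> (\<Union>i. U i)" using K by (auto simp: compactly_contained_def)
    then obtain S where S: "finite S" "closure K \<subseteq> (\<Union>i\<in>S. U i)"
      using op by (auto elim!: compactE_image[of "closure K" UNIV U])
    then obtain n where "S \<subseteq> {..<n}" using finite_nat_bounded by blast
    then have "K \<subseteq> (\<Union>i<n. U i)" using S closure_subset by blast
    then have "G K \<le> G (\<Union>i<n. U i)" using K op by (intro mono) auto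
    also have "\<dots> \<le> (\<Sum>i<n. G (U i))" by (rule finite_subadditive[OF op])
    also have "\<dots> \<le> (\<Sum>i. G (U i))" by (intro sum_le_suminf) auto
    finally show ?thesis .
  qed
  then show ?thesis using op by (subst inner_regular) (auto intro!: SUP_least)
qed

definition outer :: "'a set \<Rightarrow> ennreal" where
  "outer A = (INF U\<in>{U. open U \<and> A \<subseteq> U}. G U)"

lemma outer_open: "open U \<Longrightarrow> outer U = G U"
  unfolding outer_def by (intro antisym INF_lower INF_greatest) (auto intro: mono)

lemma outer_le: "open U \<Longrightarrow> A \<subseteq> U \<Longrightarrow> outer A \<le> G U"
  unfolding outer_def by (intro INF_lower) auto

lemma outer_mono: "A \<subseteq> B \<Longrightarrow> outer A \<le> outer B"
  unfolding outer_def by (intro INF_superset_mono) auto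

lemma outer_countably_subadditive:
  fixes A :: "nat \<Rightarrow> 'a set"
  shows "outer (\<Union>i. A i) \<le> (\<Sum>i. outer (A i))"
proof (rule ennreal_le_epsilon)
  fix e :: real assume e: "0 < e" and fin: "(\<Sum>n. outer (A n)) < top"
  then have "outer (A n) < outer (A n) + e * (1/2)^Suc n" for n
    by (auto simp add: less_top dest!: ennreal_suminf_lessD)
  moreover have "\<exists>U. open U \<and> A n \<subseteq> U \<and> G U < b" if "outer (A n) < b" for n b
    using that unfolding outer_def INF_less_iff by auto
  ultimately have "\<exists>U. open U \<and> A n \<subseteq> U \<and> G U < outer (A n) + e * (1/2)^Suc n" for n
    by blast
  then obtain U where U: "\<And>n. open (U n)" "\<And>n. A n \<subseteq> U n"
      "\<And>n. G (U n) \<le> outer (A n) + e * (1/2)^Suc n"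
    by (metis less_imp_le)
  have "outer (\<Union>i. A i) \<le> G (\<Union>i. U i)" using U by (intro outer_le) auto
  also have "\<dots> \<le> (\<Sum>i. G (U i))" by (rule countably_subadditive[OF U(1)])
  also have "\<dots> \<le> (\<Sum>n. outer (A n) + e * (1/2) ^ Suc n)" using U by (intro suminf_le) auto
  also have "\<dots> = (\<Sum>n. outer (A n)) + (\<Sum>n. ennreal e * ennreal ((1/2) ^ Suc n))"
    using e by (subst suminf_add[symmetric])
      (auto simp del: ennreal_suminf_cmult simp add: ennreal_mult[symmetric])
  also have "\<dots> = (\<Sum>n. outer (A n)) + e"
    unfolding ennreal_suminf_cmult
    by (subst suminf_ennreal_eq[OF zero_le_power power_half_series]) auto
  finally show "outer (\<Union>i. A i) \<le> (\<Sum>n. outer (A n)) + e" .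
qed

lemma outer_empty: "outer {} = 0"
  using outer_open[of "{}"] empty by simp

lemma outer_Un: "outer (A \<union> B) \<le> outer A + outer B"
proof -
  have "A \<union> B = (\<Union>i::nat. if i = 0 then A else if i = 1 then B else {})" (is "_ = (\<Union>i. ?F i)")
    by (auto split: if_splits)
  then have "outer (A \<union> B) \<le> (\<Sum>i. outer (?F i))" by (metis outer_countably_subadditive)
  also have "\<dots> = (\<Sum>i\<in>{0,1}. outer (?F i))" by (rule suminf_finite) (auto simp: outer_empty)
  finally show ?thesis by simp
qed

text \<open>For open \<open>W\<close> containing \<open>A\<close> and open \<open>K\<close> with compact closure in \<open>W \<inter> U\<close>, the sets \<open>K\<close> and
  \<open>W - closure K\<close> are disjoint, open and contained in \<open>W\<close>, and the latter covers \<open>A - U\<close>.\<close>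

lemma outer_caratheodory:
  assumes U: "open U"
  shows "outer (A \<inter> U) + outer (A - U) = outer A"
proof (rule antisym)
  show "outer (A \<inter> U) + outer (A - U) \<le> outer A"
    unfolding outer_def[of A]
  proof (rule INF_greatest)
    fix W assume "W \<in> {U. open U \<and> A \<subseteq> U}"
    then have W: "open W" "A \<subseteq> W" by auto
    have "G K + outer (A - U) \<le> G W" if K: "open K" "K \<Subset> W \<inter> U" for K
    proof -
      have clK: "closure K \<subseteq> W \<inter> U" using K by (simp add: compactly_contained_def)
      have "outer (A - U) \<le> G (W - closure K)" using W clK by (intro outer_le) auto
      then have "G K + outer (A - U) \<le> G K + G (W - closure K)" by (rule add_left_mono)
      also have "\<dots> \<le> G (K \<union> (W - closure K))"
        using K W closure_subset by (intro superadditive) auto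
      also have "\<dots> \<le> G W" using K W clK closure_subset by (intro mono) auto
      finally show ?thesis .
    qed
    then have "(SUP K\<in>{K. open K \<and> K \<Subset> W \<inter> U}. G K + outer (A - U)) \<le> G W"
      by (intro SUP_least) auto
    moreover have "(SUP K\<in>{K. open K \<and> K \<Subset> W \<inter> U}. G K + outer (A - U)) =
        (SUP K\<in>{K. open K \<and> K \<Subset> W \<inter> U}. G K) + outer (A - U)"
      by (intro ennreal_SUP_add_left) (auto simp: compactly_contained_def intro!: exI[of _ "{}"])
    moreover have "outer (A \<inter> U) \<le> (SUP K\<in>{K. open K \<and> K \<Subset> W \<inter> U}. G K)"
      using outer_le[of "W \<inter> U" "A \<inter> U"] inner_regular[of "W \<inter> U"] W U by auto
    ultimately show "outer (A \<inter> U) + outer (A - U) \<le> G W"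
      by (metis add_right_mono order_trans)
  qed
  show "outer A \<le> outer (A \<inter> U) + outer (A - U)"
    using outer_Un[of "A \<inter> U" "A - U"] by (simp add: Int_Diff_Un)
qed

definition borel_extension :: "'a measure" where
  "borel_extension = measure_of UNIV (sets borel) outer"

lemma sets_borel_extension: "sets borel_extension = sets borel"
  unfolding borel_extension_def by (metis sets.sets_measure_of_eq space_borel)

lemma emeasure_borel_extension:
  assumes "A \<in> sets borel"
  shows "emeasure borel_extension A = outer A"
proof -
  interpret P: sigma_algebra UNIV "UNIV :: 'a set set" using sigma_algebra_Pow[of UNIV] by simp
  let ?L = "lambda_system UNIV UNIV outer"
  have oms: "outer_measure_space UNIV outer"
    unfolding outer_measure_space_def
    by (auto simp: positive_def increasing_def countably_subadditive_def outer_empty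
        intro: outer_mono outer_countably_subadditive)
  have meas: "measure_space UNIV ?L outer" by (rule P.caratheodory_lemma[OF oms])
  then interpret L: sigma_algebra UNIV ?L by (simp add: measure_space_def)
  have "open U \<Longrightarrow> U \<in> ?L" for U
    by (auto simp: P.lambda_system_eq outer_caratheodory)
  then have "sigma_sets UNIV {U. open U} \<subseteq> ?L" by (intro L.sigma_sets_subset) auto
  then have sub: "sets borel \<subseteq> ?L" by (simp add: borel_def)
  have sa: "sigma_algebra UNIV (sets (borel :: 'a measure))"
    using sets.sigma_algebra_axioms[of borel] by simp
  then have "measure_space UNIV (sets borel) outer" by (rule measure_down[OF meas _ sub])
  then show ?thesis
    unfolding borel_extension_def measure_space_def
    using sa assms by (intro emeasure_measure_of_sigma) auto
qed

lemma borel_extension_open: "open U \<Longrightarrow> emeasure borel_extension U = G U"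
  by (simp add: emeasure_borel_extension outer_open)

lemma radon_borel_extension:
  assumes fin: "G UNIV < \<infinity>" and borel: "\<And>K. compact K \<Longrightarrow> K \<in> sets (borel :: 'a measure)"
  shows "radon_measure borel_extension" "finite_measure borel_extension"
proof -
  show "finite_measure borel_extension"
    using fin borel_extension_open[of UNIV] sets_eq_imp_space_eq[OF sets_borel_extension]
    by (intro finite_measureI) auto
  show "radon_measure borel_extension"
    unfolding radon_measure_def
  proof (intro conjI allI impI ballI)
    show "emeasure borel_extension K < \<infinity>" for K
      using fin borel_extension_open[of UNIV] emeasure_space[of borel_extension K]
        sets_eq_imp_space_eq[OF sets_borel_extension] by (auto simp: less_top)
    show "emeasure borel_extension A = (INF U\<in>{U. open U \<and> A \<subseteq> U}. emeasure borel_extension U)"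
      if "A \<in> sets borel" for A
      using that by (simp add: emeasure_borel_extension outer_def[of A])
        (intro INF_cong, auto simp: outer_open)
    fix U :: "'a set" assume U: "open U"
    show "emeasure borel_extension U = (SUP K\<in>{K. compact K \<and> K \<subseteq> U}. emeasure borel_extension K)"
    proof (rule antisym)
      have "G K \<le> (SUP K\<in>{K. compact K \<and> K \<subseteq> U}. emeasure borel_extension K)"
        if K: "open K" "K \<Subset> U" for K
      proof -
        have cl: "compact (closure K)" "closure K \<subseteq> U" using K by (auto simp: compactly_contained_def)
        have "G K \<le> emeasure borel_extension (closure K)"
          unfolding borel_extension_open[OF K(1), symmetric]
          using borel[OF cl(1)] by (intro emeasure_mono closure_subset) (simp add: sets_borel_extension)
        also have "\<dots> \<le> (SUP K\<in>{K. compact K \<and> K \<subseteq> U}. emeasure borel_extension K)"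
          using cl by (intro SUP_upper) auto
        finally show ?thesis .
      qed
      then show "emeasure borel_extension U \<le> (SUP K\<in>{K. compact K \<and> K \<subseteq> U}. emeasure borel_extension K)"
        unfolding borel_extension_open[OF U] inner_regular[OF U] by (intro SUP_least) auto
      show "(SUP K\<in>{K. compact K \<and> K \<subseteq> U}. emeasure borel_extension K) \<le> emeasure borel_extension U"
        using U by (intro SUP_least emeasure_mono) (auto simp: sets_borel_extension)
    qed
  qed (rule sets_borel_extension)
qed

end

section \<open>Limits of extended nonnegative reals\<close>

lemma mono_enn2ereal: "mono enn2ereal"
  by (rule monoI) (simp add: less_eq_ennreal.rep_eq)

lemma Limsup_enn2ereal: "F \<noteq> bot \<Longrightarrow> Limsup F (\<lambda>x. enn2ereal (f x)) = enn2ereal (Limsup F f)"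
  by (rule Limsup_compose_continuous_mono[OF continuous_on_enn2ereal mono_enn2ereal])

lemma Liminf_enn2ereal: "F \<noteq> bot \<Longrightarrow> Liminf F (\<lambda>x. enn2ereal (f x)) = enn2ereal (Liminf F f)"
  by (rule Liminf_compose_continuous_mono[OF continuous_on_enn2ereal mono_enn2ereal])

lemma limsup_add_ennreal: "limsup (\<lambda>n. u n + v n) \<le> limsup u + limsup (v :: nat \<Rightarrow> ennreal)"
proof -
  have "enn2ereal (limsup (\<lambda>n. u n + v n)) = limsup (\<lambda>n. enn2ereal (u n) + enn2ereal (v n))"
    by (simp add: Limsup_enn2ereal[symmetric] plus_ennreal.rep_eq)
  also have "\<dots> \<le> limsup (\<lambda>n. enn2ereal (u n)) + limsup (\<lambda>n. enn2ereal (v n))"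
    by (rule ereal_limsup_add_mono)
  finally show ?thesis by (simp add: Limsup_enn2ereal less_eq_ennreal.rep_eq plus_ennreal.rep_eq)
qed

lemma liminf_add_ennreal: "liminf u + liminf v \<le> liminf (\<lambda>n. u n + v n :: ennreal)"
proof -
  have "enn2ereal (liminf u + liminf v) = liminf (\<lambda>n. enn2ereal (u n)) + liminf (\<lambda>n. enn2ereal (v n))"
    by (simp add: Liminf_enn2ereal plus_ennreal.rep_eq)
  also have "\<dots> \<le> liminf (\<lambda>n. enn2ereal (u n) + enn2ereal (v n))"
    by (rule Liminf_add_le) auto
  also have "\<dots> = enn2ereal (liminf (\<lambda>n. u n + v n))"
    by (simp add: Liminf_enn2ereal[symmetric] plus_ennreal.rep_eq)
  finally show ?thesis by (simp add: less_eq_ennreal.rep_eq)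
qed

lemma continuous_on_cmult_ennreal: "c < top \<Longrightarrow> continuous_on UNIV (\<lambda>x::ennreal. c * x)"
  unfolding continuous_on_def by (auto intro!: ennreal_tendsto_cmult tendsto_ident_at)

lemma Limsup_cmult_ennreal: "F \<noteq> bot \<Longrightarrow> c < top \<Longrightarrow> Limsup F (\<lambda>x. c * f x :: ennreal) = c * Limsup F f"
  by (intro Limsup_compose_continuous_mono continuous_on_cmult_ennreal monoI mult_left_mono) auto

lemma Liminf_cmult_ennreal: "F \<noteq> bot \<Longrightarrow> c < top \<Longrightarrow> Liminf F (\<lambda>x. c * f x :: ennreal) = c * Liminf F f"
  by (intro Liminf_compose_continuous_mono continuous_on_cmult_ennreal monoI mult_left_mono) auto

lemma limsup_le_combination:
  fixes a b c e :: "nat \<Rightarrow> ennreal"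
  assumes ev: "\<forall>\<^sub>F n in sequentially. e n \<le> A * (a n + b n) + c n" and A: "A < top" and c: "c \<longlonglongrightarrow> 0"
  shows "limsup e \<le> A * (limsup a + limsup b)"
proof -
  have "limsup e \<le> limsup (\<lambda>n. A * (a n + b n) + c n)" using ev by (rule Limsup_mono)
  also have "\<dots> \<le> limsup (\<lambda>n. A * (a n + b n)) + limsup c" by (rule limsup_add_ennreal)
  also have "\<dots> = A * limsup (\<lambda>n. a n + b n)"
    using c A by (simp add: Limsup_cmult_ennreal lim_imp_Limsup)
  also have "\<dots> \<le> A * (limsup a + limsup b)" by (intro mult_left_mono limsup_add_ennreal) simp
  finally show ?thesis .
qed

lemma ennreal_le_of_powr_factor:
  assumes "\<And>d. 0 < d \<Longrightarrow> d < 1 \<Longrightarrow> x \<le> ennreal ((1 - d) powr (1 - p)) * y"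
  shows "x \<le> y"
proof (cases "y = \<infinity>")
  case False
  define d where "d n = 1 / (real n + 2)" for n
  have d: "0 < d n" "d n < 1" for n by (auto simp: d_def)
  have "d \<longlonglongrightarrow> 0" unfolding d_def
    using LIMSEQ_ignore_initial_segment[OF lim_1_over_n[where 'a = real], of 2] by (simp add: add.commute)
  then have "(\<lambda>n. ennreal ((1 - d n) powr (1 - p)) * y) \<longlonglongrightarrow> ennreal ((1 - 0) powr (1 - p)) * y"
    using False by (intro tendsto_mult_ennreal tendsto_ennrealI tendsto_intros) auto
  then show ?thesis using assms d by (intro LIMSEQ_le_const) auto
qed simp

lemma Lp_diff:
  assumes "1 \<le> p" "f \<in> Lp p M" "g \<in> Lp p M"
  shows "(\<lambda>x. f x - g x) \<in> Lp p M"
proof -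
  have [measurable]: "f \<in> borel_measurable M" "g \<in> borel_measurable M" using assms by (auto simp: Lp_iff)
  have "(\<integral>\<^sup>+x. ennreal (\<bar>f x - g x\<bar> powr p) \<partial>M) \<le>
      ennreal (2 powr p) * ((\<integral>\<^sup>+x. ennreal (\<bar>f x\<bar> powr p) \<partial>M) + (\<integral>\<^sup>+x. ennreal (\<bar>g x\<bar> powr p) \<partial>M))"
    using nn_integral_abs_add_powr_le2[OF assms(1), of f M "\<lambda>x. - g x" "space M"]
    by (simp add: nn_integral_set_ennreal[symmetric] cong: nn_integral_cong)
  also have "\<dots> < \<infinity>" using assms by (simp add: Lp_iff ennreal_mult_less_top)
  finally show ?thesis by (simp add: Lp_iff)
qed

lemma Lp_uminus_iff: "(\<lambda>x. - f x) \<in> Lp p M \<longleftrightarrow> f \<in> Lp p M"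
  by (simp add: Lp_iff)

lemma Lp_add:
  assumes "1 \<le> p" "f \<in> Lp p M" "g \<in> Lp p M"
  shows "(\<lambda>x. f x + g x) \<in> Lp p M"
  using Lp_diff[OF assms(1,2), of "\<lambda>x. - g x"] assms(3) by (simp add: Lp_uminus_iff)

lemma Lp_converges_iff:
  assumes p: "1 \<le> p"
  shows "Lp_converges p M fn f \<longleftrightarrow> (\<forall>n. fn n \<in> Lp p M) \<and> f \<in> Lp p M \<and>
    (\<lambda>n. \<integral>\<^sup>+x. ennreal (\<bar>fn n x - f x\<bar> powr p) \<partial>M) \<longlonglongrightarrow> 0"
proof -
  have "(\<lambda>n. Lp_norm p M (\<lambda>x. fn n x - f x)) \<longlonglongrightarrow> 0 \<longleftrightarrow>
      (\<lambda>n. \<integral>\<^sup>+x. ennreal (\<bar>fn n x - f x\<bar> powr p) \<partial>M) \<longlonglongrightarrow> 0"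
    if "\<forall>n. fn n \<in> Lp p M" "f \<in> Lp p M"
  proof -
    define a where "a n = (\<integral>x. \<bar>fn n x - f x\<bar> powr p \<partial>M)" for n
    have a: "0 \<le> a n" for n unfolding a_def by simp
    have "(\<integral>\<^sup>+x. ennreal (\<bar>fn n x - f x\<bar> powr p) \<partial>M) = ennreal (a n)" for n
      using Lp_diff[OF p, of "fn n" M f] that unfolding a_def
      by (intro nn_integral_eq_integral) (auto simp: Lp_def)
    moreover have "(\<lambda>n. a n powr (1 / p)) \<longlonglongrightarrow> 0 \<longleftrightarrow> a \<longlonglongrightarrow> 0"
    proof
      assume "(\<lambda>n. a n powr (1 / p)) \<longlonglongrightarrow> 0"
      then have "(\<lambda>n. (a n powr (1 / p)) powr p) \<longlonglongrightarrow> 0"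
        using p by - (rule tendsto_zero_powrI[OF _ tendsto_const], auto)
      then show "a \<longlonglongrightarrow> 0" using a p by (simp add: powr_powr)
    next
      assume "a \<longlonglongrightarrow> 0"
      then show "(\<lambda>n. a n powr (1 / p)) \<longlonglongrightarrow> 0"
        using p a by - (rule tendsto_zero_powrI[OF _ tendsto_const], auto)
    qed
    ultimately show ?thesis
      using a by (simp add: Lp_norm_def a_def[symmetric] ennreal_tendsto_0_iff)
  qed
  then show ?thesis unfolding Lp_converges_def by blast
qed

lemma Lp_converges_const: "f \<in> Lp p M \<Longrightarrow> 1 \<le> p \<Longrightarrow> Lp_converges p M (\<lambda>_. f) f"
  by (simp add: Lp_converges_iff)

section \<open>Gluing along a cutoff function\<close>

context metric_doubling
begin

lemma cutoff_glue_in_Lp: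
  assumes p: "1 \<le> p" and \<phi>: "\<phi> \<in> borel_measurable M" "\<And>x. 0 \<le> \<phi> x" "\<And>x. \<phi> x \<le> 1"
    and uv: "u \<in> Lp p M" "v \<in> Lp p M"
  shows "(\<lambda>x. \<phi> x * u x + (1 - \<phi> x) * v x) \<in> Lp p M"
proof -
  have "(\<lambda>x. \<psi> x * w x) \<in> Lp p M"
    if [measurable]: "\<psi> \<in> borel_measurable M" and \<psi>: "\<And>x. 0 \<le> \<psi> x" "\<And>x. \<psi> x \<le> 1" and w: "w \<in> Lp p M" for \<psi> w
  proof -
    have [measurable]: "w \<in> borel_measurable M" using w by (simp add: Lp_iff)
    have "\<bar>\<psi> x * w x\<bar> \<le> \<bar>w x\<bar>" for x using \<psi>[of x] by (simp add: abs_mult mult_left_le_one_le)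
    then have "(\<integral>\<^sup>+x. ennreal (\<bar>\<psi> x * w x\<bar> powr p) \<partial>M) \<le> (\<integral>\<^sup>+x. ennreal (\<bar>w x\<bar> powr p) \<partial>M)"
      using p by (intro nn_integral_mono ennreal_leI powr_mono2) auto
    then show ?thesis using w by (auto simp: Lp_iff intro: order_le_less_trans)
  qed
  then show ?thesis using \<phi> uv p by (intro Lp_add) auto
qed

lemma cutoff_glue_converges:
  assumes p: "1 \<le> p" and \<phi> [measurable]: "\<phi> \<in> borel_measurable M" and \<phi>01: "\<And>x. 0 \<le> \<phi> x" "\<And>x. \<phi> x \<le> 1"
    and u: "Lp_converges p M u f" and v: "Lp_converges p M v f"
  shows "Lp_converges p M (\<lambda>n x. \<phi> x * u n x + (1 - \<phi> x) * v n x) f"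
    and "(\<lambda>n. \<integral>\<^sup>+x. ennreal (\<bar>u n x - v n x\<bar> powr p) \<partial>M) \<longlonglongrightarrow> 0"
proof -
  have Lp: "u n \<in> Lp p M" "v n \<in> Lp p M" "f \<in> Lp p M" for n
    using u v by (auto simp: Lp_converges_iff[OF p])
  have [measurable]: "u n \<in> borel_measurable M" "v n \<in> borel_measurable M" "f \<in> borel_measurable M" for n
    using Lp by (auto simp: Lp_iff)
  define bound where "bound n = ennreal (2 powr p) * ((\<integral>\<^sup>+x. ennreal (\<bar>u n x - f x\<bar> powr p) \<partial>M) +
      (\<integral>\<^sup>+x. ennreal (\<bar>v n x - f x\<bar> powr p) \<partial>M))" for n
  have "bound \<longlonglongrightarrow> ennreal (2 powr p) * (0 + 0)" unfolding bound_def
    using u v by (intro ennreal_tendsto_cmult tendsto_add) (auto simp: Lp_converges_iff[OF p])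
  then have bound: "bound \<longlonglongrightarrow> 0" by simp
  show "(\<lambda>n. \<integral>\<^sup>+x. ennreal (\<bar>u n x - v n x\<bar> powr p) \<partial>M) \<longlonglongrightarrow> 0"
  proof (rule tendsto_sandwich[OF _ _ tendsto_const bound])
    show "\<forall>\<^sub>F n in sequentially. (\<integral>\<^sup>+x. ennreal (\<bar>u n x - v n x\<bar> powr p) \<partial>M) \<le> bound n"
    proof (intro always_eventually allI)
      fix n
      show "(\<integral>\<^sup>+x. ennreal (\<bar>u n x - v n x\<bar> powr p) \<partial>M) \<le> bound n"
        unfolding bound_def
        using nn_integral_abs_add_powr_le2[OF p, of "\<lambda>x. u n x - f x" M "\<lambda>x. f x - v n x" UNIV]
        by (simp add: abs_minus_commute)
    qed
  qed auto
  have "(\<lambda>n. \<integral>\<^sup>+x. ennreal (\<bar>\<phi> x * u n x + (1 - \<phi> x) * v n x - f x\<bar> powr p) \<partial>M) \<longlonglongrightarrow> 0"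
  proof (rule tendsto_sandwich[OF _ _ tendsto_const bound])
    show "\<forall>\<^sub>F n in sequentially. (\<integral>\<^sup>+x. ennreal (\<bar>\<phi> x * u n x + (1 - \<phi> x) * v n x - f x\<bar> powr p) \<partial>M) \<le> bound n"
    proof (intro always_eventually allI)
      fix n
      have "\<bar>\<phi> x * u n x + (1 - \<phi> x) * v n x - f x\<bar> powr p \<le>
          2 powr p * (\<bar>u n x - f x\<bar> powr p + \<bar>v n x - f x\<bar> powr p)" for x
      proof -
        have "\<phi> x * u n x + (1 - \<phi> x) * v n x - f x = \<phi> x * (u n x - f x) + (1 - \<phi> x) * (v n x - f x)"
          by (simp add: algebra_simps)
        then have "\<bar>\<phi> x * u n x + (1 - \<phi> x) * v n x - f x\<bar> powr p \<le>
            \<phi> x * \<bar>u n x - f x\<bar> powr p + (1 - \<phi> x) * \<bar>v n x - f x\<bar> powr p"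
          using abs_powr_convex[OF p \<phi>01, of x] by simp
        also have "\<dots> \<le> 2 powr p * \<bar>u n x - f x\<bar> powr p + 2 powr p * \<bar>v n x - f x\<bar> powr p"
        proof -
          have "1 \<le> (2::real) powr p" using p by (simp add: ge_one_powr_ge_zero)
          then show ?thesis using \<phi>01[of x] by (intro add_mono mult_right_mono) auto
        qed
        finally show ?thesis by (simp add: distrib_left)
      qed
      then have "(\<integral>\<^sup>+x. ennreal (\<bar>\<phi> x * u n x + (1 - \<phi> x) * v n x - f x\<bar> powr p) \<partial>M) \<le>
          (\<integral>\<^sup>+x. ennreal (2 powr p) * (ennreal (\<bar>u n x - f x\<bar> powr p) + ennreal (\<bar>v n x - f x\<bar> powr p)) \<partial>M)"
        by (intro nn_integral_mono) (simp add: ennreal_leI flip: ennreal_mult' ennreal_plus)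
      also have "\<dots> = bound n" unfolding bound_def
        by (subst nn_integral_cmult) (auto simp: nn_integral_add)
      finally show "(\<integral>\<^sup>+x. ennreal (\<bar>\<phi> x * u n x + (1 - \<phi> x) * v n x - f x\<bar> powr p) \<partial>M) \<le> bound n" .
    qed
  qed auto
  then show "Lp_converges p M (\<lambda>n x. \<phi> x * u n x + (1 - \<phi> x) * v n x) f"
    using Lp cutoff_glue_in_Lp[OF p \<phi> \<phi>01] by (simp add: Lp_converges_iff[OF p])
qed

lemma nn_energy_glue_le:
  assumes p: "1 \<le> p" and d: "0 < d" "d < 1" and r: "0 < r" and L: "0 \<le> L"
    and \<phi>01: "\<And>x. 0 \<le> \<phi> x" "\<And>x. \<phi> x \<le> 1" and \<phi>_lip: "\<And>x y. \<bar>\<phi> x - \<phi> y\<bar> \<le> L * dist x y"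
    and [measurable]: "u \<in> borel_measurable M" "v \<in> borel_measurable M"
    and op: "open U" "open V"
    and U: "\<And>x y. x \<in> W \<Longrightarrow> dist x y < r \<Longrightarrow> \<phi> y \<noteq> 0 \<Longrightarrow> x \<in> U"
    and V: "\<And>x y. x \<in> W \<Longrightarrow> dist x y < r \<Longrightarrow> \<phi> y \<noteq> 1 \<Longrightarrow> x \<in> V"
  shows "nn_energy p M r (\<lambda>x. \<phi> x * u x + (1 - \<phi> x) * v x) W \<le>
    ennreal ((1 - d) powr (1 - p)) * (nn_energy p M r u U + nn_energy p M r v V) +
    ennreal (d powr (1 - p) * L powr p) * (\<integral>\<^sup>+x. ennreal (\<bar>u x - v x\<bar> powr p) \<partial>M)"
proof -
  have [measurable]: "U \<in> sets M" "V \<in> sets M" using op by auto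
  define A where "A = (1 - d) powr (1 - p)"
  define B where "B = d powr (1 - p)"
  have AB: "0 \<le> A" "0 \<le> B" by (auto simp: A_def B_def)
  define w where "w x = \<phi> x * u x + (1 - \<phi> x) * v x" for x
  have osc: "mean_osc p r w x * indicator W x \<le> ennreal A * (mean_osc p r u x * indicator U x + mean_osc p r v x * indicator V x)
      + ennreal (B * (L * r) powr p) * ennreal (\<bar>u x - v x\<bar> powr p)" for x
  proof (cases "x \<in> W")
    case True
    define c where "c = ennreal (B * (L * r) powr p) * ennreal (\<bar>u x - v x\<bar> powr p)"
    have "ennreal (\<bar>w y - w x\<bar> powr p) \<le> ennreal A * (ennreal (\<bar>u y - u x\<bar> powr p) * indicator U x +
        ennreal (\<bar>v y - v x\<bar> powr p) * indicator V x) + c" if y: "y \<in> ball x r" for y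
    proof -
      have "w y - w x = \<phi> y * (u y - u x) + (1 - \<phi> y) * (v y - v x) + (\<phi> y - \<phi> x) * (u x - v x)"
        by (simp add: w_def algebra_simps)
      then have "\<bar>w y - w x\<bar> powr p \<le> A * (\<phi> y * \<bar>u y - u x\<bar> powr p + (1 - \<phi> y) * \<bar>v y - v x\<bar> powr p)
          + B * \<bar>(\<phi> y - \<phi> x) * (u x - v x)\<bar> powr p"
        unfolding A_def B_def using abs_powr_interpolate_le[OF p d \<phi>01] by metis
      also have "\<dots> \<le> A * (\<bar>u y - u x\<bar> powr p * indicator U x + \<bar>v y - v x\<bar> powr p * indicator V x)
          + B * ((L * r) powr p * \<bar>u x - v x\<bar> powr p)"
      proof (intro add_mono mult_left_mono AB)
        show "\<phi> y * \<bar>u y - u x\<bar> powr p \<le> \<bar>u y - u x\<bar> powr p * indicator U x"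
          using U[OF True, of y] y \<phi>01[of y]
          by (cases "\<phi> y = 0") (auto simp: mult_left_le_one_le)
        show "(1 - \<phi> y) * \<bar>v y - v x\<bar> powr p \<le> \<bar>v y - v x\<bar> powr p * indicator V x"
          using V[OF True, of y] y \<phi>01[of y]
          by (cases "\<phi> y = 1") (auto simp: mult_left_le_one_le)
        have "\<bar>\<phi> y - \<phi> x\<bar> \<le> L * r"
          using \<phi>_lip[of y x] y L mult_left_mono[of "dist y x" r L] by (simp add: dist_commute)
        then have "\<bar>(\<phi> y - \<phi> x) * (u x - v x)\<bar> \<le> (L * r) * \<bar>u x - v x\<bar>"
          by (simp add: abs_mult mult_right_mono)
        then have "\<bar>(\<phi> y - \<phi> x) * (u x - v x)\<bar> powr p \<le> ((L * r) * \<bar>u x - v x\<bar>) powr p"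
          using p by (intro powr_mono2) auto
        then show "\<bar>(\<phi> y - \<phi> x) * (u x - v x)\<bar> powr p \<le> (L * r) powr p * \<bar>u x - v x\<bar> powr p"
          using L r by (simp add: powr_mult)
      qed
      finally have "ennreal (\<bar>w y - w x\<bar> powr p) \<le> ennreal (A * (\<bar>u y - u x\<bar> powr p * indicator U x +
          \<bar>v y - v x\<bar> powr p * indicator V x) + B * ((L * r) powr p * \<bar>u x - v x\<bar> powr p))"
        by (rule ennreal_leI)
      also have "\<dots> = ennreal A * (ennreal (\<bar>u y - u x\<bar> powr p) * indicator U x +
          ennreal (\<bar>v y - v x\<bar> powr p) * indicator V x) + c"
        using AB by (auto simp: c_def indicator_def ennreal_mult' mult.assoc split: if_splits)
      finally show ?thesis .
    qed
    then have "(\<integral>\<^sup>+y\<in>ball x r. ennreal (\<bar>w y - w x\<bar> powr p) \<partial>M) \<le>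
        (\<integral>\<^sup>+y. ennreal A * ((ennreal (\<bar>u y - u x\<bar> powr p) * indicator (ball x r) y) * indicator U x +
          (ennreal (\<bar>v y - v x\<bar> powr p) * indicator (ball x r) y) * indicator V x) + c * indicator (ball x r) y \<partial>M)"
      by (intro nn_integral_mono) (auto simp: indicator_def)
    also have "\<dots> = ennreal A * ((\<integral>\<^sup>+y\<in>ball x r. ennreal (\<bar>u y - u x\<bar> powr p) \<partial>M) * indicator U x +
        (\<integral>\<^sup>+y\<in>ball x r. ennreal (\<bar>v y - v x\<bar> powr p) \<partial>M) * indicator V x) + c * emeasure M (ball x r)"
      by (subst nn_integral_add, measurable, subst nn_integral_cmult, measurable, subst nn_integral_add, measurable)
        (simp add: nn_integral_multc nn_integral_cmult_indicator)
    finally have "mean_osc p r w x \<le> (1 / emeasure M (ball x r)) *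
        (ennreal A * ((\<integral>\<^sup>+y\<in>ball x r. ennreal (\<bar>u y - u x\<bar> powr p) \<partial>M) * indicator U x +
        (\<integral>\<^sup>+y\<in>ball x r. ennreal (\<bar>v y - v x\<bar> powr p) \<partial>M) * indicator V x) + c * emeasure M (ball x r))"
      unfolding mean_osc_def by (rule mult_left_mono) simp
    also have "\<dots> = ennreal A * (mean_osc p r u x * indicator U x + mean_osc p r v x * indicator V x) +
        c * (1 / emeasure M (ball x r) * emeasure M (ball x r))"
      by (simp add: mean_osc_def distrib_left ac_simps)
    finally show ?thesis using True r by (simp add: inverse_emeasure_ball_mult c_def)
  qed simp
  have "(\<integral>\<^sup>+x\<in>W. mean_osc p r w x \<partial>M) \<le> (\<integral>\<^sup>+x. ennreal A * (mean_osc p r u x * indicator U x +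
      mean_osc p r v x * indicator V x) + ennreal (B * (L * r) powr p) * ennreal (\<bar>u x - v x\<bar> powr p) \<partial>M)"
    by (intro nn_integral_mono osc)
  also have "\<dots> = ennreal A * ((\<integral>\<^sup>+x\<in>U. mean_osc p r u x \<partial>M) + (\<integral>\<^sup>+x\<in>V. mean_osc p r v x \<partial>M)) +
      ennreal (B * (L * r) powr p) * (\<integral>\<^sup>+x. ennreal (\<bar>u x - v x\<bar> powr p) \<partial>M)"
    by (subst nn_integral_add, measurable, subst nn_integral_cmult, measurable, subst nn_integral_add, measurable)
      (simp add: nn_integral_cmult)
  finally have "nn_energy p M r w W \<le> ennreal (1 / r powr p) * (ennreal A * ((\<integral>\<^sup>+x\<in>U. mean_osc p r u x \<partial>M) +
      (\<integral>\<^sup>+x\<in>V. mean_osc p r v x \<partial>M)) +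
      ennreal (B * (L * r) powr p) * (\<integral>\<^sup>+x. ennreal (\<bar>u x - v x\<bar> powr p) \<partial>M))"
    unfolding nn_energy_eq by (rule mult_left_mono) simp
  also have "\<dots> = ennreal A * (nn_energy p M r u U + nn_energy p M r v V) +
      (ennreal (1 / r powr p) * ennreal (B * (L * r) powr p)) * (\<integral>\<^sup>+x. ennreal (\<bar>u x - v x\<bar> powr p) \<partial>M)"
    unfolding nn_energy_eq by (simp add: distrib_left mult.left_commute mult.assoc)
  also have "ennreal (1 / r powr p) * ennreal (B * (L * r) powr p) = ennreal (B * L powr p)"
    using r L by (simp add: powr_mult flip: ennreal_mult')
  finally show ?thesis unfolding w_def A_def B_def .
qed

lemma compactly_contained_ball_neighbourhood:
  assumes "compact K" "(\<Union>x\<in>K. ball x e) \<subseteq> V" "d < e" "0 < d"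
  shows "(\<Union>x\<in>K. ball x d) \<Subset> (V :: 'a set)"
  unfolding compactly_contained_def
proof
  let ?N = "\<Union>x\<in>K. ball x d"
  obtain x0 b where b: "K \<subseteq> cball x0 b"
    using compact_imp_bounded[OF assms(1)] bounded_subset_cball by blast
  have "?N \<subseteq> cball x0 (b + d)"
  proof
    fix z assume "z \<in> ?N"
    then obtain x where "x \<in> K" "dist x z < d" by auto
    then show "z \<in> cball x0 (b + d)" using b dist_triangle[of x0 z x] by force
  qed
  then have "bounded ?N" using bounded_cball bounded_subset by blast
  then show "compact (closure ?N)" by (intro compact_if_closed_bounded) auto
  show "closure ?N \<subseteq> V"
  proof
    fix z assume "z \<in> closure ?N"
    then obtain y where "y \<in> ?N" "dist y z < e - d"
      using assms(3) unfolding closure_approachable by (metis diff_gt_0_iff_gt)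
    then obtain x where "x \<in> K" "dist x y < d" "dist y z < e - d" by auto
    then have "x \<in> K" "z \<in> ball x e" using dist_triangle[of x z y] by auto
    then show "z \<in> V" using assms(2) by blast
  qed
qed

lemma compact_subset_open_imp_neighbourhood:
  assumes "compact K" "open V" "K \<subseteq> (V :: 'a set)"
  shows "\<exists>N. open N \<and> K \<subseteq> N \<and> N \<Subset> V"
proof -
  obtain e where "0 < e" "(\<Union>x\<in>K. ball x e) \<subseteq> V"
    using compact_subset_open_imp_ball_epsilon_subset[OF assms] by blast
  then have "(\<Union>x\<in>K. ball x (e / 2)) \<Subset> V"
    using assms(1) by (intro compactly_contained_ball_neighbourhood) auto
  moreover have "K \<subseteq> (\<Union>x\<in>K. ball x (e / 2))" using \<open>0 < e\<close> by force
  ultimately show ?thesis by (intro exI[of _ "\<Union>x\<in>K. ball x (e / 2)"] conjI) auto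
qed

lemma cutoff_exists:
  fixes K U V :: "'a set"
  assumes K: "compact K" "K \<subseteq> U \<union> V" and op: "open U" "open V"
  shows "\<exists>(\<phi> :: 'a \<Rightarrow> real) L e U' V'. 0 \<le> L \<and> 0 < e \<and> (\<forall>x. 0 \<le> \<phi> x \<and> \<phi> x \<le> 1) \<and>
    (\<forall>x y. \<bar>\<phi> x - \<phi> y\<bar> \<le> L * dist x y) \<and> open U' \<and> open V' \<and> U' \<Subset> U \<and> V' \<Subset> V \<and>
    (\<forall>x\<in>K. \<forall>y. dist x y < e \<longrightarrow> (\<phi> y \<noteq> 0 \<longrightarrow> x \<in> U') \<and> (\<phi> y \<noteq> 1 \<longrightarrow> x \<in> V'))"
proof (cases "K - V = {}")
  case True
  then obtain V' where "open V'" "K \<subseteq> V'" "V' \<Subset> V"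
    using compact_subset_open_imp_neighbourhood[OF K(1) op(2)] by auto
  then show ?thesis
    by (intro exI[of _ "\<lambda>_. 0"] exI[of _ 0] exI[of _ 1] exI[of _ "{}"] exI[of _ V'])
      (auto simp: compactly_contained_def)
next
  case False
  define A where "A = K - V"
  have A: "compact A" "A \<subseteq> U" "A \<noteq> {}"
    using K op False by (auto simp: A_def compact_diff)
  obtain e where e: "0 < e" "(\<Union>x\<in>A. ball x e) \<subseteq> U"
    using compact_subset_open_imp_ball_epsilon_subset[OF A(1) op(1) A(2)] by blast
  define h where "h = e / 4"
  have h: "0 < h" using e by (simp add: h_def)
  define \<phi> where "\<phi> y = max 0 (min 1 (2 - infdist y A / h))" for y
  define U' where "U' = (\<Union>x\<in>A. ball x (3 * h))"
  have U': "open U'" "U' \<Subset> U" unfolding U'_def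
    using A e h by (auto intro!: compactly_contained_ball_neighbourhood[of A e] simp: h_def)
  define T where "T = K \<inter> {x. h / 2 \<le> infdist x A}"
  have T: "compact T" unfolding T_def
    by (intro compact_Int_closed K closed_Collect_le continuous_intros)
  have "x \<in> V" if "x \<in> T" for x
  proof (rule ccontr)
    assume "x \<notin> V"
    then have "x \<in> A" using that by (simp add: T_def A_def)
    then show False using that h by (simp add: T_def)
  qed
  then have "T \<subseteq> V" by blast
  then obtain V' where V': "open V'" "T \<subseteq> V'" "V' \<Subset> V"
    using compact_subset_open_imp_neighbourhood[OF T op(2)] by auto
  have lip: "\<bar>\<phi> x - \<phi> y\<bar> \<le> (1 / h) * dist x y" for x y
  proof -
    have "\<bar>\<phi> x - \<phi> y\<bar> \<le> \<bar>infdist x A / h - infdist y A / h\<bar>" unfolding \<phi>_def by linarith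
    also have "\<dots> = \<bar>infdist x A - infdist y A\<bar> / h"
      using h by (simp add: abs_divide flip: diff_divide_distrib)
    also have "\<dots> \<le> dist x y / h" using h infdist_triangle_abs by (intro divide_right_mono) auto
    finally show ?thesis by simp
  qed
  have in_U': "x \<in> U'" if "dist x y < h / 2" "\<phi> y \<noteq> 0" for x y
  proof -
    have "infdist y A < 2 * h"
    proof (rule ccontr)
      assume "\<not> ?thesis"
      then have "2 \<le> infdist y A / h" using h by (simp add: field_simps)
      then show False using that by (simp add: \<phi>_def)
    qed
    then have "infdist x A < 3 * h" using infdist_triangle[of x A y] that h by linarith
    then obtain a where "a \<in> A" "dist x a < 3 * h"
      using A(3) by (auto simp: infdist_notempty cINF_less_iff)
    then show ?thesis by (auto simp: U'_def dist_commute)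
  qed
  have in_V': "x \<in> V'" if "x \<in> K" "dist x y < h / 2" "\<phi> y \<noteq> 1" for x y
  proof -
    have "h < infdist y A"
    proof (rule ccontr)
      assume "\<not> ?thesis"
      then have "infdist y A / h \<le> 1" using h by (simp add: field_simps)
      then show False using that by (simp add: \<phi>_def)
    qed
    then have "h / 2 \<le> infdist x A" using infdist_triangle[of y A x] that h by (simp add: dist_commute)
    then show ?thesis using V' that by (auto simp: T_def)
  qed
  have "\<forall>x. 0 \<le> \<phi> x \<and> \<phi> x \<le> 1" by (simp add: \<phi>_def)
  moreover have "0 \<le> 1 / h" "0 < h / 2" using h by auto
  ultimately show ?thesis using lip in_U' in_V' U' V'
    by (intro exI[of _ \<phi>] exI[of _ "1 / h"] exI[of _ "h / 2"] exI[of _ U'] exI[of _ V']) blast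
qed

end

section \<open>The localized limit functional\<close>

lemma e2ennreal_le_iff: "e2ennreal x \<le> y \<longleftrightarrow> x \<le> enn2ereal y"
proof
  assume "e2ennreal x \<le> y"
  then have "enn2ereal (e2ennreal x) \<le> enn2ereal y" by (simp add: less_eq_ennreal.rep_eq)
  moreover have "x \<le> enn2ereal (e2ennreal x)"
    by (cases "0 \<le> x") (auto simp: enn2ereal_e2ennreal e2ennreal_neg zero_ennreal.rep_eq)
  ultimately show "x \<le> enn2ereal y" by (rule order_trans[rotated])
next
  assume "x \<le> enn2ereal y"
  then show "e2ennreal x \<le> y" using e2ennreal_mono by fastforce
qed

context metric_doubling
begin

lemma bounded_imp_compactly_contained: "bounded U \<Longrightarrow> closure U \<subseteq> V \<Longrightarrow> (U :: 'a set) \<Subset> V"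
  by (simp add: compactly_contained_def compact_if_closed_bounded bounded_closure)

lemma nn_energy_exhaustion_le:
  assumes [measurable]: "f \<in> borel_measurable M" and U: "open U"
    and le: "\<And>S::nat. nn_energy p M r f (U \<inter> ball x0 (real S)) \<le> c"
  shows "nn_energy p M r f U \<le> c"
proof -
  let ?A = "\<lambda>S::nat. U \<inter> ball x0 (real S)"
  let ?D = "density M (mean_osc p r f)"
  have [measurable]: "U \<in> sets M" using U by simp
  have E: "nn_energy p M r f B = ennreal (1 / r powr p) * emeasure ?D B" if "B \<in> sets M" for B
    using that by (simp add: nn_energy_eq emeasure_density)
  have "(\<Union>S. ?A S) = U" using reals_Archimedean2 by (auto intro: reals_Archimedean2)
  moreover have "incseq ?A" by (intro incseq_SucI) auto
  moreover have "range ?A \<subseteq> sets ?D" by auto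
  ultimately have "emeasure ?D U = (SUP S. emeasure ?D (?A S))"
    using SUP_emeasure_incseq[of ?A ?D] by simp
  then have "nn_energy p M r f U = (SUP S. nn_energy p M r f (?A S))"
    by (simp add: E SUP_mult_left_ennreal)
  also have "\<dots> \<le> c" by (intro SUP_least le)
  finally show ?thesis .
qed

end

locale korevaar_schoen_limit = cheeger +
  fixes rs :: "nat \<Rightarrow> real" and Gp :: "('a \<Rightarrow> real) \<Rightarrow> 'a set \<Rightarrow> ereal"
  assumes rs_pos: "\<And>n. 0 < rs n" and rs_lim: "rs \<longlonglongrightarrow> 0"
    and gamma_bar: "Gamma_bar_converges p M (\<lambda>n f U. KS_energy p M (rs n) f U) Gp"
begin

lemma p1: "1 \<le> p"
  using p by simp

lemma rs_at_right: "filterlim rs (at_right 0) sequentially"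
  using rs_lim rs_pos by (auto simp: filterlim_at intro!: always_eventually dest: less_imp_neq[symmetric])

lemma eventually_rs_less: "0 < e \<Longrightarrow> \<forall>\<^sub>F n in sequentially. rs n < e"
  using order_tendstoD(2)[OF rs_lim] by simp

definition G :: "('a \<Rightarrow> real) \<Rightarrow> 'a set \<Rightarrow> ennreal" where
  "G f U = e2ennreal (Gp f U)"

lemma liminf_ineq:
  assumes "Lp_converges p M fn f" "open U"
  shows "G f U \<le> liminf (\<lambda>n. nn_energy p M (rs n) (fn n) U)"
proof -
  have "f \<in> Lp p M" using assms by (simp add: Lp_converges_def)
  then have "Gp f U \<le> liminf (\<lambda>n. KS_energy p M (rs n) (fn n) U)"
    by (rule gamma_bar[unfolded Gamma_bar_converges_def, THEN conjunct1, rule_format, OF _ assms])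
  then show ?thesis by (simp add: G_def e2ennreal_le_iff KS_energy_eq Liminf_enn2ereal)
qed

context
  fixes f :: "'a \<Rightarrow> real"
  assumes f: "f \<in> Lp p M"
begin

lemma recovery_ereal:
  assumes "open U" "open V" "U \<Subset> V"
  obtains fn where "Lp_converges p M fn f" "limsup (\<lambda>n. KS_energy p M (rs n) (fn n) U) \<le> Gp f V"
  using gamma_bar[unfolded Gamma_bar_converges_def, THEN conjunct2, THEN conjunct1, rule_format, OF f, of U V]
    assms by blast

lemma Gp_eq: "Gp f V = enn2ereal (G f V)" if V: "open V"
proof -
  obtain fn where "limsup (\<lambda>n. KS_energy p M (rs n) (fn n) {}) \<le> Gp f V"
    by (rule recovery_ereal[OF open_empty V]) (simp add: compactly_contained_def)
  then have "0 \<le> Gp f V" by (simp add: KS_energy_eq nn_energy_def Limsup_const zero_ennreal.rep_eq)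
  then show ?thesis by (simp add: G_def enn2ereal_e2ennreal)
qed

lemma recovery:
  assumes "open U" "open V" "U \<Subset> V"
  obtains fn where "Lp_converges p M fn f" "limsup (\<lambda>n. nn_energy p M (rs n) (fn n) U) \<le> G f V"
proof -
  obtain fn where fn: "Lp_converges p M fn f" "limsup (\<lambda>n. KS_energy p M (rs n) (fn n) U) \<le> Gp f V"
    using recovery_ereal[OF assms] .
  have "limsup (\<lambda>n. nn_energy p M (rs n) (fn n) U) \<le> G f V"
    using fn(2) by (simp add: Gp_eq[OF assms(2)] KS_energy_eq Limsup_enn2ereal less_eq_ennreal.rep_eq)
  then show ?thesis using that fn(1) by blast
qed

lemma G_le_liminf: "open U \<Longrightarrow> G f U \<le> liminf (\<lambda>n. nn_energy p M (rs n) f U)"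
  using liminf_ineq[OF Lp_converges_const[OF f p1]] .

lemma G_inner_regular: "open V \<Longrightarrow> G f V = (SUP U\<in>{U. open U \<and> U \<Subset> V}. G f U)"
proof -
  assume V: "open V"
  let ?S = "{U. open U \<and> U \<Subset> V}"
  have "enn2ereal (G f V) = (SUP U\<in>?S. Gp f U)"
    using gamma_bar[unfolded Gamma_bar_converges_def, THEN conjunct2, THEN conjunct2, rule_format, OF f V]
      Gp_eq[OF V] by simp
  also have "\<dots> = (SUP U\<in>?S. enn2ereal (G f U))" by (intro SUP_cong) (auto simp: Gp_eq)
  finally have eq: "enn2ereal (G f V) = (SUP U\<in>?S. enn2ereal (G f U))" .
  have "enn2ereal (SUP U\<in>?S. G f U) = sup 0 (SUP U\<in>?S. enn2ereal (G f U))"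
    by (simp add: Sup_ennreal.rep_eq image_image)
  also have "\<dots> = enn2ereal (G f V)" unfolding eq[symmetric] by (simp add: sup_absorb2)
  finally show ?thesis by (simp add: enn2ereal_inject)
qed

lemma G_empty: "G f {} = 0"
  using G_le_liminf[of "{}"] by (simp add: nn_energy_def Liminf_const)

lemma G_superadditive:
  assumes op: "open U" "open V" and disj: "U \<inter> V = {}"
  shows "G f U + G f V \<le> G f (U \<union> V)"
proof -
  have main: "G f U' + G f V' \<le> G f (U \<union> V)" if U': "open U'" "U' \<Subset> U" and V': "open V'" "V' \<Subset> V" for U' V'
  proof -
    have "U' \<union> V' \<Subset> U \<union> V" using U' V' by (auto simp: compactly_contained_def)
    then obtain fn where fn: "Lp_converges p M fn f"
      "limsup (\<lambda>n. nn_energy p M (rs n) (fn n) (U' \<union> V')) \<le> G f (U \<union> V)"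
      using recovery[of "U' \<union> V'" "U \<union> V"] U' V' op by auto
    have "U' \<subseteq> U" "V' \<subseteq> V" using U' V' closure_subset by (auto simp: compactly_contained_def)
    then have disj': "U' \<inter> V' = {}" using disj by blast
    have meas: "U' \<in> sets M" "V' \<in> sets M" using U' V' by auto
    have [measurable]: "fn n \<in> borel_measurable M" for n
      using fn(1) by (auto simp: Lp_converges_def Lp_iff)
    have "nn_energy p M r (fn n) U' + nn_energy p M r (fn n) V' = nn_energy p M r (fn n) (U' \<union> V')" for n r
    proof -
      have "emeasure (density M (mean_osc p r (fn n))) (U' \<union> V') =
          emeasure (density M (mean_osc p r (fn n))) U' + emeasure (density M (mean_osc p r (fn n))) V'"
        using meas disj' by (intro plus_emeasure[symmetric]) auto
      then show ?thesis using meas by (simp add: nn_energy_eq emeasure_density distrib_left)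
    qed
    then have "liminf (\<lambda>n. nn_energy p M (rs n) (fn n) U') + liminf (\<lambda>n. nn_energy p M (rs n) (fn n) V')
        \<le> liminf (\<lambda>n. nn_energy p M (rs n) (fn n) (U' \<union> V'))"
      using liminf_add_ennreal[of "\<lambda>n. nn_energy p M (rs n) (fn n) U'" "\<lambda>n. nn_energy p M (rs n) (fn n) V'"] by simp
    also have "\<dots> \<le> limsup (\<lambda>n. nn_energy p M (rs n) (fn n) (U' \<union> V'))"
      by (rule Liminf_le_Limsup) simp
    finally show ?thesis
      using add_mono[OF liminf_ineq[OF fn(1) U'(1)] liminf_ineq[OF fn(1) V'(1)]] fn(2) by order
  qed
  have ne: "{U'. open U' \<and> U' \<Subset> W} \<noteq> {}" for W :: "'a set"
    by (auto simp: compactly_contained_def intro!: exI[of _ "{}"])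
  have "G f V' + G f U \<le> G f (U \<union> V)" if "open V'" "V' \<Subset> V" for V'
    unfolding G_inner_regular[OF op(1)] add.commute[of "G f V'"] using main that ne
    by (subst ennreal_SUP_add_left[symmetric]) (auto intro!: SUP_least)
  then have "G f V + G f U \<le> G f (U \<union> V)"
    unfolding G_inner_regular[OF op(2)] using ne
    by (subst ennreal_SUP_add_left[symmetric]) (auto intro!: SUP_least)
  then show ?thesis by (simp add: add.commute)
qed

lemma limsup_glue_le:
  assumes uv: "Lp_converges p M u f" "Lp_converges p M v f"
    and d: "0 < d" "d < 1" and L: "0 \<le> L" and e: "0 < e"
    and \<phi>01: "\<And>x. 0 \<le> \<phi> x" "\<And>x. \<phi> x \<le> 1" and \<phi>_lip: "\<And>x y. \<bar>\<phi> x - \<phi> y\<bar> \<le> L * dist x y"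
    and op: "open U" "open V"
    and U: "\<And>x y. x \<in> W \<Longrightarrow> dist x y < e \<Longrightarrow> \<phi> y \<noteq> 0 \<Longrightarrow> x \<in> U"
    and V: "\<And>x y. x \<in> W \<Longrightarrow> dist x y < e \<Longrightarrow> \<phi> y \<noteq> 1 \<Longrightarrow> x \<in> V"
  obtains w where "Lp_converges p M w f" "limsup (\<lambda>n. nn_energy p M (rs n) (w n) W) \<le>
    ennreal ((1 - d) powr (1 - p)) * (limsup (\<lambda>n. nn_energy p M (rs n) (u n) U) +
      limsup (\<lambda>n. nn_energy p M (rs n) (v n) V))"
proof -
  have "L-lipschitz_on UNIV \<phi>" using \<phi>_lip L by (intro lipschitz_onI) (auto simp: dist_real_def)
  then have "\<phi> \<in> borel_measurable borel"
    using lipschitz_on_continuous_on borel_measurable_continuous_onI by blast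
  then have \<phi>: "\<phi> \<in> borel_measurable M" using measurable_cong_sets[OF sets_M refl] by blast
  have meas: "u n \<in> borel_measurable M" "v n \<in> borel_measurable M" for n
    using uv by (auto simp: Lp_converges_def Lp_iff)
  let ?w = "\<lambda>n x. \<phi> x * u n x + (1 - \<phi> x) * v n x"
  note glue = cutoff_glue_converges[OF p1 \<phi> \<phi>01 uv]
  have "limsup (\<lambda>n. nn_energy p M (rs n) (?w n) W) \<le>
      ennreal ((1 - d) powr (1 - p)) * (limsup (\<lambda>n. nn_energy p M (rs n) (u n) U) +
        limsup (\<lambda>n. nn_energy p M (rs n) (v n) V))"
  proof (rule limsup_le_combination)
    show "\<forall>\<^sub>F n in sequentially. nn_energy p M (rs n) (?w n) W \<le>
        ennreal ((1 - d) powr (1 - p)) * (nn_energy p M (rs n) (u n) U + nn_energy p M (rs n) (v n) V) +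
        ennreal (d powr (1 - p) * L powr p) * (\<integral>\<^sup>+x. ennreal (\<bar>u n x - v n x\<bar> powr p) \<partial>M)"
      using eventually_rs_less[OF e]
    proof eventually_elim
      case (elim n)
      show ?case
      proof (rule nn_energy_glue_le[OF p1 d rs_pos L \<phi>01 \<phi>_lip meas op])
        show "x \<in> U" if "x \<in> W" "dist x y < rs n" "\<phi> y \<noteq> 0" for x y
          using that elim by (intro U[of x y]) auto
        show "x \<in> V" if "x \<in> W" "dist x y < rs n" "\<phi> y \<noteq> 1" for x y
          using that elim by (intro V[of x y]) auto
      qed
    qed
    have "(\<lambda>n. ennreal (d powr (1 - p) * L powr p) * (\<integral>\<^sup>+x. ennreal (\<bar>u n x - v n x\<bar> powr p) \<partial>M))
        \<longlonglongrightarrow> ennreal (d powr (1 - p) * L powr p) * 0"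
      using glue(2) by (intro ennreal_tendsto_cmult) auto
    then show "(\<lambda>n. ennreal (d powr (1 - p) * L powr p) * (\<integral>\<^sup>+x. ennreal (\<bar>u n x - v n x\<bar> powr p) \<partial>M))
        \<longlonglongrightarrow> 0" by simp
  qed simp
  then show ?thesis using that glue(1) by blast
qed

lemma G_subadditive:
  assumes op: "open U" "open V"
  shows "G f (U \<union> V) \<le> G f U + G f V"
proof -
  have "G f W \<le> G f U + G f V" if W: "open W" "W \<Subset> U \<union> V" for W
  proof (rule ennreal_le_of_powr_factor)
    fix d :: real assume d: "0 < d" "d < 1"
    have K: "compact (closure W)" "closure W \<subseteq> U \<union> V" using W by (auto simp: compactly_contained_def)
    obtain \<phi> :: "'a \<Rightarrow> real" and L e U' V' where L: "0 \<le> L" "0 < e" and \<phi>: "\<forall>x. 0 \<le> \<phi> x \<and> \<phi> x \<le> 1"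
      "\<forall>x y. \<bar>\<phi> x - \<phi> y\<bar> \<le> L * dist x y" and op': "open U'" "open V'" and sub: "U' \<Subset> U" "V' \<Subset> V"
      and supp: "\<forall>x\<in>closure W. \<forall>y. dist x y < e \<longrightarrow> (\<phi> y \<noteq> 0 \<longrightarrow> x \<in> U') \<and> (\<phi> y \<noteq> 1 \<longrightarrow> x \<in> V')"
      using cutoff_exists[OF K op] by (elim exE conjE)
    obtain u where u: "Lp_converges p M u f" "limsup (\<lambda>n. nn_energy p M (rs n) (u n) U') \<le> G f U"
      using recovery[OF op'(1) op(1) sub(1)] .
    obtain v where v: "Lp_converges p M v f" "limsup (\<lambda>n. nn_energy p M (rs n) (v n) V') \<le> G f V"
      using recovery[OF op'(2) op(2) sub(2)] .
    have cl: "x \<in> closure W" if "x \<in> W" for x using that closure_subset by blast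
    have U': "x \<in> U'" if "x \<in> W" "dist x y < e" "\<phi> y \<noteq> 0" for x y using that supp cl by blast
    have V': "x \<in> V'" if "x \<in> W" "dist x y < e" "\<phi> y \<noteq> 1" for x y using that supp cl by blast
    obtain w where w: "Lp_converges p M w f" "limsup (\<lambda>n. nn_energy p M (rs n) (w n) W) \<le>
        ennreal ((1 - d) powr (1 - p)) * (limsup (\<lambda>n. nn_energy p M (rs n) (u n) U') +
          limsup (\<lambda>n. nn_energy p M (rs n) (v n) V'))"
      using limsup_glue_le[OF u(1) v(1) d L, of \<phi> U' V' W] \<phi> op' U' V' by blast
    have "G f W \<le> liminf (\<lambda>n. nn_energy p M (rs n) (w n) W)" by (rule liminf_ineq[OF w(1) W(1)])
    also have "\<dots> \<le> limsup (\<lambda>n. nn_energy p M (rs n) (w n) W)" by (rule Liminf_le_Limsup) simp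
    also note w(2)
    also have "ennreal ((1 - d) powr (1 - p)) * (limsup (\<lambda>n. nn_energy p M (rs n) (u n) U') +
          limsup (\<lambda>n. nn_energy p M (rs n) (v n) V')) \<le> ennreal ((1 - d) powr (1 - p)) * (G f U + G f V)"
      using u v by (intro mult_left_mono add_mono) auto
    finally show "G f W \<le> ennreal ((1 - d) powr (1 - p)) * (G f U + G f V)" .
  qed
  then show ?thesis using op by (subst G_inner_regular) (auto intro!: SUP_least)
qed

lemma de_giorgi_letta_G: "de_giorgi_letta (G f)"
  by unfold_locales (fact G_empty G_inner_regular G_superadditive G_subadditive)+

lemma nn_energy_le_G_of_comparison:
  assumes C: "\<forall>f h s R U V. f \<in> borel_measurable M \<longrightarrow> h \<in> Lp p M \<longrightarrow>
      0 < s \<longrightarrow> s \<le> R \<longrightarrow> open U \<longrightarrow> open V \<longrightarrow> (\<forall>x\<in>U. ball x ((1 + 2 * l) * R) \<subseteq> V) \<longrightarrow>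
      nn_energy p M R f U \<le> ennreal C * (nn_energy p M s h V +
        ennreal (1 / R powr p) * (\<integral>\<^sup>+x. ennreal (\<bar>f x - h x\<bar> powr p) \<partial>M))"
    and R: "0 < R" and op: "open U" "open V" "open V'"
    and sub: "\<And>x. x \<in> U \<Longrightarrow> ball x ((1 + 2 * l) * R) \<subseteq> V" "V \<Subset> V'"
  shows "nn_energy p M R f U \<le> ennreal C * G f V'"
proof -
  obtain fn where fn: "Lp_converges p M fn f" "limsup (\<lambda>n. nn_energy p M (rs n) (fn n) V) \<le> G f V'"
    using recovery[OF op(2,3) sub(2)] .
  have fm: "f \<in> borel_measurable M" and fnL: "fn n \<in> Lp p M" for n
    using f fn(1) by (auto simp: Lp_iff Lp_converges_def)
  have "limsup (\<lambda>n. nn_energy p M R f U) \<le> ennreal C * (limsup (\<lambda>n. nn_energy p M (rs n) (fn n) V) +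
      limsup (\<lambda>n. ennreal (1 / R powr p) * (\<integral>\<^sup>+x. ennreal (\<bar>f x - fn n x\<bar> powr p) \<partial>M)))"
  proof (rule limsup_le_combination[where c="\<lambda>_. 0"])
    show "\<forall>\<^sub>F n in sequentially. nn_energy p M R f U \<le> ennreal C * (nn_energy p M (rs n) (fn n) V +
        ennreal (1 / R powr p) * (\<integral>\<^sup>+x. ennreal (\<bar>f x - fn n x\<bar> powr p) \<partial>M)) + 0"
      using eventually_rs_less[OF R]
    proof eventually_elim
      case (elim n)
      then show ?case
        using C[rule_format, of f "fn n" "rs n" R U V] fm fnL rs_pos op sub(1) by simp
    qed
  qed auto
  also have "limsup (\<lambda>n. ennreal (1 / R powr p) * (\<integral>\<^sup>+x. ennreal (\<bar>f x - fn n x\<bar> powr p) \<partial>M)) = 0"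
  proof -
    have "(\<lambda>n. \<integral>\<^sup>+x. ennreal (\<bar>f x - fn n x\<bar> powr p) \<partial>M) \<longlonglongrightarrow> 0"
      using fn(1) by (simp add: Lp_converges_iff[OF p1] abs_minus_commute)
    then have "(\<lambda>n. ennreal (1 / R powr p) * (\<integral>\<^sup>+x. ennreal (\<bar>f x - fn n x\<bar> powr p) \<partial>M))
        \<longlonglongrightarrow> ennreal (1 / R powr p) * 0"
      by (intro ennreal_tendsto_cmult) auto
    then show ?thesis by (simp add: lim_imp_Limsup)
  qed
  also have "ennreal C * (limsup (\<lambda>n. nn_energy p M (rs n) (fn n) V) + 0) \<le> ennreal C * G f V'"
    using fn(2) by (intro mult_left_mono) auto
  finally show ?thesis by (simp add: Limsup_const)
qed

end

lemma nn_energy_le_G: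
  "\<exists>C>0. \<forall>f\<in>Lp p M. \<forall>R U V V'. 0 < R \<longrightarrow> open U \<longrightarrow> open V \<longrightarrow> open V' \<longrightarrow>
    (\<forall>x\<in>U. ball x ((1 + 2 * l) * R) \<subseteq> V) \<longrightarrow> V \<Subset> V' \<longrightarrow>
    nn_energy p M R f U \<le> ennreal C * G f V'"
proof -
  obtain C where C: "0 < C" and comp: "\<forall>f h s R U V. f \<in> borel_measurable M \<longrightarrow> h \<in> Lp p M \<longrightarrow>
    0 < s \<longrightarrow> s \<le> R \<longrightarrow> open U \<longrightarrow> open V \<longrightarrow> (\<forall>x\<in>U. ball x ((1 + 2 * l) * R) \<subseteq> V) \<longrightarrow>
    nn_energy p M R f U \<le> ennreal C * (nn_energy p M s h V +
      ennreal (1 / R powr p) * (\<integral>\<^sup>+x. ennreal (\<bar>f x - h x\<bar> powr p) \<partial>M))"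
    using nn_energy_comparison by (elim exE conjE)
  show ?thesis
  proof (intro exI[of _ C] conjI C ballI allI impI)
    fix f R and U V V' :: "'a set"
    assume f: "f \<in> Lp p M" and R: "0 < R" and op: "open U" "open V" "open V'"
      and sub: "\<forall>x\<in>U. ball x ((1 + 2 * l) * R) \<subseteq> V" "V \<Subset> V'"
    show "nn_energy p M R f U \<le> ennreal C * G f V'"
      by (rule nn_energy_le_G_of_comparison[OF f comp R op sub(1)[rule_format] sub(2)])
  qed
qed

lemma nn_energy_tail_le_G:
  "\<exists>C>0. \<forall>f\<in>Lp p M. \<forall>R x0 \<rho>. 0 < R \<longrightarrow> (1 + 2 * l) * R \<le> 1 \<longrightarrow>
    nn_energy p M R f (- cball x0 \<rho>) \<le> ennreal C * G f (- cball x0 (\<rho> - 2))"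
proof -
  obtain C where C: "0 < C" and le: "\<forall>f\<in>Lp p M. \<forall>R U V V'. 0 < R \<longrightarrow> open U \<longrightarrow> open V \<longrightarrow> open V' \<longrightarrow>
    (\<forall>x\<in>U. ball x ((1 + 2 * l) * R) \<subseteq> V) \<longrightarrow> V \<Subset> V' \<longrightarrow>
    nn_energy p M R f U \<le> ennreal C * G f V'"
    using nn_energy_le_G by (elim exE conjE)
  have "nn_energy p M R f (- cball x0 \<rho>) \<le> ennreal C * G f (- cball x0 (\<rho> - 2))"
    if f: "f \<in> Lp p M" and R: "0 < R" "(1 + 2 * l) * R \<le> 1" for f R x0 \<rho>
  proof (rule nn_energy_exhaustion_le)
    show "f \<in> borel_measurable M" using f by (simp add: Lp_iff)
    fix S :: nat
    let ?V = "ball x0 (real S + 1) - cball x0 (\<rho> - 1)"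
    show "nn_energy p M R f (- cball x0 \<rho> \<inter> ball x0 (real S)) \<le> ennreal C * G f (- cball x0 (\<rho> - 2))"
    proof (rule le[rule_format, OF f R(1)])
      show "ball x ((1 + 2 * l) * R) \<subseteq> ?V" if x: "x \<in> - cball x0 \<rho> \<inter> ball x0 (real S)" for x
      proof
        fix y assume "y \<in> ball x ((1 + 2 * l) * R)"
        then have "dist x y < 1" using R by simp
        then show "y \<in> ?V"
          using x dist_triangle[of x0 y x] dist_triangle[of x0 x y] by (simp add: dist_commute)
      qed
      show "?V \<Subset> - cball x0 (\<rho> - 2)"
      proof (rule bounded_imp_compactly_contained)
        show "bounded ?V" by (rule bounded_subset[OF bounded_ball]) auto
        have "closure ?V \<subseteq> {y. \<rho> - 1 \<le> dist x0 y}"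
          by (intro closure_minimal closed_Collect_le continuous_intros) auto
        then show "closure ?V \<subseteq> - cball x0 (\<rho> - 2)" by fastforce
      qed
    qed auto
  qed auto
  then show ?thesis using C by blast
qed

end

lemma (in metric_doubling) compactly_contained_scale:
  assumes "U \<Subset> V" "open (V :: 'a set)" "0 < c"
  shows "\<exists>e>0. \<exists>N. open N \<and> N \<Subset> V \<and> (\<forall>r\<le>e. \<forall>x\<in>U. ball x (c * r) \<subseteq> N)"
proof -
  have K: "compact (closure U)" "closure U \<subseteq> V" using assms(1) by (auto simp: compactly_contained_def)
  obtain e where e: "0 < e" "(\<Union>x\<in>closure U. ball x e) \<subseteq> V"
    using compact_subset_open_imp_ball_epsilon_subset[OF K(1) assms(2) K(2)] by blast
  let ?N = "\<Union>x\<in>closure U. ball x (e / 2)"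
  have "?N \<Subset> V" using K e by (intro compactly_contained_ball_neighbourhood) auto
  moreover have "ball x (c * r) \<subseteq> ?N" if "r \<le> e / 2 / c" "x \<in> U" for r x
  proof -
    have "c * r \<le> e / 2" using that assms(3) by (simp add: field_simps)
    then have "ball x (c * r) \<subseteq> ball x (e / 2)" by (rule subset_ball)
    moreover have "x \<in> closure U" using that closure_subset by blast
    ultimately show ?thesis by blast
  qed
  moreover have "open ?N" by auto
  moreover have "0 < e / 2 / c" using e assms by simp
  ultimately show ?thesis by (intro exI[of _ "e / 2 / c"] conjI exI[of _ ?N]) auto
qed

context korevaar_schoen_limit
begin

lemma KS_space_G_finite:
  assumes "f \<in> KS_space p M"
  shows "G f UNIV < \<infinity>"
proof -
  have f: "f \<in> Lp p M" and "Limsup (at_right 0) (\<lambda>r. KS_energy p M r f UNIV) < \<infinity>"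
    using assms by (auto simp: KS_space_def)
  then obtain y where y: "Limsup (at_right 0) (\<lambda>r. KS_energy p M r f UNIV) < y" "y < \<infinity>"
    using dense by blast
  have "\<forall>\<^sub>F r in at_right 0. KS_energy p M r f UNIV < y" using y(1) by (rule Limsup_lessD)
  then have "\<forall>\<^sub>F n in sequentially. KS_energy p M (rs n) f UNIV < y"
    using rs_at_right by (rule eventually_compose_filterlim)
  then have "limsup (\<lambda>n. KS_energy p M (rs n) f UNIV) \<le> y"
    by (intro Limsup_bounded) (auto elim: eventually_mono)
  then have "enn2ereal (limsup (\<lambda>n. nn_energy p M (rs n) f UNIV)) \<le> y"
    by (simp add: KS_energy_eq Limsup_enn2ereal)
  then have "enn2ereal (limsup (\<lambda>n. nn_energy p M (rs n) f UNIV)) < \<infinity>"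
    using y(2) by (rule order_le_less_trans)
  moreover have "G f UNIV \<le> limsup (\<lambda>n. nn_energy p M (rs n) f UNIV)"
    using G_le_liminf[OF f, of UNIV] Liminf_le_Limsup[of sequentially "\<lambda>n. nn_energy p M (rs n) f UNIV"]
    by (auto intro: order_trans)
  ultimately have "enn2ereal (G f UNIV) < \<infinity>"
    unfolding less_eq_ennreal.rep_eq by (rule order_le_less_trans[rotated])
  then show ?thesis by (simp add: less_ennreal.rep_eq top_ennreal.rep_eq infinity_ennreal_def)
qed

lemma Gp_measure:
  assumes f: "f \<in> KS_space p M"
  shows "\<exists>N :: 'a measure. radon_measure N \<and> finite_measure N \<and>
    (\<forall>U. open U \<longrightarrow> Gp f U = enn2ereal (emeasure N U))"
proof -
  have fL: "f \<in> Lp p M" using f by (simp add: KS_space_def)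
  interpret m: de_giorgi_letta "G f" by (rule de_giorgi_letta_G[OF fL])
  have "K \<in> sets borel" if "compact K" for K :: "'a set"
    using that by (simp add: compact_imp_closed)
  then show ?thesis
    using m.radon_borel_extension KS_space_G_finite[OF f] Gp_eq[OF fL] m.borel_extension_open
    by (intro exI[of _ m.borel_extension]) auto
qed

lemma G_tail_tendsto_0:
  assumes f: "f \<in> KS_space p M"
  shows "(\<lambda>k. G f (- cball x0 (real k - 2))) \<longlonglongrightarrow> 0"
proof -
  have fL: "f \<in> Lp p M" using f by (simp add: KS_space_def)
  interpret m: de_giorgi_letta "G f" by (rule de_giorgi_letta_G[OF fL])
  let ?N = m.borel_extension and ?A = "\<lambda>k::nat. - cball x0 (real k - 2)"
  interpret N: finite_measure ?N
    using KS_space_G_finite[OF f] by (intro m.radon_borel_extension) (auto simp: compact_imp_closed)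
  have "(\<lambda>k. emeasure ?N (?A k)) \<longlonglongrightarrow> emeasure ?N (\<Inter>k. ?A k)"
    by (intro Lim_emeasure_decseq decseq_SucI)
      (auto simp: m.sets_borel_extension intro!: borel_open)
  moreover have "(\<Inter>k. ?A k) = {}"
  proof -
    have "\<exists>k::nat. dist x0 y \<le> real k - 2" for y
      using real_arch_simple[of "dist x0 y + 2"] by (auto simp: algebra_simps)
    then have "y \<notin> (\<Inter>k. ?A k)" for y by (metis ComplD INT_D UNIV_I mem_cball)
    then show ?thesis by blast
  qed
  ultimately show ?thesis by (simp add: m.borel_extension_open open_Compl)
qed

lemma Gamma_limit_eq:
  assumes f: "f \<in> KS_space p M"
    and gamma: "Gamma_converges p M (\<lambda>n f. KS_energy p M (rs n) f UNIV) Ep"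
  shows "Gp f UNIV = Ep f"
proof (rule antisym)
  have fL: "f \<in> Lp p M" using f by (simp add: KS_space_def)
  obtain fn where fn: "Lp_converges p M fn f" "limsup (\<lambda>n. KS_energy p M (rs n) (fn n) UNIV) \<le> Ep f"
    using gamma[unfolded Gamma_converges_def, THEN conjunct2, rule_format, OF fL] by blast
  have "Gp f UNIV = enn2ereal (G f UNIV)" by (simp add: Gp_eq[OF fL])
  also have "\<dots> \<le> enn2ereal (liminf (\<lambda>n. nn_energy p M (rs n) (fn n) UNIV))"
    using liminf_ineq[OF fn(1), of UNIV] by (simp add: less_eq_ennreal.rep_eq)
  also have "\<dots> = liminf (\<lambda>n. KS_energy p M (rs n) (fn n) UNIV)"
    by (simp add: KS_energy_eq Liminf_enn2ereal)
  also have "\<dots> \<le> limsup (\<lambda>n. KS_energy p M (rs n) (fn n) UNIV)" by (rule Liminf_le_Limsup) simp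
  also note fn(2)
  finally show "Gp f UNIV \<le> Ep f" .

  obtain C where C: "0 < C" and tail: "\<forall>f\<in>Lp p M. \<forall>R x0 \<rho>. 0 < R \<longrightarrow> (1 + 2 * l) * R \<le> 1 \<longrightarrow>
    nn_energy p M R f (- cball x0 \<rho>) \<le> ennreal C * G f (- cball x0 (\<rho> - 2))"
    using nn_energy_tail_le_G by (elim exE conjE)
  fix x0 :: 'a
  have glued: "e2ennreal (Ep f) \<le> ennreal ((1 - d) powr (1 - p)) *
      (G f UNIV + ennreal C * G f (- cball x0 (real k - 2)))" if d: "0 < d" "d < 1" for d and k :: nat
  proof -
    let ?U = "ball x0 (real k + 3)" and ?V = "- cball x0 (real k)"
    define \<phi> where "\<phi> y = max 0 (min 1 (real k + 2 - dist x0 y))" for y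
    have \<phi>01: "0 \<le> \<phi> y" "\<phi> y \<le> 1" for y by (auto simp: \<phi>_def)
    have \<phi>_lip: "\<bar>\<phi> x - \<phi> y\<bar> \<le> 1 * dist x y" for x y
    proof -
      have "\<bar>dist x0 x - dist x0 y\<bar> \<le> dist x y"
        using dist_triangle[of x0 x y] dist_triangle[of x0 y x] by (simp add: dist_commute abs_le_iff)
      then show ?thesis unfolding \<phi>_def by linarith
    qed
    have "?U \<Subset> UNIV" by (intro bounded_imp_compactly_contained) auto
    then obtain u where u: "Lp_converges p M u f"
      "limsup (\<lambda>n. nn_energy p M (rs n) (u n) ?U) \<le> G f UNIV"
      using recovery[OF fL open_ball open_UNIV] by blast
    have U: "x \<in> ?U" if "dist x y < 1" "\<phi> y \<noteq> 0" for x y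
    proof -
      have "dist x0 y < real k + 2" using that(2) by (simp add: \<phi>_def split: if_splits)
      then show ?thesis using that(1) dist_triangle[of x0 x y] by (simp add: dist_commute)
    qed
    have V: "x \<in> ?V" if "dist x y < 1" "\<phi> y \<noteq> 1" for x y
    proof -
      have "real k + 1 < dist x0 y" using that(2) by (simp add: \<phi>_def split: if_splits)
      then show ?thesis using that(1) dist_triangle[of x0 y x] by (simp add: dist_commute)
    qed
    have "\<exists>w. Lp_converges p M w f \<and> limsup (\<lambda>n. nn_energy p M (rs n) (w n) UNIV) \<le>
        ennreal ((1 - d) powr (1 - p)) * (limsup (\<lambda>n. nn_energy p M (rs n) (u n) ?U) +
          limsup (\<lambda>n. nn_energy p M (rs n) f ?V))"
    proof (rule limsup_glue_le[OF fL u(1) Lp_converges_const[OF fL p1] d zero_le_one zero_less_one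
            \<phi>01 \<phi>_lip, of ?U ?V UNIV])
      show "x \<in> ?U" if "dist x y < 1" "\<phi> y \<noteq> 0" for x y by (rule U[OF that])
      show "x \<in> ?V" if "dist x y < 1" "\<phi> y \<noteq> 1" for x y by (rule V[OF that])
    qed (auto simp: open_Compl)
    then obtain w where w: "Lp_converges p M w f" "limsup (\<lambda>n. nn_energy p M (rs n) (w n) UNIV) \<le>
        ennreal ((1 - d) powr (1 - p)) * (limsup (\<lambda>n. nn_energy p M (rs n) (u n) ?U) +
          limsup (\<lambda>n. nn_energy p M (rs n) f ?V))"
      by blast
    have "Ep f \<le> liminf (\<lambda>n. KS_energy p M (rs n) (w n) UNIV)"
      using gamma[unfolded Gamma_converges_def, THEN conjunct1, rule_format, OF fL w(1)] .
    also have "\<dots> \<le> limsup (\<lambda>n. KS_energy p M (rs n) (w n) UNIV)" by (rule Liminf_le_Limsup) simp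
    finally have "e2ennreal (Ep f) \<le> limsup (\<lambda>n. nn_energy p M (rs n) (w n) UNIV)"
      by (simp add: e2ennreal_le_iff KS_energy_eq Limsup_enn2ereal)
    also note w(2)
    finally have le: "e2ennreal (Ep f) \<le> ennreal ((1 - d) powr (1 - p)) *
        (limsup (\<lambda>n. nn_energy p M (rs n) (u n) ?U) + limsup (\<lambda>n. nn_energy p M (rs n) f ?V))" .
    have "limsup (\<lambda>n. nn_energy p M (rs n) f ?V) \<le> ennreal C * G f (- cball x0 (real k - 2))"
    proof (rule Limsup_bounded)
      have "0 < 1 / (1 + 2 * l)" using l by simp
      from eventually_rs_less[OF this]
      show "\<forall>\<^sub>F n in sequentially. nn_energy p M (rs n) f ?V \<le> ennreal C * G f (- cball x0 (real k - 2))"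
      proof eventually_elim
        case (elim n)
        then have "(1 + 2 * l) * rs n \<le> 1" using l by (simp add: field_simps)
        then show ?case using tail fL rs_pos by blast
      qed
    qed
    then have "ennreal ((1 - d) powr (1 - p)) *
        (limsup (\<lambda>n. nn_energy p M (rs n) (u n) ?U) + limsup (\<lambda>n. nn_energy p M (rs n) f ?V)) \<le>
        ennreal ((1 - d) powr (1 - p)) * (G f UNIV + ennreal C * G f (- cball x0 (real k - 2)))"
      using u(2) by (intro mult_left_mono add_mono) auto
    with le show ?thesis by (rule order_trans)
  qed
  have "e2ennreal (Ep f) \<le> G f UNIV"
  proof (rule ennreal_le_of_powr_factor)
    fix d :: real assume d: "0 < d" "d < 1"
    have "(\<lambda>k. ennreal ((1 - d) powr (1 - p)) * (G f UNIV + ennreal C * G f (- cball x0 (real k - 2))))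
        \<longlonglongrightarrow> ennreal ((1 - d) powr (1 - p)) * (G f UNIV + ennreal C * 0)"
      using G_tail_tendsto_0[OF f] by (intro ennreal_tendsto_cmult tendsto_add tendsto_const) auto
    then show "e2ennreal (Ep f) \<le> ennreal ((1 - d) powr (1 - p)) * G f UNIV"
      using glued[OF d] by (intro LIMSEQ_le_const) auto
  qed
  then show "Ep f \<le> Gp f UNIV" by (simp add: e2ennreal_le_iff Gp_eq[OF fL])
qed

lemma energy_bounds:
  "\<exists>C>0. \<forall>f\<in>Lp p M. \<forall>U V W. open U \<longrightarrow> open V \<longrightarrow> open W \<longrightarrow> U \<Subset> V \<longrightarrow> V \<Subset> W \<longrightarrow>
    Limsup (at_right 0) (\<lambda>r. nn_energy p M r f U) \<le> ennreal C * G f V \<and>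
    G f V \<le> liminf (\<lambda>n. nn_energy p M (rs n) f V) \<and>
    liminf (\<lambda>n. nn_energy p M (rs n) f V) \<le> ennreal C * Liminf (at_right 0) (\<lambda>r. nn_energy p M r f W)"
proof -
  let ?k = "1 + 2 * l"
  have k: "0 < ?k" using l by simp
  obtain Ca where Ca: "0 < Ca" and upper: "\<forall>f\<in>Lp p M. \<forall>R U V V'. 0 < R \<longrightarrow> open U \<longrightarrow> open V \<longrightarrow> open V' \<longrightarrow>
    (\<forall>x\<in>U. ball x ((1 + 2 * l) * R) \<subseteq> V) \<longrightarrow> V \<Subset> V' \<longrightarrow>
    nn_energy p M R f U \<le> ennreal Ca * G f V'"
    using nn_energy_le_G by (elim exE conjE)
  obtain Cb where Cb: "0 < Cb" and comp: "\<forall>f h s R U V. f \<in> borel_measurable M \<longrightarrow> h \<in> Lp p M \<longrightarrow>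
    0 < s \<longrightarrow> s \<le> R \<longrightarrow> open U \<longrightarrow> open V \<longrightarrow> (\<forall>x\<in>U. ball x ((1 + 2 * l) * R) \<subseteq> V) \<longrightarrow>
    nn_energy p M R f U \<le> ennreal Cb * (nn_energy p M s h V +
      ennreal (1 / R powr p) * (\<integral>\<^sup>+x. ennreal (\<bar>f x - h x\<bar> powr p) \<partial>M))"
    using nn_energy_comparison by (elim exE conjE)
  define C where "C = max Ca Cb"
  show ?thesis
  proof (intro exI[of _ C] conjI ballI allI impI)
    show "0 < C" using Ca by (simp add: C_def)
    fix f and U V W :: "'a set"
    assume f: "f \<in> Lp p M" and op: "open U" "open V" "open W" and UV: "U \<Subset> V" and VW: "V \<Subset> W"
    show "G f V \<le> liminf (\<lambda>n. nn_energy p M (rs n) f V)" by (rule G_le_liminf[OF f op(2)])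
    show "Limsup (at_right 0) (\<lambda>r. nn_energy p M r f U) \<le> ennreal C * G f V"
    proof (rule Limsup_bounded)
      obtain e N where e: "0 < e" "open N" "N \<Subset> V" "\<forall>r\<le>e. \<forall>x\<in>U. ball x (?k * r) \<subseteq> N"
        using compactly_contained_scale[OF UV op(2) k] by blast
      from eventually_at_right_real[OF e(1)]
      show "\<forall>\<^sub>F r in at_right 0. nn_energy p M r f U \<le> ennreal C * G f V"
      proof eventually_elim
        case (elim r)
        then have "nn_energy p M r f U \<le> ennreal Ca * G f V"
          using e op by (intro upper[rule_format, OF f, of r U N V]) auto
        also have "\<dots> \<le> ennreal C * G f V"
          by (intro mult_right_mono ennreal_leI) (auto simp: C_def)
        finally show ?case .
      qed
    qed
    obtain e N where e: "0 < e" "open N" "N \<Subset> W" "\<forall>r\<le>e. \<forall>x\<in>V. ball x (?k * r) \<subseteq> N"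
      using compactly_contained_scale[OF VW op(3) k] by blast
    have NW: "N \<subseteq> W" using e(3) closure_subset by (auto simp: compactly_contained_def)
    have "nn_energy p M (rs n) f V \<le> ennreal C * Liminf (at_right 0) (\<lambda>r. nn_energy p M r f W)"
      if n: "rs n < e" for n
    proof -
      have "\<forall>\<^sub>F s in at_right 0. nn_energy p M (rs n) f V \<le> ennreal C * nn_energy p M s f W"
        using eventually_at_right_real[OF rs_pos[of n]]
      proof eventually_elim
        case (elim s)
        have sub: "ball x (?k * rs n) \<subseteq> W" if x: "x \<in> V" for x
          using e(4)[rule_format, OF less_imp_le[OF n] x] NW by (rule subset_trans)
        have "nn_energy p M (rs n) f V \<le> ennreal Cb * (nn_energy p M s f W +
            ennreal (1 / rs n powr p) * (\<integral>\<^sup>+x. ennreal (\<bar>f x - f x\<bar> powr p) \<partial>M))"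
          using f elim op sub by (intro comp[rule_format]) (auto simp: Lp_iff)
        also have "\<dots> = ennreal Cb * nn_energy p M s f W" by simp
        also have "\<dots> \<le> ennreal C * nn_energy p M s f W"
          by (intro mult_right_mono ennreal_leI) (auto simp: C_def)
        finally show ?case .
      qed
      then have "nn_energy p M (rs n) f V \<le> Liminf (at_right 0) (\<lambda>s. ennreal C * nn_energy p M s f W)"
        by (rule Liminf_bounded)
      then show ?thesis by (simp add: Liminf_cmult_ennreal)
    qed
    then have ev: "\<forall>\<^sub>F n in sequentially. nn_energy p M (rs n) f V
        \<le> ennreal C * Liminf (at_right 0) (\<lambda>r. nn_energy p M r f W)"
      using eventually_rs_less[OF e(1)] by (rule eventually_mono[rotated])
    have "liminf (\<lambda>n. nn_energy p M (rs n) f V) \<le> limsup (\<lambda>n. nn_energy p M (rs n) f V)"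
      by (rule Liminf_le_Limsup) simp
    also have "\<dots> \<le> ennreal C * Liminf (at_right 0) (\<lambda>r. nn_energy p M r f W)"
      by (rule Limsup_bounded[OF ev])
    finally show "liminf (\<lambda>n. nn_energy p M (rs n) f V) \<le> ennreal C * Liminf (at_right 0) (\<lambda>r. nn_energy p M r f W)" .
  qed
qed

end

lemma cheeger_space_locale:
  assumes "1 < p" "cheeger_space p M"
  shows "\<exists>C0 C1 l. cheeger M C0 p C1 l"
proof -
  obtain C where C: "C > 0" and vd: "\<And>x r. r > 0 \<Longrightarrow> 0 < emeasure M (ball x (2 * r)) \<and>
      emeasure M (ball x (2 * r)) \<le> ennreal C * emeasure M (ball x r) \<and>
      ennreal C * emeasure M (ball x r) < \<infinity>"
    using assms(2) unfolding cheeger_space_def volume_doubling_def by blast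
  obtain C1 l where C1: "C1 > 0" "l \<ge> 1" and pi: "\<And>f x R. \<exists>L. L-lipschitz_on UNIV f \<Longrightarrow> R > 0 \<Longrightarrow>
      (\<integral>\<^sup>+y\<in>ball x R. ennreal (\<bar>f y - ball_average M f x R\<bar> powr p) \<partial>M)
         \<le> ennreal (C1 * R powr p) * (\<integral>\<^sup>+y\<in>ball x (l * R). ennreal (pointwise_lip f y powr p) \<partial>M)"
    using assms(2) unfolding cheeger_space_def poincare_inequality_def by blast
  have sets: "sets M = sets borel" using assms(2) by (simp add: cheeger_space_def radon_measure_def)
  have pos: "0 < emeasure M (ball x r)" if "0 < r" for x r using vd[of "r / 2" x] that by simp
  have fin: "emeasure M (ball x r) < \<infinity>" for x r
  proof (cases "0 < r")
    case True
    then show ?thesis using vd[of r x] C by (auto simp: ennreal_mult_less_top)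
  next
    case False
    then show ?thesis by (simp add: ball_empty)
  qed
  have eq: "emeasure M (ball x r) = ennreal (measure M (ball x r))" for x r
    using fin[of x r] by (simp add: emeasure_eq_ennreal_measure less_top)
  have db: "measure M (ball x (2 * r)) \<le> C * measure M (ball x r)" if "0 < r" for x r
    using vd[OF that, of x] C by (simp add: eq flip: ennreal_mult')
  have "1 \<le> C"
  proof -
    fix x :: 'a
    have "measure M (ball x 1) \<le> measure M (ball x (2 * 1))"
      using emeasure_mono[of "ball x 1" "ball x 2" M] sets by (simp add: eq subset_ball)
    also have "\<dots> \<le> C * measure M (ball x 1)" by (rule db) simp
    finally show ?thesis using pos[of 1 x] by (simp add: eq)
  qed
  then have "cheeger M C p C1 l"
    using sets pos fin db assms(1) C1 pi by unfold_locales blast+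
  then show ?thesis by blast
qed

theorem theorem4p5:
  fixes M :: "'a::complete_space measure"
    and p :: real
    and rs :: "nat \<Rightarrow> real"
    and Ep :: "('a \<Rightarrow> real) \<Rightarrow> ereal"
    and Gp :: "('a \<Rightarrow> real) \<Rightarrow> 'a set \<Rightarrow> ereal"
  assumes "1 < p"
    and "cheeger_space p M"
    and "\<And>n. rs n > 0"
    and "rs \<longlonglongrightarrow> 0"
    and "Gamma_converges p M (\<lambda>n f. KS_energy p M (rs n) f UNIV) Ep"
    and "Gamma_bar_converges p M (\<lambda>n f U. KS_energy p M (rs n) f U) Gp"
  shows "(\<forall>f\<in>KS_space p M.
            (\<exists>N :: 'a measure. radon_measure N \<and> finite_measure N \<and>
               (\<forall>U. open U \<longrightarrow> Gp f U = enn2ereal (emeasure N U))) \<and>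
            Gp f UNIV = Ep f) \<and>
         (\<exists>(C1::real) (C2::real). C1 > 0 \<and> C2 > 0 \<and>
            (\<forall>f\<in>KS_space p M. \<forall>U V W.
               open U \<and> open V \<and> open W \<and> U \<Subset> V \<and> V \<Subset> W \<longrightarrow>
                 ereal C1 * Limsup (at_right 0) (\<lambda>r. KS_energy p M r f U) \<le> Gp f V \<and>
                 Gp f V \<le> liminf (\<lambda>n. KS_energy p M (rs n) f V) \<and>
                 liminf (\<lambda>n. KS_energy p M (rs n) f V)
                   \<le> ereal C2 * Liminf (at_right 0) (\<lambda>r. KS_energy p M r f W)))"
proof -
  obtain C0 K l where "cheeger M C0 p K l" using cheeger_space_locale[OF assms(1,2)] by blast
  then interpret cheeger M C0 p K l .
  interpret korevaar_schoen_limit M C0 p K l rs Gp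
    using assms(3,4,6) by unfold_locales
  obtain C where C: "0 < C" and bounds: "\<forall>f\<in>Lp p M. \<forall>U V W. open U \<longrightarrow> open V \<longrightarrow> open W \<longrightarrow> U \<Subset> V \<longrightarrow> V \<Subset> W \<longrightarrow>
    Limsup (at_right 0) (\<lambda>r. nn_energy p M r f U) \<le> ennreal C * G f V \<and>
    G f V \<le> liminf (\<lambda>n. nn_energy p M (rs n) f V) \<and>
    liminf (\<lambda>n. nn_energy p M (rs n) f V) \<le> ennreal C * Liminf (at_right 0) (\<lambda>r. nn_energy p M r f W)"
    using energy_bounds by (elim exE conjE)
  have "\<forall>f\<in>KS_space p M. \<forall>U V W.
      open U \<and> open V \<and> open W \<and> U \<Subset> V \<and> V \<Subset> W \<longrightarrow>
      ereal (1 / C) * Limsup (at_right 0) (\<lambda>r. KS_energy p M r f U) \<le> Gp f V \<and>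
      Gp f V \<le> liminf (\<lambda>n. KS_energy p M (rs n) f V) \<and>
      liminf (\<lambda>n. KS_energy p M (rs n) f V) \<le> ereal C * Liminf (at_right 0) (\<lambda>r. KS_energy p M r f W)"
  proof (intro ballI allI impI)
    fix f and U V W :: "'a set"
    assume "f \<in> KS_space p M" and op: "open U \<and> open V \<and> open W \<and> U \<Subset> V \<and> V \<Subset> W"
    then have f: "f \<in> Lp p M" by (simp add: KS_space_def)
    have C': "ereal a * enn2ereal x = enn2ereal (ennreal a * x)" if "0 \<le> a" for a x
      using that by (simp add: times_ennreal.rep_eq enn2ereal_ennreal)
    have b: "Limsup (at_right 0) (\<lambda>r. nn_energy p M r f U) \<le> ennreal C * G f V"
      "G f V \<le> liminf (\<lambda>n. nn_energy p M (rs n) f V)"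
      "liminf (\<lambda>n. nn_energy p M (rs n) f V) \<le> ennreal C * Liminf (at_right 0) (\<lambda>r. nn_energy p M r f W)"
      using bounds f op by blast+
    have "ennreal (1 / C) * Limsup (at_right 0) (\<lambda>r. nn_energy p M r f U) \<le> ennreal (1 / C) * (ennreal C * G f V)"
      by (intro mult_left_mono b) simp
    also have "\<dots> = G f V" using C by (simp flip: mult.assoc ennreal_mult')
    finally have b1: "ennreal (1 / C) * Limsup (at_right 0) (\<lambda>r. nn_energy p M r f U) \<le> G f V" .
    show "ereal (1 / C) * Limsup (at_right 0) (\<lambda>r. KS_energy p M r f U) \<le> Gp f V \<and>
      Gp f V \<le> liminf (\<lambda>n. KS_energy p M (rs n) f V) \<and>
      liminf (\<lambda>n. KS_energy p M (rs n) f V) \<le> ereal C * Liminf (at_right 0) (\<lambda>r. KS_energy p M r f W)"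
      using b1 b(2,3) C op
      by (simp add: KS_energy_eq Limsup_enn2ereal Liminf_enn2ereal Gp_eq[OF f] C' less_eq_ennreal.rep_eq[symmetric]
          del: times_divide_eq_left)
  qed
  then have "\<exists>C1 C2. C1 > 0 \<and> C2 > 0 \<and> (\<forall>f\<in>KS_space p M. \<forall>U V W.
      open U \<and> open V \<and> open W \<and> U \<Subset> V \<and> V \<Subset> W \<longrightarrow>
      ereal C1 * Limsup (at_right 0) (\<lambda>r. KS_energy p M r f U) \<le> Gp f V \<and>
      Gp f V \<le> liminf (\<lambda>n. KS_energy p M (rs n) f V) \<and>
      liminf (\<lambda>n. KS_energy p M (rs n) f V) \<le> ereal C2 * Liminf (at_right 0) (\<lambda>r. KS_energy p M r f W))"
    using C by (intro exI[of _ "1 / C"] exI[of _ C] conjI) auto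
  moreover have "\<forall>f\<in>KS_space p M. (\<exists>N :: 'a measure. radon_measure N \<and> finite_measure N \<and>
      (\<forall>U. open U \<longrightarrow> Gp f U = enn2ereal (emeasure N U))) \<and> Gp f UNIV = Ep f"
    using Gp_measure Gamma_limit_eq[OF _ assms(5)] by blast
  ultimately show ?thesis by (rule conjI[rotated])
qed

end
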